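(* There exists an (even commutative) short local algebra $A$ of Hilbert type $(6,2)$ with a non-projective $3$-torsionfree module $M$ having dimension vector $(2,2)$.
   Context: Let $k$ be an arbitrary fixed field. All algebras $A$ are finite-dimensional local $k$-algebras with radical $J$ such that $A/J=k$. $A$ is short if $J^3=0$. $|M|$ denotes the length of a module $M$. The Hilbert type of a short local algebra $A$ is $(|J/J^2|,|J^2|)$. Modules are left $A$-modules of finite length. If $M$ has Loewy length at most $2$, its dimension vector is $(|M/JM|,|JM|)$. A module $M$ is $n$-torsionfree if $\operatorname{Ext}^i(\operatorname{Tr}M,A)=0$ for $1\le i\le n$, where $\operatorname{Tr}$ is Auslander's transpose (so $\operatorname{Tr}M$ is a right module and Ext is formed with $A_A$). *)

theory Defs
  imports "HOL-Algebra.Module" "HOL-Algebra.QuotRing" "HOL-Algebra.Ideal_Product"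
    "HOL-Algebra.Elementary_Groups"
begin

text \<open>
  The locale \<open>module\<close> of the library only covers commutative rings of scalars. The notions needed
  here involve left modules over arbitrary rings; right \<open>R\<close>-modules are left modules over the
  opposite ring. In records of type \<open>module\<close> that are used as modules only, the fields \<open>mult\<close> and
  \<open>one\<close> carry no information.
\<close>

locale lmodule = R?: ring R + M?: abelian_group M
  for R :: "('r, 'e) ring_scheme" (structure) and M :: "('r, 'm) module" (structure) +
  assumes smult_closed:
      "\<lbrakk>a \<in> carrier R; x \<in> carrier M\<rbrakk> \<Longrightarrow> a \<odot>\<^bsub>M\<^esub> x \<in> carrier M"
    and smult_l_distr:
      "\<lbrakk>a \<in> carrier R; b \<in> carrier R; x \<in> carrier M\<rbrakk> \<Longrightarrow>
        (a \<oplus>\<^bsub>R\<^esub> b) \<odot>\<^bsub>M\<^esub> x = (a \<odot>\<^bsub>M\<^esub> x) \<oplus>\<^bsub>M\<^esub> (b \<odot>\<^bsub>M\<^esub> x)"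
    and smult_r_distr:
      "\<lbrakk>a \<in> carrier R; x \<in> carrier M; y \<in> carrier M\<rbrakk> \<Longrightarrow>
        a \<odot>\<^bsub>M\<^esub> (x \<oplus>\<^bsub>M\<^esub> y) = (a \<odot>\<^bsub>M\<^esub> x) \<oplus>\<^bsub>M\<^esub> (a \<odot>\<^bsub>M\<^esub> y)"
    and smult_assoc:
      "\<lbrakk>a \<in> carrier R; b \<in> carrier R; x \<in> carrier M\<rbrakk> \<Longrightarrow>
        (a \<otimes>\<^bsub>R\<^esub> b) \<odot>\<^bsub>M\<^esub> x = a \<odot>\<^bsub>M\<^esub> (b \<odot>\<^bsub>M\<^esub> x)"
    and smult_one:
      "x \<in> carrier M \<Longrightarrow> \<one>\<^bsub>R\<^esub> \<odot>\<^bsub>M\<^esub> x = x"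

definition opposite_ring :: "('r, 'e) ring_scheme \<Rightarrow> 'r ring" where
  "opposite_ring R =
    \<lparr>carrier = carrier R, mult = (\<lambda>a b. b \<otimes>\<^bsub>R\<^esub> a), one = \<one>\<^bsub>R\<^esub>, zero = \<zero>\<^bsub>R\<^esub>, add = add R\<rparr>"

definition regular_module :: "('r, 'e) ring_scheme \<Rightarrow> ('r, 'r) module" where
  "regular_module R =
    \<lparr>carrier = carrier R, mult = mult R, one = \<one>\<^bsub>R\<^esub>, zero = \<zero>\<^bsub>R\<^esub>, add = add R, smult = mult R\<rparr>"

definition quot_module :: "('r, 'm) module \<Rightarrow> 'm set \<Rightarrow> ('r, 'm set) module" where
  "quot_module M U =
    \<lparr>carrier = a_rcosets\<^bsub>M\<^esub> U, mult = undefined, one = undefined, zero = U, add = set_add M,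
     smult = (\<lambda>a X. \<Union>x\<in>X. U +>\<^bsub>M\<^esub> (a \<odot>\<^bsub>M\<^esub> x))\<rparr>"

text \<open>The submodule \<open>I M\<close>; compare \<^const>\<open>ideal_prod\<close>.\<close>

inductive_set ideal_smult :: "'r set \<Rightarrow> ('r, 'm) module \<Rightarrow> 'm set \<Rightarrow> 'm set" for I M U where
  smult: "\<lbrakk>a \<in> I; x \<in> U\<rbrakk> \<Longrightarrow> a \<odot>\<^bsub>M\<^esub> x \<in> ideal_smult I M U"
| add: "\<lbrakk>x \<in> ideal_smult I M U; y \<in> ideal_smult I M U\<rbrakk> \<Longrightarrow> x \<oplus>\<^bsub>M\<^esub> y \<in> ideal_smult I M U"

definition finitely_generated :: "('r, 'e) ring_scheme \<Rightarrow> ('r, 'm) module \<Rightarrow> bool" where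
  "finitely_generated R M \<longleftrightarrow>
    (\<exists>B. finite B \<and> B \<subseteq> carrier M \<and> (\<forall>U. submodule U R M \<and> B \<subseteq> U \<longrightarrow> U = carrier M))"

text \<open>
  \<open>M\<close> has a composition series with \<open>n\<close> factors; by the Jordan--Hoelder theorem
  \<open>n\<close> is then determined by \<open>M\<close>.
\<close>

definition has_length :: "('r, 'e) ring_scheme \<Rightarrow> ('r, 'm) module \<Rightarrow> nat \<Rightarrow> bool" where
  "has_length R M n \<longleftrightarrow>
    (\<exists>U. U 0 = {\<zero>\<^bsub>M\<^esub>} \<and> U n = carrier M \<and> (\<forall>i\<le>n. submodule (U i) R M) \<and>
      (\<forall>i<n. U i \<subset> U (Suc i) \<and> (\<nexists>V. submodule V R M \<and> U i \<subset> V \<and> V \<subset> U (Suc i))))"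

subsection \<open>Short local algebras\<close>

definition maximal_left_ideal :: "('r, 'e) ring_scheme \<Rightarrow> 'r set \<Rightarrow> bool" where
  "maximal_left_ideal R I \<longleftrightarrow>
    submodule I R (regular_module R) \<and> I \<noteq> carrier R \<and>
    (\<forall>L. submodule L R (regular_module R) \<and> I \<subseteq> L \<longrightarrow> L = I \<or> L = carrier R)"

definition radical :: "('r, 'e) ring_scheme \<Rightarrow> 'r set" where
  "radical R = carrier R \<inter> \<Inter> {I. maximal_left_ideal R I}"

text \<open>
  Unlike \<^locale>\<open>algebra\<close>, the following does not require \<open>A\<close> to be commutative. The condition
  \<open>A/J = k\<close> says that the structure map \<open>k \<rightarrow> A \<rightarrow> A/J\<close> is bijective.
\<close>

locale local_algebra = K?: field K + module K A + A?: ring A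
  for K :: "('k, 'e) ring_scheme" (structure) and A :: "('k, 'a) module" (structure) +
  assumes smult_mult_left:
      "\<lbrakk>c \<in> carrier K; a \<in> carrier A; b \<in> carrier A\<rbrakk> \<Longrightarrow>
        (c \<odot>\<^bsub>A\<^esub> a) \<otimes>\<^bsub>A\<^esub> b = c \<odot>\<^bsub>A\<^esub> (a \<otimes>\<^bsub>A\<^esub> b)"
    and smult_mult_right:
      "\<lbrakk>c \<in> carrier K; a \<in> carrier A; b \<in> carrier A\<rbrakk> \<Longrightarrow>
        a \<otimes>\<^bsub>A\<^esub> (c \<odot>\<^bsub>A\<^esub> b) = c \<odot>\<^bsub>A\<^esub> (a \<otimes>\<^bsub>A\<^esub> b)"
    and finite_dimensional: "finitely_generated K A"
    and local: "\<exists>!I. maximal_left_ideal A I"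
    and residue_field:
      "(\<lambda>c. radical A +>\<^bsub>A\<^esub> (c \<odot>\<^bsub>A\<^esub> \<one>\<^bsub>A\<^esub>)) \<in> ring_iso K (A Quot (radical A))"

definition short :: "('r, 'e) ring_scheme \<Rightarrow> bool" where
  "short A \<longleftrightarrow> ideal_prod A (ideal_prod A (radical A) (radical A)) (radical A) = {\<zero>\<^bsub>A\<^esub>}"

definition has_hilbert_type :: "('r, 'e) ring_scheme \<Rightarrow> nat \<Rightarrow> nat \<Rightarrow> bool" where
  "has_hilbert_type A e a \<longleftrightarrow>
    (let J = radical A; J2 = ideal_prod A J J in
      has_length A (quot_module ((regular_module A)\<lparr>carrier := J\<rparr>) J2) e \<and>
      has_length A ((regular_module A)\<lparr>carrier := J2\<rparr>) a)"

definition has_dimension_vector :: "('r, 'e) ring_scheme \<Rightarrow> ('r, 'm) module \<Rightarrow> nat \<Rightarrow> nat \<Rightarrow> bool" where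
  "has_dimension_vector A M t s \<longleftrightarrow>
    (let J = radical A; JM = ideal_smult J M (carrier M) in
      ideal_smult J M JM = {\<zero>\<^bsub>M\<^esub>} \<and>
      has_length A (quot_module M JM) t \<and>
      has_length A (M\<lparr>carrier := JM\<rparr>) s)"

subsection \<open>Homomorphisms and projective modules\<close>

definition mhom :: "('r, 'e) ring_scheme \<Rightarrow> ('r, 'm) module \<Rightarrow> ('r, 'n) module \<Rightarrow> ('m \<Rightarrow> 'n) set" where
  "mhom R M N = {f \<in> carrier M \<rightarrow>\<^sub>E carrier N.
    (\<forall>x\<in>carrier M. \<forall>y\<in>carrier M. f (x \<oplus>\<^bsub>M\<^esub> y) = f x \<oplus>\<^bsub>N\<^esub> f y) \<and>
    (\<forall>a\<in>carrier R. \<forall>x\<in>carrier M. f (a \<odot>\<^bsub>M\<^esub> x) = a \<odot>\<^bsub>N\<^esub> f x)}"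

definition mkernel :: "('r, 'm) module \<Rightarrow> ('r, 'n) module \<Rightarrow> ('m \<Rightarrow> 'n) \<Rightarrow> 'm set" where
  "mkernel M N f = {x \<in> carrier M. f x = \<zero>\<^bsub>N\<^esub>}"

text \<open>
  Modules that are quantified over inside a definition have elements of type \<^typ>\<open>nat \<Rightarrow> 'r\<close>, where
  \<^typ>\<open>'r\<close> is the element type of the ring. This loses nothing: for every \<open>n\<close> the free module
  \<open>R\<^sup>n\<close>, hence (choosing representatives of cosets) every finitely generated \<open>R\<close>-module, has an
  isomorphic copy on this type.
\<close>

definition projective :: "('r, 'e) ring_scheme \<Rightarrow> ('r, 'm) module \<Rightarrow> bool" where
  "projective R P \<longleftrightarrow> lmodule R P \<and>
    (\<forall>(X :: ('r, nat \<Rightarrow> 'r) module) (Y :: ('r, nat \<Rightarrow> 'r) module) g f.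
      lmodule R X \<and> lmodule R Y \<and>
      g \<in> mhom R X Y \<and> g ` carrier X = carrier Y \<and> f \<in> mhom R P Y \<longrightarrow>
      (\<exists>h \<in> mhom R P X. \<forall>x\<in>carrier P. g (h x) = f x))"

definition projective_cover ::
    "('r, 'e) ring_scheme \<Rightarrow> ('r, 'p) module \<Rightarrow> ('r, 'm) module \<Rightarrow> ('p \<Rightarrow> 'm) \<Rightarrow> bool" where
  "projective_cover R P M p \<longleftrightarrow>
    projective R P \<and> p \<in> mhom R P M \<and> p ` carrier P = carrier M \<and>
    (\<forall>U. submodule U R P \<and> p ` U = carrier M \<longrightarrow> U = carrier P)"

subsection \<open>Ext\<close>

definition projective_resolution ::
    "('r, 'e) ring_scheme \<Rightarrow> ('r, 'm) module \<Rightarrow> (nat \<Rightarrow> ('r, 'p) module) \<Rightarrow> (nat \<Rightarrow> 'p \<Rightarrow> 'p) \<Rightarrow>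
      ('p \<Rightarrow> 'm) \<Rightarrow> bool" where
  "projective_resolution R N P d e \<longleftrightarrow>
    (\<forall>i. projective R (P i)) \<and>
    (\<forall>i. d i \<in> mhom R (P (Suc i)) (P i)) \<and> e \<in> mhom R (P 0) N \<and>
    e ` carrier (P 0) = carrier N \<and>
    d 0 ` carrier (P 1) = mkernel (P 0) N e \<and>
    (\<forall>i. d (Suc i) ` carrier (P (Suc (Suc i))) = mkernel (P (Suc i)) (P i) (d i))"

definition hom_group :: "('r, 'e) ring_scheme \<Rightarrow> ('r, 'm) module \<Rightarrow> ('r, 'n) module \<Rightarrow> ('m \<Rightarrow> 'n) monoid" where
  "hom_group R M N =
    \<lparr>carrier = mhom R M N, mult = (\<lambda>f g. \<lambda>x\<in>carrier M. f x \<oplus>\<^bsub>N\<^esub> g x), one = (\<lambda>x\<in>carrier M. \<zero>\<^bsub>N\<^esub>)\<rparr>"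

text \<open>
  The complex \<open>Hom(P, X)\<close> of a resolution \<open>P\<close> with differentials \<open>d i : P (i+1) \<rightarrow> P i\<close>, and its
  cohomology.
\<close>

definition cocycles ::
    "('r, 'e) ring_scheme \<Rightarrow> (nat \<Rightarrow> ('r, 'p) module) \<Rightarrow> (nat \<Rightarrow> 'p \<Rightarrow> 'p) \<Rightarrow> ('r, 'x) module \<Rightarrow>
      nat \<Rightarrow> ('p \<Rightarrow> 'x) set" where
  "cocycles R P d X i = {g \<in> mhom R (P i) X. \<forall>x\<in>carrier (P (Suc i)). g (d i x) = \<zero>\<^bsub>X\<^esub>}"

fun coboundaries ::
    "('r, 'e) ring_scheme \<Rightarrow> (nat \<Rightarrow> ('r, 'p) module) \<Rightarrow> (nat \<Rightarrow> 'p \<Rightarrow> 'p) \<Rightarrow> ('r, 'x) module \<Rightarrow>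
      nat \<Rightarrow> ('p \<Rightarrow> 'x) set" where
  "coboundaries R P d X 0 = {\<lambda>x\<in>carrier (P 0). \<zero>\<^bsub>X\<^esub>}"
| "coboundaries R P d X (Suc i) = {compose (carrier (P (Suc i))) h (d i) | h. h \<in> mhom R (P i) X}"

definition cohomology ::
    "('r, 'e) ring_scheme \<Rightarrow> (nat \<Rightarrow> ('r, 'p) module) \<Rightarrow> (nat \<Rightarrow> 'p \<Rightarrow> 'p) \<Rightarrow> ('r, 'x) module \<Rightarrow>
      nat \<Rightarrow> ('p \<Rightarrow> 'x) set monoid" where
  "cohomology R P d X i =
    ((hom_group R (P i) X)\<lparr>carrier := cocycles R P d X i\<rparr>) Mod (coboundaries R P d X i)"

text \<open>
  \<open>Ext\<^sup>i(N, X) = 0\<close>. Up to isomorphism the cohomology group does not depend on the resolution,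
  so its vanishing may be stated for some projective resolution.
\<close>

definition Ext_vanishes ::
    "('r, 'e) ring_scheme \<Rightarrow> ('r, 'm) module \<Rightarrow> ('r, 'x) module \<Rightarrow> nat \<Rightarrow> bool" where
  "Ext_vanishes R N X i \<longleftrightarrow>
    (\<exists>(P :: nat \<Rightarrow> ('r, nat \<Rightarrow> 'r) module) d e.
      projective_resolution R N P d e \<and> trivial_group (cohomology R P d X i))"

subsection \<open>Transpose and torsionfreeness\<close>

text \<open>\<open>Hom\<^sub>R(P, R)\<close> as a right \<open>R\<close>-module, via \<open>(f a)(x) = f(x) a\<close>.\<close>

definition dual_module :: "('r, 'e) ring_scheme \<Rightarrow> ('r, 'm) module \<Rightarrow> ('r, 'm \<Rightarrow> 'r) module" where
  "dual_module R P =
    \<lparr>carrier = mhom R P (regular_module R), mult = undefined, one = undefined,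
     zero = (\<lambda>x\<in>carrier P. \<zero>\<^bsub>R\<^esub>), add = (\<lambda>f g. \<lambda>x\<in>carrier P. f x \<oplus>\<^bsub>R\<^esub> g x),
     smult = (\<lambda>a f. \<lambda>x\<in>carrier P. f x \<otimes>\<^bsub>R\<^esub> a)\<rparr>"

text \<open>
  The right module \<open>N\<close> is a transpose of \<open>M\<close>: for a minimal projective presentation
  \<open>P1 \<rightarrow> P0 \<rightarrow> M \<rightarrow> 0\<close> with first map \<open>f\<close>, it is the cokernel of
  \<open>Hom(f, R) : Hom(P0, R) \<rightarrow> Hom(P1, R)\<close>.
\<close>

definition is_transpose ::
    "('r, 'e) ring_scheme \<Rightarrow> ('r, 'm) module \<Rightarrow> ('r, 'n) module \<Rightarrow> bool" where
  "is_transpose R M N \<longleftrightarrow> lmodule (opposite_ring R) N \<and>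
    (\<exists>(P0 :: ('r, nat \<Rightarrow> 'r) module) (P1 :: ('r, nat \<Rightarrow> 'r) module) p f q.
      projective_cover R P0 M p \<and>
      projective_cover R P1 (P0\<lparr>carrier := mkernel P0 M p\<rparr>) f \<and>
      q \<in> mhom (opposite_ring R) (dual_module R P1) N \<and>
      q ` carrier (dual_module R P1) = carrier N \<and>
      mkernel (dual_module R P1) N q =
        (\<lambda>g. compose (carrier P1) g f) ` carrier (dual_module R P0))"

text \<open>\<open>Tr M\<close> is determined up to isomorphism, so any transpose \<open>N\<close> may be used.\<close>

definition torsionfree :: "nat \<Rightarrow> ('r, 'e) ring_scheme \<Rightarrow> ('r, 'm) module \<Rightarrow> bool" where
  "torsionfree n R M \<longleftrightarrow>
    (\<exists>N :: ('r, nat \<Rightarrow> 'r) module. is_transpose R M N \<and>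
      (\<forall>i\<in>{1..n}. Ext_vanishes (opposite_ring R) N (regular_module (opposite_ring R)) i))"

end

theory Submission
  imports Defs
begin

text \<open>
  Let \<open>A\<close> have the \<open>K\<close>-basis \<open>1, u\<^sub>1, u\<^sub>2, y\<^sub>1, y\<^sub>2, y\<^sub>3, y\<^sub>4, w\<^sub>1, w\<^sub>2\<close>, where the only nonzero products of
  basis vectors different from \<open>1\<close> are
  \<open>u\<^sub>1 y\<^sub>1 = u\<^sub>2 y\<^sub>3 = w\<^sub>1\<close> and \<open>u\<^sub>1 y\<^sub>2 = u\<^sub>2 y\<^sub>4 = w\<^sub>2\<close>, and let \<open>M\<close> be the ideal
  \<open>(u\<^sub>1, u\<^sub>2)\<close>, which has the basis \<open>u\<^sub>1, u\<^sub>2, w\<^sub>1, w\<^sub>2\<close>. More intrinsically, \<open>M = U \<oplus> W\<close> and the \<open>y\<^sub>i\<close>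
  span \<open>Hom(U, W)\<close> for two planes \<open>U\<close> and \<open>W\<close>; the multiplication \<open>U \<times> Hom(U, W) \<rightarrow> W\<close> is evaluation.
  So \<open>y \<mapsto> (u\<^sub>1 y, u\<^sub>2 y)\<close> maps the span of the \<open>y\<^sub>i\<close> isomorphically onto \<open>W\<^sup>2\<close>. It follows that

  \<^item> \<open>M\<close> is its own annihilator;
  \<^item> every homomorphism \<open>M \<rightarrow> A\<close> is the multiplication by an element of \<open>A\<close>.

  For the second claim let \<open>u\<^sub>i \<mapsto> a\<^sub>i\<close>. The relations \<open>u\<^sub>j u\<^sub>i = 0\<close> put \<open>a\<^sub>1, a\<^sub>2\<close> into the annihilator
  \<open>M\<close>. The relations \<open>y\<^sub>3 u\<^sub>1 = y\<^sub>4 u\<^sub>1 = 0\<close>, \<open>y\<^sub>1 u\<^sub>2 = y\<^sub>2 u\<^sub>2 = 0\<close> and \<open>y\<^sub>1 u\<^sub>1 = y\<^sub>3 u\<^sub>2\<close> make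
  the linear part of \<open>(a\<^sub>1, a\<^sub>2)\<close> a multiple \<open>\<lambda> (u\<^sub>1, u\<^sub>2)\<close>, and what remains lies in \<open>W\<^sup>2\<close> and is
  therefore of the form \<open>(y u\<^sub>1, y u\<^sub>2)\<close>.

  The two claims decide the question. Let \<open>p : A\<^sup>2 \<rightarrow> A\<close> have the entries \<open>u\<^sub>1, u\<^sub>2\<close>. It is a projective
  cover of its image \<open>M\<close>. Let \<open>f : A\<^sup>m \<rightarrow> A\<^sup>2\<close> be a projective cover of the kernel of \<open>p\<close>. Then \<open>Tr M\<close> is the cokernel
  of the transpose \<open>f\<^sup>T\<close>. The kernel of \<open>f\<^sup>T\<close> is \<open>Hom(M, A)\<close>, by the second claim the
  image of \<open>p\<^sup>T : A \<rightarrow> A\<^sup>2\<close>, and the kernel of \<open>p\<^sup>T\<close> is the annihilator of \<open>M\<close>, by the first claim the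
  image of \<open>p\<close>. Hence \<open>Tr M\<close> has a free resolution starting with
  \<open>A\<^sup>m \<rightarrow> A\<^sup>2 \<rightarrow> A \<rightarrow> A\<^sup>2 \<rightarrow> A\<^sup>m\<close>, the maps being \<open>f, p, p\<^sup>T, f\<^sup>T\<close>. Transposition turns this sequence into
  itself, and its exactness at the three middle terms is the vanishing of \<open>Ext\<^sup>i(Tr M, A)\<close> for
  \<open>i = 1, 2, 3\<close>. This part, \<open>torsionfree_3_embed_idealI\<close>, holds over every noetherian commutative
  local ring whose maximal ideal has cube zero.

  The rest is linear algebra. Submodules of free modules are finitely generated because free modules have
  finite length, and all lengths are read off from \<open>K\<close>-valued coordinates by
  \<open>has_length_by_coordinates\<close>. Finally \<open>M\<close> is not projective: a section of \<open>A\<^sup>2 \<rightarrow> M\<close>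
  would send \<open>u\<^sub>1\<close> to a vector with a unit as first entry, but \<open>u\<^sub>1\<close> annihilates \<open>u\<^sub>1\<close> and not this vector.
\<close>

section \<open>Commutative rings and their opposites\<close>

text \<open>
  Over a commutative ring the modules used here are those of the locale \<open>module\<close>, and right modules
  are left modules. So all arguments can take place in \<open>module\<close>, over the given ring.
\<close>

lemma lmodule_iff_module: "cring R \<Longrightarrow> lmodule R M \<longleftrightarrow> module R M"
  unfolding lmodule_def module_def lmodule_axioms_def module_axioms_def
  by (auto simp: cring.axioms(1))

lemma cring_opposite_ring:
  assumes "cring R" shows "cring (opposite_ring R)"
proof -
  interpret cring R by fact
  show ?thesis
    by (intro cringI abelian_groupI comm_monoidI)
       (auto simp: opposite_ring_def a_ac m_ac r_distr l_distr intro: a_inv_closed l_neg exI)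
qed

lemma module_opposite_ring:
  assumes "cring R" shows "module (opposite_ring R) M \<longleftrightarrow> module R M"
proof -
  interpret cring R by fact
  note op = cring_opposite_ring[OF assms]
  show ?thesis
    unfolding module_def module_axioms_def using assms op
    by (auto simp: opposite_ring_def m_comm)
qed

context
  fixes R :: "('a, 'e) ring_scheme" (structure)
  assumes R: "cring R"
begin

interpretation cring R by (fact R)

lemma mhom_opposite_ring: "mhom (opposite_ring R) X Y = mhom R X Y"
  by (simp add: mhom_def opposite_ring_def)

lemma projective_opposite_ring: "projective (opposite_ring R) P \<longleftrightarrow> projective R P"
  by (simp add: projective_def mhom_opposite_ring lmodule_iff_module[OF R]
    lmodule_iff_module[OF cring_opposite_ring[OF R]] module_opposite_ring[OF R])

lemma mhom_regular_opposite_ring: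
  "mhom R P (regular_module (opposite_ring R)) = mhom R P (regular_module R)"
  by (fastforce simp: mhom_def regular_module_def opposite_ring_def m_comm PiE_iff)

text \<open>
  Outside the carrier the multiplications of \<open>R\<close> and of its opposite may differ, so the two regular
  modules need not be equal as records. But homomorphisms, and with them resolutions and cochain complexes,
  only see the multiplication on the carrier.
\<close>

lemma Ext_vanishes_opposite_ring:
  "Ext_vanishes (opposite_ring R) N (regular_module (opposite_ring R)) i
    \<longleftrightarrow> Ext_vanishes R N (regular_module R) i"
proof -
  have coc: "cocycles (opposite_ring R) P d (regular_module (opposite_ring R)) i
      = cocycles R P d (regular_module R) i" for P d and i :: nat
    unfolding cocycles_def mhom_opposite_ring mhom_regular_opposite_ring
    by (simp add: regular_module_def opposite_ring_def)
  have cob: "coboundaries (opposite_ring R) P d (regular_module (opposite_ring R)) i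
      = coboundaries R P d (regular_module R) i" for P d and i :: nat
    unfolding mhom_opposite_ring mhom_regular_opposite_ring
    by (cases i) (simp_all add: mhom_opposite_ring mhom_regular_opposite_ring,
      simp add: regular_module_def opposite_ring_def)
  have hg: "hom_group (opposite_ring R) X (regular_module (opposite_ring R))
      = hom_group R X (regular_module R)" for X
    unfolding hom_group_def mhom_opposite_ring mhom_regular_opposite_ring
    by (simp add: regular_module_def opposite_ring_def)
  show ?thesis
    unfolding Ext_vanishes_def cohomology_def projective_resolution_def
    by (simp add: coc cob hg mhom_opposite_ring projective_opposite_ring)
qed

end

lemma (in abelian_monoid) finsum_lessThan_Suc:
  "(\<And>i. i \<le> n \<Longrightarrow> f i \<in> carrier G) \<Longrightarrow> finsum G f {..<Suc n} = f n \<oplus> finsum G f {..<n}"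
  unfolding lessThan_Suc by (subst finsum_insert) auto

lemma (in abelian_monoid) finsum_lessThan_induct:
  fixes n :: nat
  assumes "S \<subseteq> carrier G" "\<zero> \<in> S" "\<And>x y. x \<in> S \<Longrightarrow> y \<in> S \<Longrightarrow> x \<oplus> y \<in> S"
    and "\<And>i. i < n \<Longrightarrow> f i \<in> S"
  shows "finsum G f {..<n} \<in> S"
  using assms(4)
proof (induction n)
  case 0
  then show ?case using assms by simp
next
  case (Suc n)
  have "finsum G f {..<Suc n} = f n \<oplus> finsum G f {..<n}"
    using Suc.prems assms(1) by (intro finsum_lessThan_Suc) auto
  then show ?case using Suc assms(3) by simp
qed

section \<open>Homomorphisms, submodules and quotients\<close>

lemma mhomD:
  assumes "f \<in> mhom R X Y"
  shows "\<And>x. x \<in> carrier X \<Longrightarrow> f x \<in> carrier Y"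
    and "\<And>x y. x \<in> carrier X \<Longrightarrow> y \<in> carrier X \<Longrightarrow> f (x \<oplus>\<^bsub>X\<^esub> y) = f x \<oplus>\<^bsub>Y\<^esub> f y"
    and "\<And>a x. a \<in> carrier R \<Longrightarrow> x \<in> carrier X \<Longrightarrow> f (a \<odot>\<^bsub>X\<^esub> x) = a \<odot>\<^bsub>Y\<^esub> f x"
    and "f \<in> extensional (carrier X)"
  using assms by (auto simp: mhom_def PiE_iff)

lemma mhomI:
  assumes "\<And>x. x \<in> carrier X \<Longrightarrow> f x \<in> carrier Y"
    and "\<And>x y. x \<in> carrier X \<Longrightarrow> y \<in> carrier X \<Longrightarrow> f (x \<oplus>\<^bsub>X\<^esub> y) = f x \<oplus>\<^bsub>Y\<^esub> f y"
    and "\<And>a x. a \<in> carrier R \<Longrightarrow> x \<in> carrier X \<Longrightarrow> f (a \<odot>\<^bsub>X\<^esub> x) = a \<odot>\<^bsub>Y\<^esub> f x"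
    and "f \<in> extensional (carrier X)"
  shows "f \<in> mhom R X Y"
  using assms by (auto simp: mhom_def PiE_iff)

lemma mhom_restrictI:
  assumes X: "module R X"
    and "\<And>x. x \<in> carrier X \<Longrightarrow> f x \<in> carrier Y"
    and "\<And>x y. x \<in> carrier X \<Longrightarrow> y \<in> carrier X \<Longrightarrow> f (x \<oplus>\<^bsub>X\<^esub> y) = f x \<oplus>\<^bsub>Y\<^esub> f y"
    and "\<And>a x. a \<in> carrier R \<Longrightarrow> x \<in> carrier X \<Longrightarrow> f (a \<odot>\<^bsub>X\<^esub> x) = a \<odot>\<^bsub>Y\<^esub> f x"
  shows "restrict f (carrier X) \<in> mhom R X Y"
proof -
  interpret X: module R X by fact
  show ?thesis using assms(2-) by (intro mhomI) auto
qed

lemma mhom_restrict_codomain: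
  "f \<in> mhom R X Y \<Longrightarrow> f ` carrier X \<subseteq> U \<Longrightarrow> f \<in> mhom R X (Y\<lparr>carrier := U\<rparr>)"
  by (auto simp: mhom_def PiE_iff)

lemma mhom_extend_codomain:
  "f \<in> mhom R X (Y\<lparr>carrier := U\<rparr>) \<Longrightarrow> U \<subseteq> carrier Y \<Longrightarrow> f \<in> mhom R X Y"
  by (auto simp: mhom_def PiE_iff)

lemma mhom_compose:
  assumes X: "module R X" and f: "f \<in> mhom R X Y" and g: "g \<in> mhom R Y Z"
  shows "compose (carrier X) g f \<in> mhom R X Z"
proof -
  interpret X: module R X by fact
  show ?thesis using mhomD[OF f] mhomD[OF g] by (intro mhomI) (auto simp: compose_eq)
qed

lemma mhom_zero:
  assumes X: "module R X" and Y: "module R Y" and f: "f \<in> mhom R X Y"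
  shows "f \<zero>\<^bsub>X\<^esub> = \<zero>\<^bsub>Y\<^esub>"
proof -
  interpret X: module R X by fact
  interpret Y: module R Y by fact
  have "f (\<zero>\<^bsub>R\<^esub> \<odot>\<^bsub>X\<^esub> \<zero>\<^bsub>X\<^esub>) = \<zero>\<^bsub>R\<^esub> \<odot>\<^bsub>Y\<^esub> f \<zero>\<^bsub>X\<^esub>" using mhomD(3)[OF f] by blast
  then show ?thesis using mhomD(1)[OF f] by simp
qed

lemma mhom_minus:
  assumes X: "module R X" and Y: "module R Y" and f: "f \<in> mhom R X Y" and x: "x \<in> carrier X"
  shows "f (\<ominus>\<^bsub>X\<^esub> x) = \<ominus>\<^bsub>Y\<^esub> f x"
proof -
  interpret X: module R X by fact
  interpret Y: module R Y by fact
  have "f (\<ominus>\<^bsub>X\<^esub> x) \<oplus>\<^bsub>Y\<^esub> f x = \<zero>\<^bsub>Y\<^esub>"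
    using mhomD(2)[OF f, of "\<ominus>\<^bsub>X\<^esub> x" x] x by (simp add: X.l_neg mhom_zero[OF X Y f])
  then show ?thesis using mhomD(1)[OF f] x by (metis X.a_inv_closed Y.minus_equality)
qed

lemma submodule_image:
  assumes X: "module R X" and Y: "module R Y" and f: "f \<in> mhom R X Y"
    and U: "submodule U R X"
  shows "submodule (f ` U) R Y"
proof -
  interpret X: module R X by fact
  interpret Y: module R Y by fact
  note D = mhomD[OF f] and U' = X.submoduleE[OF U]
  have z: "\<zero>\<^bsub>X\<^esub> \<in> U" using subgroup.one_closed[OF submodule.axioms(1)[OF U]] by simp
  show ?thesis
  proof (rule Y.submoduleI)
    show "f ` U \<subseteq> carrier Y" using D(1) U'(1) by auto
    show "\<zero>\<^bsub>Y\<^esub> \<in> f ` U" using mhom_zero[OF X Y f] z by force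
    show "\<ominus>\<^bsub>Y\<^esub> a \<in> f ` U" if "a \<in> f ` U" for a
      using that mhom_minus[OF X Y f] U' by (smt (verit) image_iff subsetD)
    show "a \<oplus>\<^bsub>Y\<^esub> b \<in> f ` U" if "a \<in> f ` U" "b \<in> f ` U" for a b
      using that D(2) U' by (smt (verit) image_iff subsetD)
    show "a \<odot>\<^bsub>Y\<^esub> x \<in> f ` U" if "a \<in> carrier R" "x \<in> f ` U" for a x
      using that D(3) U' by (smt (verit) image_iff subsetD)
  qed
qed

lemma submodule_mkernel:
  assumes X: "module R X" and Y: "module R Y" and f: "f \<in> mhom R X Y"
  shows "submodule (mkernel X Y f) R X"
proof -
  interpret X: module R X by fact
  interpret Y: module R Y by fact
  show ?thesis
    using mhom_zero[OF X Y f] mhom_minus[OF X Y f] mhomD[OF f]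
    by (intro X.submoduleI) (auto simp: mkernel_def)
qed

text \<open>
  Equational axioms pass to surjective images; this covers quotients by cosets and by representatives.
\<close>

lemma module_surjective_image:
  assumes X: "module R X" and q: "q ` carrier X = carrier Y"
    and add: "\<And>x y. x \<in> carrier X \<Longrightarrow> y \<in> carrier X \<Longrightarrow> q (x \<oplus>\<^bsub>X\<^esub> y) = q x \<oplus>\<^bsub>Y\<^esub> q y"
    and smult: "\<And>a x. a \<in> carrier R \<Longrightarrow> x \<in> carrier X \<Longrightarrow> q (a \<odot>\<^bsub>X\<^esub> x) = a \<odot>\<^bsub>Y\<^esub> q x"
    and zero: "q \<zero>\<^bsub>X\<^esub> = \<zero>\<^bsub>Y\<^esub>"
  shows "module R Y"
proof -
  interpret X: module R X by fact
  note add' = add[symmetric] and smult' = smult[symmetric] and zero' = zero[symmetric]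
  have mem: "x \<in> carrier X \<Longrightarrow> q x \<in> carrier Y" for x using q by blast
  have ex: "\<exists>x. x \<in> carrier X \<and> y = q x" if "y \<in> carrier Y" for y using q that by blast
  show ?thesis
  proof (rule moduleI[OF X.R.cring_axioms])
    show "abelian_group Y"
    proof (rule abelian_groupI)
      fix x y z assume "x \<in> carrier Y" "y \<in> carrier Y" "z \<in> carrier Y"
      then obtain x' y' z' where *: "x' \<in> carrier X" "x = q x'" "y' \<in> carrier X" "y = q y'"
        "z' \<in> carrier X" "z = q z'" using ex by meson
      show "x \<oplus>\<^bsub>Y\<^esub> y \<oplus>\<^bsub>Y\<^esub> z = x \<oplus>\<^bsub>Y\<^esub> (y \<oplus>\<^bsub>Y\<^esub> z)"
        using * by (simp add: add' X.a_ac)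
    next
      fix x y assume "x \<in> carrier Y" "y \<in> carrier Y"
      then obtain x' y' where *: "x' \<in> carrier X" "x = q x'" "y' \<in> carrier X" "y = q y'"
        using ex by meson
      show "x \<oplus>\<^bsub>Y\<^esub> y \<in> carrier Y" "x \<oplus>\<^bsub>Y\<^esub> y = y \<oplus>\<^bsub>Y\<^esub> x"
        using * mem by (simp_all add: add' X.a_ac)
    next
      show "\<zero>\<^bsub>Y\<^esub> \<in> carrier Y" using mem by (simp add: zero')
    next
      fix x assume "x \<in> carrier Y"
      then obtain x' where *: "x' \<in> carrier X" "x = q x'" using ex by meson
      show "\<zero>\<^bsub>Y\<^esub> \<oplus>\<^bsub>Y\<^esub> x = x" using * by (simp add: add' zero')
      have "q (\<ominus>\<^bsub>X\<^esub> x') \<oplus>\<^bsub>Y\<^esub> x = \<zero>\<^bsub>Y\<^esub>" using * by (simp add: add' zero' X.l_neg)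
      then show "\<exists>y\<in>carrier Y. y \<oplus>\<^bsub>Y\<^esub> x = \<zero>\<^bsub>Y\<^esub>" using * mem by blast
    qed
  next
    fix a x assume "a \<in> carrier R" "x \<in> carrier Y"
    moreover obtain x' where *: "x' \<in> carrier X" "x = q x'" using ex \<open>x \<in> carrier Y\<close> by meson
    ultimately show "a \<odot>\<^bsub>Y\<^esub> x \<in> carrier Y" using mem by (simp add: smult')
  next
    fix a b x assume ab: "a \<in> carrier R" "b \<in> carrier R" and "x \<in> carrier Y"
    then obtain x' where *: "x' \<in> carrier X" "x = q x'" using ex by meson
    show "(a \<oplus>\<^bsub>R\<^esub> b) \<odot>\<^bsub>Y\<^esub> x = a \<odot>\<^bsub>Y\<^esub> x \<oplus>\<^bsub>Y\<^esub> b \<odot>\<^bsub>Y\<^esub> x"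
      "a \<otimes>\<^bsub>R\<^esub> b \<odot>\<^bsub>Y\<^esub> x = a \<odot>\<^bsub>Y\<^esub> (b \<odot>\<^bsub>Y\<^esub> x)"
      using * ab by (simp_all add: add' smult' X.smult_l_distr X.smult_assoc1)
  next
    fix a x y assume a: "a \<in> carrier R" and "x \<in> carrier Y" "y \<in> carrier Y"
    then obtain x' y' where *: "x' \<in> carrier X" "x = q x'" "y' \<in> carrier X" "y = q y'"
      using ex by meson
    show "a \<odot>\<^bsub>Y\<^esub> (x \<oplus>\<^bsub>Y\<^esub> y) = a \<odot>\<^bsub>Y\<^esub> x \<oplus>\<^bsub>Y\<^esub> a \<odot>\<^bsub>Y\<^esub> y"
      using * a by (simp add: add' smult' X.smult_r_distr)
  next
    fix x assume "x \<in> carrier Y"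
    then obtain x' where *: "x' \<in> carrier X" "x = q x'" using ex by meson
    show "\<one>\<^bsub>R\<^esub> \<odot>\<^bsub>Y\<^esub> x = x" using * by (simp add: smult')
  qed
qed

text \<open>
  In the definition of 3-torsionfreeness the transpose has the same type of elements as the free modules
  that present it. Therefore this quotient consists of chosen representatives of the cosets instead of
  the cosets themselves.
\<close>

lemma quotient_on_representatives:
  fixes X :: "('a, 'm) module"
  assumes X: "module R X" and B: "submodule B R X"
  shows "\<exists>(N :: ('a, 'm) module) q. module R N \<and> q \<in> mhom R X N \<and>
    q ` carrier X = carrier N \<and> mkernel X N q = B"
proof -
  interpret X: module R X by fact
  note B' = X.submoduleE[OF B]
  interpret S: abelian_subgroup B X
    using X.a_comm_group submodule.axioms(1)[OF B] by (intro abelian_subgroupI2) auto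
  define rep where "rep x = (SOME y. y \<in> B +>\<^bsub>X\<^esub> x)" for x
  have mem: "x \<in> B +>\<^bsub>X\<^esub> x" if "x \<in> carrier X" for x
    using that X.a_rcosI[of "\<zero>\<^bsub>X\<^esub>" B x] B'(1) by simp
  have rep: "rep x \<in> B +>\<^bsub>X\<^esub> x" if "x \<in> carrier X" for x
    unfolding rep_def using mem[OF that] by (rule someI)
  have repc: "rep x \<in> carrier X" if "x \<in> carrier X" for x
    using S.a_elemrcos_carrier[OF that rep[OF that]] .
  have coset: "B +>\<^bsub>X\<^esub> rep x = B +>\<^bsub>X\<^esub> x" if "x \<in> carrier X" for x
    using S.a_repr_independence'[OF rep[OF that] that] by simp
  have repD: "rep x = rep y" if "B +>\<^bsub>X\<^esub> x = B +>\<^bsub>X\<^esub> y" for x y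
    unfolding rep_def that ..
  have add: "rep (rep x \<oplus>\<^bsub>X\<^esub> rep y) = rep (x \<oplus>\<^bsub>X\<^esub> y)"
    if "x \<in> carrier X" "y \<in> carrier X" for x y
    using that repc coset by (intro repD) (metis S.a_rcos_sum)
  have eq_iff: "B +>\<^bsub>X\<^esub> x = B +>\<^bsub>X\<^esub> y \<longleftrightarrow> x \<ominus>\<^bsub>X\<^esub> y \<in> B"
    if "x \<in> carrier X" "y \<in> carrier X" for x y
    using that S.a_rcos_module[of y x] mem S.a_repr_independence'[of x y]
    by (auto simp: a_minus_def)
  have smult: "rep (a \<odot>\<^bsub>X\<^esub> rep x) = rep (a \<odot>\<^bsub>X\<^esub> x)" if "a \<in> carrier R" "x \<in> carrier X" for a x
  proof -
    have "a \<odot>\<^bsub>X\<^esub> (rep x \<ominus>\<^bsub>X\<^esub> x) \<in> B"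
      using that coset eq_iff repc B'(4) by metis
    then have "a \<odot>\<^bsub>X\<^esub> rep x \<ominus>\<^bsub>X\<^esub> a \<odot>\<^bsub>X\<^esub> x \<in> B"
      using that repc by (simp add: a_minus_def X.smult_r_distr X.smult_r_minus)
    then show ?thesis using that repc eq_iff by (intro repD) auto
  qed
  define N :: "('a, 'm) module" where "N = \<lparr>carrier = rep ` carrier X, mult = undefined,
    one = undefined, zero = rep \<zero>\<^bsub>X\<^esub>, add = \<lambda>x y. rep (x \<oplus>\<^bsub>X\<^esub> y),
    smult = \<lambda>a x. rep (a \<odot>\<^bsub>X\<^esub> x)\<rparr>"
  have N: "module R N"
    by (rule module_surjective_image[OF X, of rep]) (auto simp: N_def add smult)
  moreover have "restrict rep (carrier X) \<in> mhom R X N"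
    by (rule mhom_restrictI[OF X]) (auto simp: N_def add smult)
  moreover have "restrict rep (carrier X) ` carrier X = carrier N"
    by (simp add: N_def)
  moreover have "mkernel X N (restrict rep (carrier X)) = B"
  proof -
    have "rep x = rep \<zero>\<^bsub>X\<^esub> \<longleftrightarrow> x \<in> B" if x: "x \<in> carrier X" for x
    proof -
      have "rep x = rep \<zero>\<^bsub>X\<^esub> \<longleftrightarrow> B +>\<^bsub>X\<^esub> x = B +>\<^bsub>X\<^esub> \<zero>\<^bsub>X\<^esub>"
        using coset[OF x] coset[OF X.zero_closed] repD[of x "\<zero>\<^bsub>X\<^esub>"] by auto
      also have "\<dots> \<longleftrightarrow> x \<ominus>\<^bsub>X\<^esub> \<zero>\<^bsub>X\<^esub> \<in> B" using eq_iff x by blast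
      finally show ?thesis
        using x X.minus_equality[of "\<zero>\<^bsub>X\<^esub>" "\<zero>\<^bsub>X\<^esub>"] by (simp add: a_minus_def)
    qed
    then show ?thesis using B'(1) by (auto simp: mkernel_def N_def)
  qed
  ultimately show ?thesis by blast
qed

section \<open>Free modules\<close>

text \<open>
  The module \<open>R\<^sup>n\<close>. Vectors are extended by zero, so that free modules of all ranks share one type of
  elements and a resolution is a sequence of modules of the same type.
\<close>

definition free_module :: "('a, 'e) ring_scheme \<Rightarrow> nat \<Rightarrow> ('a, nat \<Rightarrow> 'a) module" where
  "free_module R n =
    \<lparr>carrier = {x. (\<forall>i. x i \<in> carrier R) \<and> (\<forall>i\<ge>n. x i = \<zero>\<^bsub>R\<^esub>)}, mult = undefined, one = undefined,
     zero = (\<lambda>i. \<zero>\<^bsub>R\<^esub>), add = (\<lambda>x y i. x i \<oplus>\<^bsub>R\<^esub> y i), smult = (\<lambda>a x i. a \<otimes>\<^bsub>R\<^esub> x i)\<rparr>"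

definition unit_vector :: "('a, 'e) ring_scheme \<Rightarrow> nat \<Rightarrow> nat \<Rightarrow> 'a" where
  "unit_vector R i = (\<lambda>j. if j = i then \<one>\<^bsub>R\<^esub> else \<zero>\<^bsub>R\<^esub>)"

definition lift_hom ::
    "('a, 'e) ring_scheme \<Rightarrow> nat \<Rightarrow> ('a, 'm) module \<Rightarrow> (nat \<Rightarrow> 'm) \<Rightarrow> (nat \<Rightarrow> 'a) \<Rightarrow> 'm" where
  "lift_hom R n X v =
    (\<lambda>x\<in>carrier (free_module R n). \<Oplus>\<^bsub>X\<^esub>i\<in>{..<n}. x i \<odot>\<^bsub>X\<^esub> v i)"

definition dot :: "('a, 'e) ring_scheme \<Rightarrow> nat \<Rightarrow> (nat \<Rightarrow> 'a) \<Rightarrow> (nat \<Rightarrow> 'a) \<Rightarrow> 'a" where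
  "dot R n x y = (\<Oplus>\<^bsub>R\<^esub>i\<in>{..<n}. x i \<otimes>\<^bsub>R\<^esub> y i)"

lemma free_module_simps [simp]:
  "carrier (free_module R n) = {x. (\<forall>i. x i \<in> carrier R) \<and> (\<forall>i\<ge>n. x i = \<zero>\<^bsub>R\<^esub>)}"
  "zero (free_module R n) = (\<lambda>i. \<zero>\<^bsub>R\<^esub>)"
  "add (free_module R n) = (\<lambda>x y i. x i \<oplus>\<^bsub>R\<^esub> y i)"
  "smult (free_module R n) = (\<lambda>a x i. a \<otimes>\<^bsub>R\<^esub> x i)"
  by (simp_all add: free_module_def)

lemma regular_module_simps [simp]:
  "carrier (regular_module R) = carrier R" "zero (regular_module R) = zero R"
  "add (regular_module R) = add R" "smult (regular_module R) = mult R"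
  by (simp_all add: regular_module_def)

lemma finsum_regular_module: "finsum (regular_module R) f A = finsum R f A"
  by (simp add: finsum_def finprod_def)

context cring
begin

lemma module_free_module: "module R (free_module R n)"
proof (rule moduleI[OF cring_axioms])
  show "abelian_group (free_module R n)"
  proof (rule abelian_groupI)
    fix x assume x: "x \<in> carrier (free_module R n)"
    then show "\<exists>y\<in>carrier (free_module R n). y \<oplus>\<^bsub>free_module R n\<^esub> x = \<zero>\<^bsub>free_module R n\<^esub>"
      by (intro bexI[of _ "\<lambda>i. \<ominus> x i"]) (auto simp: l_neg)
  qed (auto simp: a_ac)
qed (auto simp: l_distr r_distr m_assoc)

lemma module_regular_module: "module R (regular_module R)"
proof (rule moduleI[OF cring_axioms])
  show "abelian_group (regular_module R)"
  proof (rule abelian_groupI)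
    fix x assume x: "x \<in> carrier (regular_module R)"
    then show "\<exists>y\<in>carrier (regular_module R). y \<oplus>\<^bsub>regular_module R\<^esub> x = \<zero>\<^bsub>regular_module R\<^esub>"
      by (intro bexI[of _ "\<ominus> x"]) (auto simp: l_neg)
  qed (auto simp: a_ac)
qed (auto simp: l_distr r_distr m_assoc)

lemma unit_vector_closed [simp]: "i < n \<Longrightarrow> unit_vector R i \<in> carrier (free_module R n)"
  by (auto simp: unit_vector_def)

lemma lift_hom_mhom:
  assumes X: "module R X" and v: "\<forall>i<n. v i \<in> carrier X"
  shows "lift_hom R n X v \<in> mhom R (free_module R n) X"
proof -
  interpret X: module R X by fact
  show ?thesis
    unfolding lift_hom_def
  proof (rule mhom_restrictI[OF module_free_module])
    fix a x assume "a \<in> carrier R" "x \<in> carrier (free_module R n)"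
    then show "(\<Oplus>\<^bsub>X\<^esub>i\<in>{..<n}. (a \<odot>\<^bsub>free_module R n\<^esub> x) i \<odot>\<^bsub>X\<^esub> v i) =
        a \<odot>\<^bsub>X\<^esub> (\<Oplus>\<^bsub>X\<^esub>i\<in>{..<n}. x i \<odot>\<^bsub>X\<^esub> v i)"
      using v by (subst X.finsum_smult_ldistr) (auto intro!: X.finsum_cong' simp: X.smult_assoc1)
  next
    fix x y assume xy: "x \<in> carrier (free_module R n)" "y \<in> carrier (free_module R n)"
    have "(\<Oplus>\<^bsub>X\<^esub>i\<in>{..<n}. (x \<oplus>\<^bsub>free_module R n\<^esub> y) i \<odot>\<^bsub>X\<^esub> v i) =
       (\<Oplus>\<^bsub>X\<^esub>i\<in>{..<n}. x i \<odot>\<^bsub>X\<^esub> v i \<oplus>\<^bsub>X\<^esub> y i \<odot>\<^bsub>X\<^esub> v i)"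
      using v xy by (intro X.finsum_cong') (auto simp: X.smult_l_distr)
    also have "\<dots> = (\<Oplus>\<^bsub>X\<^esub>i\<in>{..<n}. x i \<odot>\<^bsub>X\<^esub> v i) \<oplus>\<^bsub>X\<^esub> (\<Oplus>\<^bsub>X\<^esub>i\<in>{..<n}. y i \<odot>\<^bsub>X\<^esub> v i)"
      using v xy by (intro X.finsum_addf) auto
    finally show "(\<Oplus>\<^bsub>X\<^esub>i\<in>{..<n}. (x \<oplus>\<^bsub>free_module R n\<^esub> y) i \<odot>\<^bsub>X\<^esub> v i) =
       (\<Oplus>\<^bsub>X\<^esub>i\<in>{..<n}. x i \<odot>\<^bsub>X\<^esub> v i) \<oplus>\<^bsub>X\<^esub> (\<Oplus>\<^bsub>X\<^esub>i\<in>{..<n}. y i \<odot>\<^bsub>X\<^esub> v i)" .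
  qed (use v in \<open>auto intro!: X.finsum_closed\<close>)
qed

lemma mhom_free_expand:
  assumes X: "module R X" and f: "f \<in> mhom R (free_module R n) X"
    and x: "x \<in> carrier (free_module R n)"
  shows "f x = (\<Oplus>\<^bsub>X\<^esub>i\<in>{..<n}. x i \<odot>\<^bsub>X\<^esub> f (unit_vector R i))"
proof -
  interpret X: module R X by fact
  define tr where "tr k = (\<lambda>i. if i < k then x i else \<zero>)" for k
  have trc: "tr k \<in> carrier (free_module R n)" for k using x by (auto simp: tr_def)
  note D = mhomD[OF f]
  have "f (tr k) = (\<Oplus>\<^bsub>X\<^esub>i\<in>{..<k}. x i \<odot>\<^bsub>X\<^esub> f (unit_vector R i))" if "k \<le> n" for k
    using that
  proof (induction k)
    case 0
    have "tr 0 = \<zero>\<^bsub>free_module R n\<^esub>" by (auto simp: tr_def)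
    then show ?case using mhom_zero[OF module_free_module X f] by simp
  next
    case (Suc k)
    have xk: "x k \<in> carrier R" using x by auto
    have "tr (Suc k) = x k \<odot>\<^bsub>free_module R n\<^esub> unit_vector R k \<oplus>\<^bsub>free_module R n\<^esub> tr k"
      using x by (auto simp: tr_def unit_vector_def less_Suc_eq fun_eq_iff)
    moreover have "f (x k \<odot>\<^bsub>free_module R n\<^esub> unit_vector R k \<oplus>\<^bsub>free_module R n\<^esub> tr k)
        = x k \<odot>\<^bsub>X\<^esub> f (unit_vector R k) \<oplus>\<^bsub>X\<^esub> f (tr k)"
    proof -
      interpret F: module R "free_module R n" by (rule module_free_module)
      have u: "unit_vector R k \<in> carrier (free_module R n)" using Suc.prems by (intro unit_vector_closed) auto
      show ?thesis using D(2)[OF F.smult_closed[OF xk u] trc] D(3)[OF xk u] by simp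
    qed
    ultimately have "f (tr (Suc k)) = x k \<odot>\<^bsub>X\<^esub> f (unit_vector R k) \<oplus>\<^bsub>X\<^esub> f (tr k)" by simp
    then show ?case
      using Suc x D(1)[OF unit_vector_closed] by (subst X.finsum_lessThan_Suc) auto
  qed
  moreover have "tr n = x" using x by (auto simp: tr_def fun_eq_iff not_less)
  ultimately show ?thesis using le_refl by metis
qed

lemma mhom_free_eqI:
  assumes X: "module R X" and f: "f \<in> mhom R (free_module R n) X"
    and g: "g \<in> mhom R (free_module R n) X"
    and eq: "\<And>i. i < n \<Longrightarrow> f (unit_vector R i) = g (unit_vector R i)"
  shows "f = g"
proof (rule extensionalityI[OF mhomD(4)[OF f] mhomD(4)[OF g]])
  interpret X: module R X by fact
  fix x assume x: "x \<in> carrier (free_module R n)"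
  show "f x = g x"
    unfolding mhom_free_expand[OF X f x] mhom_free_expand[OF X g x]
    using eq x mhomD(1)[OF g unit_vector_closed] by (intro X.finsum_cong') auto
qed

lemma lift_hom_unit_vector:
  assumes X: "module R X" and v: "\<forall>i<n. v i \<in> carrier X" and i: "i < n"
  shows "lift_hom R n X v (unit_vector R i) = v i"
proof -
  interpret X: module R X by fact
  have "lift_hom R n X v (unit_vector R i) =
      (\<Oplus>\<^bsub>X\<^esub>j\<in>{..<n}. if i = j then v j else \<zero>\<^bsub>X\<^esub>)"
    using unit_vector_closed[OF i] v unfolding lift_hom_def
    by (simp, intro X.finsum_cong') (auto simp: unit_vector_def)
  also have "\<dots> = v i" using i v by (intro X.finsum_singleton) auto
  finally show ?thesis .
qed

lemma mhom_free_in_submodule: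
  assumes X: "module R X" and f: "f \<in> mhom R (free_module R n) X"
    and x: "x \<in> carrier (free_module R n)" and V: "submodule V R X"
    and "\<And>i. i < n \<Longrightarrow> x i \<odot>\<^bsub>X\<^esub> f (unit_vector R i) \<in> V"
  shows "f x \<in> V"
proof -
  interpret X: module R X by fact
  show ?thesis
    unfolding mhom_free_expand[OF X f x]
    using X.submoduleE[OF V] subgroup.one_closed[OF submodule.axioms(1)[OF V]] assms
    by (intro X.finsum_lessThan_induct) auto
qed

lemma projective_free_module: "projective R (free_module R n)"
  unfolding projective_def
proof (intro conjI allI impI)
  show "lmodule R (free_module R n)"
    using module_free_module lmodule_iff_module cring_axioms by blast
next
  fix X Y :: "('a, nat \<Rightarrow> 'a) module" and g f
  assume *: "lmodule R X \<and> lmodule R Y \<and> g \<in> mhom R X Y \<and> g ` carrier X = carrier Y \<and>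
    f \<in> mhom R (free_module R n) Y"
  have X: "module R X" and Y: "module R Y"
    using * lmodule_iff_module[OF cring_axioms] by blast+
  from * have g: "g \<in> mhom R X Y" "g ` carrier X = carrier Y"
    and f: "f \<in> mhom R (free_module R n) Y" by auto
  have "\<exists>x. x \<in> carrier X \<and> g x = f (unit_vector R i)" if "i < n" for i
    using mhomD(1)[OF f unit_vector_closed[OF that]] g(2) by (metis imageE)
  then obtain v where v: "\<forall>i<n. v i \<in> carrier X"
      "\<And>i. i < n \<Longrightarrow> g (v i) = f (unit_vector R i)"
    by metis
  let ?h = "lift_hom R n X v"
  have h: "?h \<in> mhom R (free_module R n) X" by (rule lift_hom_mhom[OF X v(1)])
  have "compose (carrier (free_module R n)) g ?h = f"
  proof (rule mhom_free_eqI[OF Y mhom_compose[OF module_free_module h g(1)] f])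
    fix i assume "i < n"
    then show "compose (carrier (free_module R n)) g ?h (unit_vector R i) = f (unit_vector R i)"
      using v lift_hom_unit_vector[OF X v(1)] by (simp del: free_module_simps add: compose_eq)
  qed
  then have "g (?h x) = f x" if "x \<in> carrier (free_module R n)" for x
    using fun_cong[of _ f x] compose_eq[OF that, of g ?h] by metis
  then show "\<exists>h\<in>mhom R (free_module R n) X. \<forall>x\<in>carrier (free_module R n). g (h x) = f x"
    using h by blast
qed

lemma dot_closed [simp]:
  "x \<in> carrier (free_module R n) \<Longrightarrow> y \<in> carrier (free_module R n) \<Longrightarrow> dot R n x y \<in> carrier R"
  unfolding dot_def by (intro finsum_closed) auto

lemma dot_commute:
  "x \<in> carrier (free_module R n) \<Longrightarrow> y \<in> carrier (free_module R n) \<Longrightarrow> dot R n x y = dot R n y x"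
  unfolding dot_def by (intro finsum_cong') (auto simp: m_comm)

lemma dot_mhom:
  assumes "y \<in> carrier (free_module R n)"
  shows "(\<lambda>x\<in>carrier (free_module R n). dot R n x y) \<in> mhom R (free_module R n) (regular_module R)"
  using lift_hom_mhom[OF module_regular_module, of n y] assms
  by (simp add: lift_hom_def dot_def finsum_regular_module)

lemma dot_unit_vector:
  assumes y: "y \<in> carrier (free_module R n)" and i: "i < n"
  shows "dot R n (unit_vector R i) y = y i"
proof -
  have "dot R n (unit_vector R i) y = (\<Oplus>j\<in>{..<n}. if i = j then y j else \<zero>)"
    unfolding dot_def using y by (intro finsum_cong') (auto simp: unit_vector_def)
  also have "\<dots> = y i" using i y by (intro finsum_singleton) auto
  finally show ?thesis .
qed

text \<open>
  Free modules of finite rank are self-dual: a linear form is the scalar product with its vector of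
  values on the basis.
\<close>

lemma mhom_free_eq_dot:
  assumes g: "g \<in> mhom R (free_module R n) (regular_module R)"
  shows "(\<lambda>i. if i < n then g (unit_vector R i) else \<zero>) \<in> carrier (free_module R n)"
    and "x \<in> carrier (free_module R n) \<Longrightarrow>
      g x = dot R n x (\<lambda>i. if i < n then g (unit_vector R i) else \<zero>)"
proof -
  let ?y = "\<lambda>i. if i < n then g (unit_vector R i) else \<zero>"
  show y: "?y \<in> carrier (free_module R n)"
    using mhomD(1)[OF g unit_vector_closed] by auto
  have eq: "g = (\<lambda>x\<in>carrier (free_module R n). dot R n x ?y)"
    using dot_unit_vector[OF y]
    by (intro mhom_free_eqI[OF module_regular_module g dot_mhom[OF y]])
      (simp del: free_module_simps)
  assume x: "x \<in> carrier (free_module R n)"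
  show "g x = dot R n x ?y"
    using fun_cong[OF eq, of x] unfolding restrict_apply'[OF x] .
qed

end

section \<open>Generators and projective covers\<close>

context cring
begin

lemma lift_hom_image:
  assumes X: "module R X" and v: "\<forall>i<n. v i \<in> carrier X"
  defines "L \<equiv> lift_hom R n X v ` carrier (free_module R n)"
  shows "submodule L R X" and "\<And>i. i < n \<Longrightarrow> v i \<in> L"
    and "\<And>V. submodule V R X \<Longrightarrow> (\<And>i. i < n \<Longrightarrow> v i \<in> V) \<Longrightarrow> L \<subseteq> V"
proof -
  interpret X: module R X by fact
  note h = lift_hom_mhom[OF X v]
  interpret F: module R "free_module R n" by (rule module_free_module)
  show "submodule L R X"
    unfolding L_def by (rule submodule_image[OF F.module_axioms X h F.carrier_is_submodule])
  show "v i \<in> L" if "i < n" for i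
    unfolding L_def using lift_hom_unit_vector[OF X v that] unit_vector_closed[OF that]
    by (metis imageI)
  show "L \<subseteq> V" if V: "submodule V R X" and vV: "\<And>i. i < n \<Longrightarrow> v i \<in> V" for V
  proof
    fix y assume "y \<in> L"
    then obtain x where x: "x \<in> carrier (free_module R n)" "y = lift_hom R n X v x"
      unfolding L_def by auto
    have "lift_hom R n X v x \<in> V"
      using mhom_free_in_submodule[OF X h x(1) V] vV X.submoduleE(4)[OF V] x(1)
        lift_hom_unit_vector[OF X v] by simp
    then show "y \<in> V" using x by simp
  qed
qed

text \<open>
  Intersect \<open>U\<close> with the terms of a composition series. As the factors are simple, a single element
  of \<open>U\<close> outside \<open>C\<^sub>i\<close> generates, together with \<open>U \<inter> C\<^sub>i\<close>, the whole of \<open>U \<inter> C\<^sub>i\<^sub>+\<^sub>1\<close>.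
\<close>

lemma finite_length_submodule_generated:
  assumes X: "module R X" and L: "has_length R X n" and U: "submodule U R X"
  shows "\<exists>m f. f \<in> mhom R (free_module R m) X \<and> f ` carrier (free_module R m) = U"
proof -
  interpret X: module R X by fact
  obtain C where C: "C 0 = {\<zero>\<^bsub>X\<^esub>}" "C n = carrier X" "\<And>i. i \<le> n \<Longrightarrow> submodule (C i) R X"
    and ss: "\<And>i. i < n \<Longrightarrow> C i \<subset> C (Suc i)"
    and simple: "\<And>i V. i < n \<Longrightarrow> submodule V R X \<Longrightarrow> C i \<subset> V \<Longrightarrow> \<not> V \<subset> C (Suc i)"
    using L unfolding has_length_def by metis
  note UE = X.submoduleE[OF U]
  have zero: "\<zero>\<^bsub>X\<^esub> \<in> V" if "submodule V R X" for V
    using subgroup.one_closed[OF submodule.axioms(1)[OF that]] by simp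
  have inter: "submodule (U \<inter> C i) R X" if "i \<le> n" for i
    using X.submoduleE[OF C(3)[OF that]] UE zero[OF U] zero[OF C(3)[OF that]]
    by (intro X.submoduleI) auto
  have "\<exists>m v. (\<forall>j<m. v j \<in> carrier X) \<and>
      lift_hom R m X v ` carrier (free_module R m) = U \<inter> C i" if "i \<le> n" for i
    using that
  proof (induction i)
    case 0
    have "lift_hom R 0 X (\<lambda>_. \<zero>\<^bsub>X\<^esub>) ` carrier (free_module R 0) = {\<zero>\<^bsub>X\<^esub>}"
      by (auto simp: lift_hom_def)
    then show ?case using zero[OF U] C(1)
      by (intro exI[of _ 0] exI[of _ "\<lambda>_. \<zero>\<^bsub>X\<^esub>"]) (simp del: free_module_simps)
  next
    case (Suc i)
    then obtain m v where v: "\<forall>j<m. v j \<in> carrier X"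
      and im: "lift_hom R m X v ` carrier (free_module R m) = U \<inter> C i" by auto
    have i: "i < n" "i \<le> n" using Suc.prems by auto
    show ?case
    proof (cases "U \<inter> C (Suc i) \<subseteq> C i")
      case True
      then have "U \<inter> C (Suc i) = U \<inter> C i" using ss[OF i(1)] by auto
      then show ?thesis using v im by auto
    next
      case False
      then obtain u where u: "u \<in> U" "u \<in> C (Suc i)" "u \<notin> C i" by auto
      note CE = X.submoduleE[OF C(3)[OF i(2)]] and CE' = X.submoduleE[OF C(3)[OF Suc.prems]]
      have uX: "u \<in> carrier X" using u UE by auto
      define v' where "v' = v(m := u)"
      have v': "\<forall>j<Suc m. v' j \<in> carrier X"
        using v uX by (auto simp: v'_def less_Suc_eq)
      let ?W = "lift_hom R (Suc m) X v' ` carrier (free_module R (Suc m))"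
      have vU: "v j \<in> U \<inter> C i" if "j < m" for j
        using lift_hom_image(2)[OF X v that] im by auto
      have "?W \<subseteq> U \<inter> C (Suc i)"
        using vU u ss[OF i(1)]
        by (intro lift_hom_image(3)[OF X v'] inter Suc.prems) (auto simp: v'_def less_Suc_eq)
      moreover have "U \<inter> C (Suc i) \<subseteq> ?W"
      proof
        fix x assume x: "x \<in> U \<inter> C (Suc i)"
        have WS: "submodule ?W R X" by (intro lift_hom_image(1)[OF X v'])
        have v'_eq: "v' m = u" "\<And>j. j < m \<Longrightarrow> v' j = v j" by (auto simp: v'_def)
        have uW: "u \<in> ?W" using lift_hom_image(2)[OF X v', of m] unfolding v'_eq by blast
        have "v j \<in> ?W" if "j < m" for j
          using that lift_hom_image(2)[OF X v', of j] unfolding v'_eq(2)[OF that] by auto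
        then have sub: "U \<inter> C i \<subseteq> ?W"
          unfolding im[symmetric] by (intro lift_hom_image(3)[OF X v] WS)
        \<comment> \<open>\<open>V\<close> is \<open>C i + R u\<close>, which is \<open>C (Suc i)\<close> because the factor is simple.\<close>
        define V where "V = {y \<oplus>\<^bsub>X\<^esub> r \<odot>\<^bsub>X\<^esub> u | y r. y \<in> C i \<and> r \<in> carrier R}"
        have V: "submodule V R X"
        proof (rule X.submoduleI)
          show "V \<subseteq> carrier X" using CE(1) uX by (auto simp: V_def)
          have "\<zero>\<^bsub>X\<^esub> = \<zero>\<^bsub>X\<^esub> \<oplus>\<^bsub>X\<^esub> \<zero> \<odot>\<^bsub>X\<^esub> u" using uX by simp
          then show "\<zero>\<^bsub>X\<^esub> \<in> V" unfolding V_def using zero[OF C(3)[OF i(2)]] by blast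
        next
          fix a assume "a \<in> V"
          then obtain y r where *: "a = y \<oplus>\<^bsub>X\<^esub> r \<odot>\<^bsub>X\<^esub> u" "y \<in> C i" "r \<in> carrier R"
            by (auto simp: V_def)
          then have "\<ominus>\<^bsub>X\<^esub> a = \<ominus>\<^bsub>X\<^esub> y \<oplus>\<^bsub>X\<^esub> (\<ominus> r) \<odot>\<^bsub>X\<^esub> u"
            using uX CE(1) by (auto simp: X.minus_add X.smult_l_minus)
          then show "\<ominus>\<^bsub>X\<^esub> a \<in> V" unfolding V_def using * CE(3) by blast
        next
          fix a b assume "a \<in> V" "b \<in> V"
          then obtain y r z s where *: "a = y \<oplus>\<^bsub>X\<^esub> r \<odot>\<^bsub>X\<^esub> u" "y \<in> C i" "r \<in> carrier R"
              "b = z \<oplus>\<^bsub>X\<^esub> s \<odot>\<^bsub>X\<^esub> u" "z \<in> C i" "s \<in> carrier R"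
            by (auto simp: V_def)
          have yz: "y \<in> carrier X" "z \<in> carrier X" using * CE(1) by auto
          have "a \<oplus>\<^bsub>X\<^esub> b = (y \<oplus>\<^bsub>X\<^esub> z) \<oplus>\<^bsub>X\<^esub> (r \<oplus> s) \<odot>\<^bsub>X\<^esub> u"
            using uX * yz by (simp add: X.smult_l_distr X.a_ac)
          then show "a \<oplus>\<^bsub>X\<^esub> b \<in> V"
            unfolding V_def using *(3,6) CE(5)[OF *(2,5)] by blast
        next
          fix a x assume a: "a \<in> carrier R" and "x \<in> V"
          then obtain y r where *: "x = y \<oplus>\<^bsub>X\<^esub> r \<odot>\<^bsub>X\<^esub> u" "y \<in> C i" "r \<in> carrier R"
            by (auto simp: V_def)
          have y: "y \<in> carrier X" using * CE(1) by auto
          have "a \<odot>\<^bsub>X\<^esub> x = a \<odot>\<^bsub>X\<^esub> y \<oplus>\<^bsub>X\<^esub> (a \<otimes> r) \<odot>\<^bsub>X\<^esub> u"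
            using a * y uX by (simp add: X.smult_r_distr X.smult_assoc1)
          then show "a \<odot>\<^bsub>X\<^esub> x \<in> V" unfolding V_def using a * CE(4)[OF a *(2)] by blast
        qed
        have "C i \<subseteq> V"
        proof
          fix y assume y: "y \<in> C i"
          then have "y = y \<oplus>\<^bsub>X\<^esub> \<zero> \<odot>\<^bsub>X\<^esub> u" using CE(1) uX by auto
          then show "y \<in> V" unfolding V_def using y by blast
        qed
        moreover have "u \<in> V"
        proof -
          have "u = \<zero>\<^bsub>X\<^esub> \<oplus>\<^bsub>X\<^esub> \<one> \<odot>\<^bsub>X\<^esub> u" using uX by simp
          then show ?thesis unfolding V_def using zero[OF C(3)[OF i(2)]] by blast
        qed
        ultimately have "\<not> V \<subset> C (Suc i)" using u(3) by (intro simple[OF i(1) V]) auto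
        moreover have "V \<subseteq> C (Suc i)"
          using ss[OF i(1)] CE' u(2) by (auto simp: V_def)
        ultimately have "x \<in> V" using x by auto
        then obtain y r where *: "x = y \<oplus>\<^bsub>X\<^esub> r \<odot>\<^bsub>X\<^esub> u" "y \<in> C i" "r \<in> carrier R"
          by (auto simp: V_def)
        have yX: "y \<in> carrier X" using * CE(1) by auto
        have "y = x \<oplus>\<^bsub>X\<^esub> \<ominus>\<^bsub>X\<^esub> (r \<odot>\<^bsub>X\<^esub> u)"
          using * yX uX by (simp add: X.a_assoc X.r_neg)
        then have "y \<in> U" using UE(3,4,5) x u(1) *(3) by auto
        then have "y \<in> ?W" using sub * by auto
        then show "x \<in> ?W"
          unfolding *(1) using X.submoduleE(4,5)[OF WS] uW *(3) by auto
      qed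
      ultimately have "?W = U \<inter> C (Suc i)" by auto
      then show ?thesis using v' by blast
    qed
  qed
  from this[of n] obtain m v where v: "\<forall>j<m. v j \<in> carrier X"
    and im: "lift_hom R m X v ` carrier (free_module R m) = U"
    using UE(1) C(2) by (auto simp: Int_absorb2)
  then show ?thesis using lift_hom_mhom[OF X v] by blast
qed

end

text \<open>
  If \<open>R\<close> is not the zero ring, it is local and \<open>J\<close> is its maximal ideal, because the elements outside
  \<open>J\<close> are units and those of \<open>J\<close> are nilpotent.
\<close>

locale short_local_ring = cring R for R (structure) +
  fixes J :: "'a set"
  assumes J_ideal: "ideal J R"
    and J_cube: "\<lbrakk>x \<in> J; y \<in> J; z \<in> J\<rbrakk> \<Longrightarrow> x \<otimes> y \<otimes> z = \<zero>"
    and unit_outside_J: "\<lbrakk>x \<in> carrier R; x \<notin> J\<rbrakk> \<Longrightarrow> x \<in> Units R"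
begin

text \<open>
  Nakayama's lemma in the form that a submodule \<open>U\<close> of \<open>F = R\<^sup>n\<close> with \<open>U + J F = F\<close> is all of \<open>F\<close>.
  Vectors with all entries in \<open>0\<close>, in the annihilator of \<open>J\<close>, in \<open>J\<close> and in \<open>R\<close> are shown to
  lie in \<open>U\<close>, one after the other: replacing each basis vector of such a vector by an element of \<open>U\<close>
  changes the entries by products with elements of \<open>J\<close>, which belong to the case before. The chain is
  this short because \<open>J\<^sup>3 = 0\<close>.
\<close>

lemma submodule_free_module_eqI:
  assumes U: "submodule U R (free_module R n)"
    and gen: "\<And>i. i < n \<Longrightarrow> \<exists>t\<in>carrier (free_module R n).
      (\<forall>j. t j \<in> J) \<and> unit_vector R i \<oplus>\<^bsub>free_module R n\<^esub> t \<in> U"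
  shows "U = carrier (free_module R n)"
proof -
  let ?F = "free_module R n"
  interpret F: module R ?F by (rule module_free_module)
  interpret J: ideal J R by (rule J_ideal)
  note UE = F.submoduleE[OF U]
  from gen have "\<forall>i. \<exists>t. i < n \<longrightarrow> t \<in> carrier ?F \<and> (\<forall>j. t j \<in> J) \<and>
    unit_vector R i \<oplus>\<^bsub>?F\<^esub> t \<in> U" by blast
  then obtain t where t: "\<And>i. i < n \<Longrightarrow> t i \<in> carrier ?F" "\<And>i j. i < n \<Longrightarrow> t i j \<in> J"
      "\<And>i. i < n \<Longrightarrow> unit_vector R i \<oplus>\<^bsub>?F\<^esub> t i \<in> U"
    by metis
  have step: "x \<in> U"
    if x: "x \<in> carrier ?F" "\<And>i. x i \<in> S" and ST: "\<And>s j. s \<in> S \<Longrightarrow> j \<in> J \<Longrightarrow> s \<otimes> j \<in> T"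
      and T: "\<zero> \<in> T" "\<And>a b. a \<in> T \<Longrightarrow> b \<in> T \<Longrightarrow> a \<oplus> b \<in> T"
        "\<And>a. a \<in> T \<Longrightarrow> \<ominus> a \<in> T" "T \<subseteq> carrier R"
      and TU: "\<And>y. y \<in> carrier ?F \<Longrightarrow> (\<And>i. y i \<in> T) \<Longrightarrow> y \<in> U" for S T x
  proof -
    have id: "(\<lambda>x\<in>carrier ?F. x) \<in> mhom R ?F ?F"
      by (rule mhom_restrictI[OF F.module_axioms]) auto
    define y where "y = (\<Oplus>\<^bsub>?F\<^esub>i\<in>{..<n}. x i \<odot>\<^bsub>?F\<^esub> t i)"
    define z where "z = (\<Oplus>\<^bsub>?F\<^esub>i\<in>{..<n}. x i \<odot>\<^bsub>?F\<^esub> (unit_vector R i \<oplus>\<^bsub>?F\<^esub> t i))"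
    have xi: "x i \<in> carrier R" for i using x by auto
    have eT: "y \<in> {y \<in> carrier ?F. \<forall>i. y i \<in> T}"
      unfolding y_def
    proof (rule F.finsum_lessThan_induct)
      fix i assume i: "i < n"
      have "x i \<odot>\<^bsub>?F\<^esub> t i \<in> carrier ?F" using xi t(1)[OF i] by (rule F.smult_closed)
      then show "x i \<odot>\<^bsub>?F\<^esub> t i \<in> {y \<in> carrier ?F. \<forall>i. y i \<in> T}"
        using ST[OF x(2) t(2)[OF i]] by simp
    qed (use T in auto)
    have zU: "z \<in> U"
      unfolding z_def
      using UE subgroup.one_closed[OF submodule.axioms(1)[OF U]] t(3) xi
      by (intro F.finsum_lessThan_induct) (auto simp del: free_module_simps)
    have "x = (\<Oplus>\<^bsub>?F\<^esub>i\<in>{..<n}. x i \<odot>\<^bsub>?F\<^esub> unit_vector R i)"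
      using mhom_free_expand[OF F.module_axioms id x(1)] x(1)
      by (subst (asm) F.finsum_cong'[OF refl, of "\<lambda>i. x i \<odot>\<^bsub>?F\<^esub> unit_vector R i"])
        (use F.smult_closed[OF xi unit_vector_closed] in \<open>simp_all del: free_module_simps\<close>)
    moreover have "z = (\<Oplus>\<^bsub>?F\<^esub>i\<in>{..<n}. x i \<odot>\<^bsub>?F\<^esub> unit_vector R i \<oplus>\<^bsub>?F\<^esub> x i \<odot>\<^bsub>?F\<^esub> t i)"
      unfolding z_def using F.smult_r_distr[OF xi unit_vector_closed t(1)]
        F.smult_closed[OF xi t(1)] F.smult_closed[OF xi unit_vector_closed] F.a_closed
      by (intro F.finsum_cong') (auto simp del: free_module_simps)
    moreover have "\<dots> = (\<Oplus>\<^bsub>?F\<^esub>i\<in>{..<n}. x i \<odot>\<^bsub>?F\<^esub> unit_vector R i) \<oplus>\<^bsub>?F\<^esub> y"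
      unfolding y_def using F.smult_closed[OF xi t(1)] F.smult_closed[OF xi unit_vector_closed]
      by (intro F.finsum_addf) (auto simp del: free_module_simps)
    ultimately have "z = x \<oplus>\<^bsub>?F\<^esub> y" by simp
    moreover have y: "y \<in> carrier ?F" "\<And>i. y i \<in> T" using eT by auto
    ultimately have "x = z \<oplus>\<^bsub>?F\<^esub> \<ominus>\<^bsub>?F\<^esub> y"
      using x(1) by (simp add: F.a_assoc F.r_neg del: free_module_simps)
    moreover have "y \<in> U" using TU y by auto
    ultimately show "x \<in> U" using zU UE by (simp del: free_module_simps)
  qed
  have zero: "\<zero>\<^bsub>?F\<^esub> \<in> U" using subgroup.one_closed[OF submodule.axioms(1)[OF U]] by simp
  define T where "T = {a \<in> carrier R. \<forall>j\<in>J. a \<otimes> j = \<zero>}"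
  have T: "\<zero> \<in> T" "\<And>a b. a \<in> T \<Longrightarrow> b \<in> T \<Longrightarrow> a \<oplus> b \<in> T"
        "\<And>a. a \<in> T \<Longrightarrow> \<ominus> a \<in> T" "T \<subseteq> carrier R"
    by (auto simp: T_def l_distr l_minus J.Icarr)
  have 2: "x \<in> U" if "x \<in> carrier ?F" "\<And>i. x i \<in> T" for x
  proof (rule step[of x T "{\<zero>}"])
    fix y assume "y \<in> carrier ?F" and "\<And>i. y i \<in> {\<zero>}"
    then have "y = \<zero>\<^bsub>?F\<^esub>" by auto
    then show "y \<in> U" using zero by simp
  qed (use that in \<open>auto simp: T_def\<close>)
  have 1: "x \<in> U" if "x \<in> carrier ?F" "\<And>i. x i \<in> J" for x
    by (rule step[of x J T]) (use that T 2 J_cube in \<open>auto simp: T_def J.Icarr\<close>)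
  have 0: "x \<in> U" if "x \<in> carrier ?F" for x
  proof (rule step[of x "carrier R" J])
    show "x i \<in> carrier R" for i using that by auto
    show "J \<subseteq> carrier R" using J.Icarr by auto
  qed (use that 1 in \<open>auto intro: J.I_l_closed simp del: free_module_simps\<close>)
  show ?thesis using 0 UE(1) by auto
qed

text \<open>
  If the kernel is contained in \<open>J F\<close>, a submodule that maps onto \<open>X\<close> contains every basis vector up to
  an element of \<open>J F\<close>, and Nakayama's lemma applies.
\<close>

lemma projective_cover_free_moduleI:
  assumes X: "module R X" and f: "f \<in> mhom R (free_module R n) X"
    and onto: "f ` carrier (free_module R n) = carrier X"
    and ker: "\<And>x i. x \<in> mkernel (free_module R n) X f \<Longrightarrow> x i \<in> J"
  shows "projective_cover R (free_module R n) X f"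
  unfolding projective_cover_def
proof (intro conjI allI impI projective_free_module f onto)
  let ?F = "free_module R n"
  interpret F: module R ?F by (rule module_free_module)
  interpret X: module R X by fact
  fix U assume *: "submodule U R ?F \<and> f ` U = carrier X"
  then have U: "submodule U R ?F" ..
  note UE = F.submoduleE[OF U]
  show "U = carrier ?F"
  proof (rule submodule_free_module_eqI[OF U])
    fix i assume i: "i < n"
    note e = unit_vector_closed[OF i]
    obtain u where u: "u \<in> U" "f u = f (unit_vector R i)"
      using * mhomD(1)[OF f e] by (metis imageE)
    have uF: "u \<in> carrier ?F" using u UE(1) by blast
    define t where "t = u \<oplus>\<^bsub>?F\<^esub> \<ominus>\<^bsub>?F\<^esub> unit_vector R i"
    have tF: "t \<in> carrier ?F" unfolding t_def using F.a_closed[OF uF F.a_inv_closed[OF e]] .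
    have "f t = \<zero>\<^bsub>X\<^esub>"
      unfolding t_def mhomD(2)[OF f uF F.a_inv_closed[OF e]] mhom_minus[OF F.module_axioms X f e] u(2)
      using X.r_neg mhomD(1)[OF f e] by simp
    then have "\<forall>j. t j \<in> J" using ker tF by (simp add: mkernel_def del: free_module_simps)
    moreover have "unit_vector R i \<oplus>\<^bsub>?F\<^esub> t = u"
      unfolding t_def using uF e F.a_inv_closed[OF e] F.a_comm F.a_assoc F.l_neg
      by (metis F.a_closed F.r_zero)
    ultimately show "\<exists>t\<in>carrier ?F. (\<forall>j. t j \<in> J) \<and> unit_vector R i \<oplus>\<^bsub>?F\<^esub> t \<in> U"
      using tF u(1) by metis
  qed
qed

text \<open>
  Take the least possible number of generators. If an element of the kernel had an entry outside
  \<open>J\<close>, that is, a unit, one of the generators could be expressed by the others.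
\<close>

lemma projective_cover_exists:
  assumes X: "module R X" and "\<exists>f. f \<in> mhom R (free_module R n) X \<and>
      f ` carrier (free_module R n) = carrier X"
  shows "\<exists>m f. f \<in> mhom R (free_module R m) X \<and> f ` carrier (free_module R m) = carrier X \<and>
    projective_cover R (free_module R m) X f"
proof -
  interpret X: module R X by fact
  define P where "P m \<longleftrightarrow> (\<exists>f. f \<in> mhom R (free_module R m) X \<and>
    f ` carrier (free_module R m) = carrier X)" for m
  define m where "m = (LEAST m. P m)"
  have Pm: "P m" unfolding m_def using assms(2) by (intro LeastI[of P n]) (simp add: P_def)
  have least: "\<not> P k" if "k < m" for k using that not_less_Least unfolding m_def by blast
  from Pm obtain f where f: "f \<in> mhom R (free_module R m) X"
    and onto: "f ` carrier (free_module R m) = carrier X"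
    unfolding P_def by auto
  let ?F = "free_module R m"
  interpret F: module R ?F by (rule module_free_module)
  have "x i \<in> J" if x: "x \<in> mkernel ?F X f" for x i
  proof (rule ccontr)
    assume xi: "x i \<notin> J"
    have xF: "x \<in> carrier ?F" and fx: "f x = \<zero>\<^bsub>X\<^esub>" using x by (auto simp: mkernel_def)
    have i: "i < m"
    proof (rule ccontr)
      assume "\<not> i < m"
      then have "x i = \<zero>" using xF by auto
      then show False using xi J_ideal by (simp add: additive_subgroup.zero_closed ideal.axioms(1))
    qed
    have xiu: "x i \<in> Units R" using xi xF by (intro unit_outside_J) auto
    \<comment> \<open>the generators other than the \<open>i\<close>-th one, renumbered\<close>
    define v where "v j = f (unit_vector R (if j < i then j else Suc j))" for j
    have v: "\<forall>j<m - 1. v j \<in> carrier X"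
      unfolding v_def using i by (intro allI impI mhomD(1)[OF f] unit_vector_closed) auto
    define V where "V = lift_hom R (m - 1) X v ` carrier (free_module R (m - 1))"
    note VL = lift_hom_image[OF X v, folded V_def]
    have V: "submodule V R X" using VL(1) by simp
    note VE = X.submoduleE[OF V]
    have other: "f (unit_vector R j) \<in> V" if "j < m" "j \<noteq> i" for j
    proof (cases "j < i")
      case True
      then have "v j = f (unit_vector R j)" by (simp add: v_def)
      then show ?thesis using VL(2)[of j] True i by auto
    next
      case False
      then have "\<not> j - 1 < i" "Suc (j - 1) = j" using that by auto
      then have "v (j - 1) = f (unit_vector R j)" by (simp add: v_def)
      then show ?thesis using VL(2)[of "j - 1"] False that by auto
    qed
    define y where "y = x(i := \<zero>)"
    have yF: "y \<in> carrier ?F" using xF by (auto simp: y_def)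
    note e = unit_vector_closed[OF i]
    have xi': "x i \<in> carrier R" using xiu by auto
    have fe: "f (unit_vector R i) \<in> carrier X" by (rule mhomD(1)[OF f e])
    have "f y \<in> V"
    proof (rule mhom_free_in_submodule[OF X f yF V])
      fix j assume j: "j < m"
      show "y j \<odot>\<^bsub>X\<^esub> f (unit_vector R j) \<in> V"
      proof (cases "j = i")
        case True
        then show ?thesis
          using fe subgroup.one_closed[OF submodule.axioms(1)[OF V]] by (simp add: y_def)
      next
        case False
        then show ?thesis using other[OF j] VE(4) yF by auto
      qed
    qed
    moreover have "x = y \<oplus>\<^bsub>?F\<^esub> x i \<odot>\<^bsub>?F\<^esub> unit_vector R i"
      using xF xi' by (auto simp: y_def unit_vector_def fun_eq_iff)
    then have "\<zero>\<^bsub>X\<^esub> = f y \<oplus>\<^bsub>X\<^esub> x i \<odot>\<^bsub>X\<^esub> f (unit_vector R i)"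
      using fx mhomD(2)[OF f yF F.smult_closed[OF xi' e]] mhomD(3)[OF f xi' e] by metis
    then have "x i \<odot>\<^bsub>X\<^esub> f (unit_vector R i) = \<ominus>\<^bsub>X\<^esub> f y"
      using mhomD(1)[OF f yF] X.smult_closed[OF xi' fe] by (metis X.a_comm X.minus_equality)
    ultimately have "x i \<odot>\<^bsub>X\<^esub> f (unit_vector R i) \<in> V" using VE by simp
    then have "inv (x i) \<odot>\<^bsub>X\<^esub> (x i \<odot>\<^bsub>X\<^esub> f (unit_vector R i)) \<in> V" using VE(4) xiu by simp
    then have "f (unit_vector R i) \<in> V"
      using xiu xi' fe by (simp add: X.smult_assoc1[symmetric])
    then have all: "f (unit_vector R j) \<in> V" if "j < m" for j using other that by metis
    have "f z \<in> V" if z: "z \<in> carrier ?F" for z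
      using z by (intro mhom_free_in_submodule[OF X f z V] VE(4) all) auto
    then have "f ` carrier ?F \<subseteq> V" by blast
    then have "V = carrier X" using onto VE(1) by simp
    then have "P (m - 1)" unfolding P_def using lift_hom_mhom[OF X v] V_def by blast
    then show False using least[of "m - 1"] i by simp
  qed
  then show ?thesis using projective_cover_free_moduleI[OF X f onto] f onto by blast
qed

end

section \<open>Projective resolutions and Ext\<close>

context cring
begin

text \<open>
  Resolutions are infinite sequences. If submodules of free modules are finitely generated, a given map
  of free modules can be continued to the left by covering the kernels successively.
\<close>

lemma free_resolution_continues:
  assumes noeth: "\<And>n U. submodule U R (free_module R n) \<Longrightarrow>
      \<exists>m f. f \<in> mhom R (free_module R m) (free_module R n) \<and> f ` carrier (free_module R m) = U"
    and f: "f \<in> mhom R (free_module R m) (free_module R r)"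
  shows "\<exists>n d. n 0 = r \<and> n (Suc 0) = m \<and> d 0 = f \<and>
    (\<forall>i. d i \<in> mhom R (free_module R (n (Suc i))) (free_module R (n i))) \<and>
    (\<forall>i. d (Suc i) ` carrier (free_module R (n (Suc (Suc i)))) =
      mkernel (free_module R (n (Suc i))) (free_module R (n i)) (d i))"
proof -
  \<comment> \<open>A state \<open>(a, b, g)\<close> consists of a map \<open>g : R\<^sup>b \<rightarrow> R\<^sup>a\<close>; its successor maps onto the kernel of \<open>g\<close>.\<close>
  define S :: "(nat \<times> nat \<times> ((nat \<Rightarrow> 'a) \<Rightarrow> (nat \<Rightarrow> 'a))) set"
    where "S = {(a, b, g). g \<in> mhom R (free_module R b) (free_module R a)}"
  define Q where "Q s s' \<longleftrightarrow> fst s' = fst (snd s) \<and>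
    snd (snd s') ` carrier (free_module R (fst (snd s'))) =
      mkernel (free_module R (fst (snd s))) (free_module R (fst s)) (snd (snd s))" for s s'
  have "\<exists>s. (\<forall>i. s i \<in> S) \<and> s 0 = (r, m, f) \<and> (\<forall>i. Q (s i) (s (Suc i)))"
  proof -
    have ex: "\<exists>s'. s' \<in> S \<and> Q s s'" if "s \<in> S" for s
    proof -
      obtain a b g where s: "s = (a, b, g)" by (cases s)
      then have g: "g \<in> mhom R (free_module R b) (free_module R a)" using that by (simp add: S_def)
      obtain c h where "h \<in> mhom R (free_module R c) (free_module R b)"
        "h ` carrier (free_module R c) = mkernel (free_module R b) (free_module R a) g"
        using noeth[OF submodule_mkernel[OF module_free_module module_free_module g]] by blast
      then show ?thesis unfolding s
        by (intro exI[of _ "(b, c, h)"]) (simp add: S_def Q_def del: free_module_simps)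
    qed
    define nx where "nx s = (SOME s'. s' \<in> S \<and> Q s s')" for s
    have nx: "nx s \<in> S" "Q s (nx s)" if "s \<in> S" for s
      using someI_ex[OF ex[OF that]] unfolding nx_def by auto
    have S0: "(r, m, f) \<in> S" using f by (simp add: S_def)
    define s where "s = rec_nat (r, m, f) (\<lambda>_. nx)"
    have "s i \<in> S" for i by (induction i) (auto simp: s_def S0 nx)
    then show ?thesis using nx by (intro exI[of _ s]) (auto simp: s_def)
  qed
  then obtain s where s: "\<And>i. s i \<in> S" "s 0 = (r, m, f)" "\<And>i. Q (s i) (s (Suc i))" by blast
  have Qs: "fst (s (Suc i)) = fst (snd (s i))"
    "snd (snd (s (Suc i))) ` carrier (free_module R (fst (snd (s (Suc i))))) =
      mkernel (free_module R (fst (snd (s i)))) (free_module R (fst (s i))) (snd (snd (s i)))" for i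
    using s(3)[of i] unfolding Q_def by blast+
  have "snd (snd (s i)) \<in> mhom R (free_module R (fst (snd (s i)))) (free_module R (fst (s i)))" for i
    using s(1)[of i] by (auto simp: S_def split: prod.splits)
  then show ?thesis
    using Qs s(2)
    by (intro exI[of _ "\<lambda>i. fst (s i)"] exI[of _ "\<lambda>i. snd (snd (s i))"])
      (simp del: free_module_simps)
qed

text \<open>
  The cocycles form a group, so that each of their cosets modulo the equal set of coboundaries is the set
  itself.
\<close>

lemma trivial_cohomologyI:
  assumes X: "module R X" and P: "\<And>i. module R (P i)" and d: "\<And>i. d i \<in> mhom R (P (Suc i)) (P i)"
    and eq: "cocycles R P d X i = coboundaries R P d X i"
  shows "trivial_group (cohomology R P d X i)"
proof -
  interpret X: module R X by fact
  interpret Pi: module R "P i" by (rule P)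
  let ?Z = "cocycles R P d X i"
  let ?G = "(hom_group R (P i) X)\<lparr>carrier := ?Z\<rparr>"
  let ?add = "\<lambda>f g. \<lambda>x\<in>carrier (P i). f x \<oplus>\<^bsub>X\<^esub> g x"
  have Zh: "f \<in> mhom R (P i) X" if "f \<in> ?Z" for f using that by (simp add: cocycles_def)
  have Z0: "f (d i x) = \<zero>\<^bsub>X\<^esub>" "d i x \<in> carrier (P i)" if "f \<in> ?Z" "x \<in> carrier (P (Suc i))" for f x
    using that mhomD(1)[OF d[of i]] by (auto simp: cocycles_def)
  have zero: "(\<lambda>x\<in>carrier (P i). \<zero>\<^bsub>X\<^esub>) \<in> ?Z"
    unfolding cocycles_def using mhomD(1)[OF d[of i]]
    by (auto intro!: mhom_restrictI[OF P])
  have add: "?add f g \<in> ?Z" if "f \<in> ?Z" "g \<in> ?Z" for f g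
  proof -
    note D = mhomD[OF Zh[OF that(1)]] mhomD[OF Zh[OF that(2)]]
    have "?add f g \<in> mhom R (P i) X"
      by (rule mhom_restrictI[OF P]) (auto simp: D X.a_ac X.smult_r_distr)
    then show ?thesis using Z0[OF that(1)] Z0[OF that(2)] by (simp add: cocycles_def)
  qed
  have minus: "(\<lambda>x\<in>carrier (P i). \<ominus>\<^bsub>X\<^esub> f x) \<in> ?Z" if "f \<in> ?Z" for f
  proof -
    note D = mhomD[OF Zh[OF that(1)]]
    have "(\<lambda>x\<in>carrier (P i). \<ominus>\<^bsub>X\<^esub> f x) \<in> mhom R (P i) X"
      by (rule mhom_restrictI[OF P]) (auto simp: D X.minus_add X.smult_r_minus)
    moreover have "\<ominus>\<^bsub>X\<^esub> \<zero>\<^bsub>X\<^esub> = \<zero>\<^bsub>X\<^esub>" using X.minus_equality[of "\<zero>\<^bsub>X\<^esub>" "\<zero>\<^bsub>X\<^esub>"] by simp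
    ultimately show ?thesis using Z0[OF that(1)] by (simp add: cocycles_def)
  qed
  have solve: "\<exists>h\<in>?Z. ?add h g = f" if f: "f \<in> ?Z" and g: "g \<in> ?Z" for f g
  proof (rule bexI)
    let ?h = "?add f (\<lambda>x\<in>carrier (P i). \<ominus>\<^bsub>X\<^esub> g x)"
    show "?h \<in> ?Z" by (intro add minus f g)
    show "?add ?h g = f"
    proof (rule extensionalityI[OF _ mhomD(4)[OF Zh[OF f]]])
      fix x assume "x \<in> carrier (P i)"
      then show "?add ?h g x = f x"
        using mhomD(1)[OF Zh[OF f]] mhomD(1)[OF Zh[OF g]]
        by (simp add: X.a_assoc X.l_neg)
    qed simp
  qed
  have coset: "?Z #>\<^bsub>?G\<^esub> g = ?Z" if g: "g \<in> ?Z" for g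
  proof -
    have "?Z #>\<^bsub>?G\<^esub> g = (\<lambda>h. ?add h g) ` ?Z" by (auto simp: r_coset_def hom_group_def)
    also have "\<dots> = ?Z"
    proof (intro equalityI subsetI)
      fix f assume "f \<in> ?Z"
      then show "f \<in> (\<lambda>h. ?add h g) ` ?Z" using solve[OF _ g] by blast
    qed (use add g in blast)
    finally show ?thesis .
  qed
  define Q where "Q = ?G Mod ?Z"
  have carr: "carrier Q = {?Z}"
    using coset zero by (auto simp: Q_def FactGroup_def RCOSETS_def)
  have one: "one Q = ?Z" by (simp add: Q_def FactGroup_def)
  have "?Z <#>\<^bsub>?G\<^esub> ?Z = (\<Union>g\<in>?Z. ?Z #>\<^bsub>?G\<^esub> g)"
    unfolding set_mult_def r_coset_def by blast
  then have mult: "?Z \<otimes>\<^bsub>Q\<^esub> ?Z = ?Z" using coset zero by (auto simp: Q_def FactGroup_def)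
  have "group Q" by (rule groupI) (auto simp: carr one mult)
  then show ?thesis
    unfolding cohomology_def eq[symmetric] trivial_group_def Q_def[symmetric]
    using carr one by simp
qed

end

section \<open>A criterion for an ideal to be 3-torsionfree\<close>

text \<open>
  The ideal \<open>I\<close> as a submodule of \<open>R\<^sup>1\<close> instead of \<open>R\<close>, which gives it the type of elements that is
  common to the free modules.
\<close>

definition embed_ideal :: "('a, 'e) ring_scheme \<Rightarrow> 'a set \<Rightarrow> ('a, nat \<Rightarrow> 'a) module" where
  "embed_ideal R I = (free_module R 1)\<lparr>carrier := {x \<in> carrier (free_module R 1). x 0 \<in> I}\<rparr>"

context cring
begin

lemma embed_ideal_presentation:
  fixes r u
  defines "I \<equiv> {dot R r x u | x. x \<in> carrier (free_module R r)}"
    and "p \<equiv> \<lambda>x\<in>carrier (free_module R r). \<lambda>i::nat. if i = 0 then dot R r x u else \<zero>"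
  assumes u: "u \<in> carrier (free_module R r)"
  shows "p \<in> mhom R (free_module R r) (free_module R 1)"
    and "p \<in> mhom R (free_module R r) (embed_ideal R I)"
    and "p ` carrier (free_module R r) = carrier (embed_ideal R I)"
    and "mkernel (free_module R r) (embed_ideal R I) p =
      {x \<in> carrier (free_module R r). dot R r x u = \<zero>}"
    and "mkernel (free_module R r) (free_module R 1) p =
      {x \<in> carrier (free_module R r). dot R r x u = \<zero>}"
    and "module R (embed_ideal R I)"
proof -
  let ?F = "free_module R"
  let ?M = "embed_ideal R I"
  interpret Fr: module R "?F r" by (rule module_free_module)
  define D where "D = (\<lambda>x\<in>carrier (?F r). dot R r x u)"
  have Dh: "D \<in> mhom R (?F r) (regular_module R)" unfolding D_def by (rule dot_mhom[OF u])
  have D: "D x = dot R r x u" if "x \<in> carrier (?F r)" for x unfolding D_def using that by simp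
  have p: "p x = (\<lambda>i. if i = 0 then D x else \<zero>)" if "x \<in> carrier (?F r)" for x
    unfolding p_def D[OF that] restrict_apply'[OF that] by (rule refl)
  show ph: "p \<in> mhom R (?F r) (?F 1)"
  proof (rule mhomI)
    show "p \<in> extensional (carrier (?F r))" unfolding p_def by simp
  next
    fix x assume x: "x \<in> carrier (?F r)"
    show "p x \<in> carrier (?F 1)" using p[OF x] mhomD(1)[OF Dh x] by auto
  next
    fix x y assume x: "x \<in> carrier (?F r)" and y: "y \<in> carrier (?F r)"
    show "p (x \<oplus>\<^bsub>?F r\<^esub> y) = p x \<oplus>\<^bsub>?F 1\<^esub> p y"
      using p[OF x] p[OF y] p[OF Fr.a_closed[OF x y]] mhomD(2)[OF Dh x y] by auto
  next
    fix a x assume a: "a \<in> carrier R" and x: "x \<in> carrier (?F r)"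
    show "p (a \<odot>\<^bsub>?F r\<^esub> x) = a \<odot>\<^bsub>?F 1\<^esub> p x"
      using a p[OF x] p[OF Fr.smult_closed[OF a x]] mhomD(3)[OF Dh a x] by auto
  qed
  show pim: "p ` carrier (?F r) = carrier ?M"
  proof (intro equalityI subsetI)
    fix z assume "z \<in> p ` carrier (?F r)"
    then obtain x where x: "x \<in> carrier (?F r)" "z = p x" by blast
    then show "z \<in> carrier ?M"
      using mhomD(1)[OF ph x(1)] p[OF x(1)] D[OF x(1)]
      by (auto simp: embed_ideal_def I_def simp del: free_module_simps)
  next
    fix z assume z: "z \<in> carrier ?M"
    then obtain x where x: "x \<in> carrier (?F r)" "z 0 = dot R r x u"
      by (auto simp: embed_ideal_def I_def simp del: free_module_simps)
    have "z = p x" using z x(2) unfolding p[OF x(1)] D[OF x(1)] by (auto simp: embed_ideal_def I_def)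
    then show "z \<in> p ` carrier (?F r)" using x by blast
  qed
  show ker1: "mkernel (?F r) ?M p = {x \<in> carrier (?F r). dot R r x u = \<zero>}"
  proof -
    have "p x = (\<lambda>i. \<zero>) \<longleftrightarrow> dot R r x u = \<zero>" if "x \<in> carrier (?F r)" for x
      using p[OF that] D[OF that] by (auto simp: fun_eq_iff)
    then show ?thesis by (auto simp: mkernel_def embed_ideal_def I_def simp del: free_module_simps(1))
  qed
  show ker2: "mkernel (?F r) (?F 1) p = {x \<in> carrier (?F r). dot R r x u = \<zero>}"
    using ker1 by (simp add: mkernel_def embed_ideal_def I_def)
  show M: "module R ?M"
  proof -
    have "submodule (p ` carrier (?F r)) R (?F 1)"
      by (rule submodule_image[OF module_free_module module_free_module ph Fr.carrier_is_submodule])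
    moreover have "?M = (?F 1)\<lparr>carrier := p ` carrier (?F r)\<rparr>"
      unfolding pim by (simp add: embed_ideal_def)
    ultimately show ?thesis
      using submodule.submodule_is_module[OF _ module_free_module, of "p ` carrier (?F r)" 1] by simp
  qed
  show phM: "p \<in> mhom R (?F r) ?M"
    unfolding embed_ideal_def using pim
    by (intro mhom_restrict_codomain[OF ph]) (simp add: embed_ideal_def)
qed

end

context short_local_ring
begin

text \<open>
  Let the ideal \<open>I\<close> be generated by \<open>u\<^sub>1, \<dots>, u\<^sub>r\<close>. The hypotheses say that \<open>I\<^sup>2 = 0\<close>, that the
  generators are linearly independent modulo \<open>J I\<close>, that an element annihilating \<open>I\<close> lies in \<open>I\<close>, and
  that a vector \<open>a\<close> satisfying all linear relations between the generators, in other words the vector of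
  values of a homomorphism \<open>I \<rightarrow> R\<close>, is a multiple of \<open>u\<close>.
  
  These are the exactness properties of the sequence \<open>R\<^sup>m \<rightarrow> R\<^sup>r \<rightarrow> R \<rightarrow> R\<^sup>r \<rightarrow> R\<^sup>m\<close> with the maps
  \<open>f\<close>, \<open>p\<close>, \<open>c = p\<^sup>T\<close> and \<open>ft = f\<^sup>T\<close>, where \<open>f\<close> covers the relations between the generators. The sequence
  starts a resolution of the transpose, which is the cokernel of \<open>f\<^sup>T\<close>. Each property is used twice, once in
  the resolution and once in the dual complex: a linear form on \<open>R\<^sup>r\<close> that vanishes on the image of \<open>c\<close> is a
  relation, a linear form on \<open>R\<close> that vanishes on the image of \<open>p\<close> annihilates \<open>I\<close>, and a linear form on
  \<open>R\<^sup>r\<close> that vanishes on the image of \<open>f\<close> is a homomorphism \<open>I \<rightarrow> R\<close>.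
\<close>

lemma torsionfree_3_embed_idealI:
  assumes noeth: "\<And>n U. submodule U R (free_module R n) \<Longrightarrow>
      \<exists>m f. f \<in> mhom R (free_module R m) (free_module R n) \<and> f ` carrier (free_module R m) = U"
    and u: "u \<in> carrier (free_module R r)"
    and zero: "\<And>i j. u i \<otimes> u j = \<zero>"
    and minimal: "\<And>x i. \<lbrakk>x \<in> carrier (free_module R r); dot R r x u = \<zero>\<rbrakk> \<Longrightarrow> x i \<in> J"
    and ann: "\<And>a. \<lbrakk>a \<in> carrier R; \<And>i. a \<otimes> u i = \<zero>\<rbrakk> \<Longrightarrow>
      \<exists>x\<in>carrier (free_module R r). a = dot R r x u"
    and homs: "\<And>a. \<lbrakk>a \<in> carrier (free_module R r);
        \<And>x. x \<in> carrier (free_module R r) \<Longrightarrow> dot R r x u = \<zero> \<Longrightarrow> dot R r x a = \<zero>\<rbrakk> \<Longrightarrow>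
      \<exists>c\<in>carrier R. a = (\<lambda>i. c \<otimes> u i)"
  shows "torsionfree 3 R (embed_ideal R {dot R r x u | x. x \<in> carrier (free_module R r)})"
proof -
  let ?F = "free_module R"
  let ?M = "embed_ideal R {dot R r x u | x. x \<in> carrier (?F r)}"
  interpret J: ideal J R by (rule J_ideal)
  define p where "p = (\<lambda>x\<in>carrier (?F r). \<lambda>i::nat. if i = 0 then dot R r x u else \<zero>)"
  note pres = embed_ideal_presentation[OF u, folded p_def]
  note ph = pres(1) and phM = pres(2) and pim = pres(3) and ker1 = pres(4) and ker2 = pres(5)
    and M = pres(6)
  have p: "p x = (\<lambda>i. if i = 0 then dot R r x u else \<zero>)" if "x \<in> carrier (?F r)" for x
    unfolding p_def restrict_apply'[OF that] by (rule refl)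
  let ?K = "mkernel (?F r) ?M p"
  interpret Fr: module R "?F r" by (rule module_free_module)
  have KS: "submodule ?K R (?F r)"
    unfolding ker1 ker2[symmetric] by (rule submodule_mkernel[OF module_free_module module_free_module ph])
  have cover0: "projective_cover R (?F r) ?M p"
  proof (rule projective_cover_free_moduleI[OF M phM pim])
    fix x i assume "x \<in> ?K"
    then show "x i \<in> J" unfolding ker1 using minimal by blast
  qed
  obtain m f where f: "f \<in> mhom R (?F m) ((?F r)\<lparr>carrier := ?K\<rparr>)"
    and fim: "f ` carrier (?F m) = ?K"
    and cover1: "projective_cover R (?F m) ((?F r)\<lparr>carrier := ?K\<rparr>) f"
  proof -
    have mK: "module R ((?F r)\<lparr>carrier := ?K\<rparr>)"
      by (rule submodule.submodule_is_module[OF KS module_free_module])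
    obtain n g where g: "g \<in> mhom R (?F n) (?F r)" "g ` carrier (?F n) = ?K"
      using noeth[OF KS] by blast
    have "g \<in> mhom R (?F n) ((?F r)\<lparr>carrier := ?K\<rparr>)"
      by (rule mhom_restrict_codomain[OF g(1) equalityD1[OF g(2)]])
    moreover have "g ` carrier (?F n) = carrier ((?F r)\<lparr>carrier := ?K\<rparr>)"
      unfolding g(2) by simp
    ultimately have "\<exists>g. g \<in> mhom R (?F n) ((?F r)\<lparr>carrier := ?K\<rparr>) \<and>
        g ` carrier (?F n) = carrier ((?F r)\<lparr>carrier := ?K\<rparr>)" by blast
    from projective_cover_exists[OF mK this] that show ?thesis by auto
  qed
  have fr: "f \<in> mhom R (?F m) (?F r)"
    using mhom_extend_codomain[OF f] Fr.submoduleE(1)[OF KS] by blast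
  let ?e = "unit_vector R"
  have fe: "f (?e j) \<in> carrier (?F r)" if "j < m" for j
    using mhomD(1)[OF fr unit_vector_closed[OF that]] .
  define ft where "ft = (\<lambda>y\<in>carrier (?F r). \<lambda>j. if j < m then dot R r y (f (?e j)) else \<zero>)"
  have ft: "ft y = (\<lambda>j. if j < m then dot R r y (f (?e j)) else \<zero>)" if "y \<in> carrier (?F r)" for y
    using that unfolding ft_def by simp
  have dh: "(\<lambda>y\<in>carrier (?F r). dot R r y (f (?e j))) \<in> mhom R (?F r) (regular_module R)" if "j < m" for j
    by (rule dot_mhom[OF fe[OF that]])
  have fth: "ft \<in> mhom R (?F r) (?F m)"
  proof (rule mhomI)
    show "ft \<in> extensional (carrier (?F r))" unfolding ft_def by simp
  next
    fix x assume x: "x \<in> carrier (?F r)"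
    show "ft x \<in> carrier (?F m)" using ft[OF x] dot_closed[OF x fe] by auto
  next
    fix x y assume x: "x \<in> carrier (?F r)" and y: "y \<in> carrier (?F r)"
    show "ft (x \<oplus>\<^bsub>?F r\<^esub> y) = ft x \<oplus>\<^bsub>?F m\<^esub> ft y"
    proof
      fix j show "ft (x \<oplus>\<^bsub>?F r\<^esub> y) j = (ft x \<oplus>\<^bsub>?F m\<^esub> ft y) j"
        using ft[OF x] ft[OF y] ft[OF Fr.a_closed[OF x y]] mhomD(2)[OF dh[of j] x y]
          x y Fr.a_closed[OF x y] by (simp del: free_module_simps(1))
    qed
  next
    fix a x assume a: "a \<in> carrier R" and x: "x \<in> carrier (?F r)"
    show "ft (a \<odot>\<^bsub>?F r\<^esub> x) = a \<odot>\<^bsub>?F m\<^esub> ft x"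
    proof
      fix j show "ft (a \<odot>\<^bsub>?F r\<^esub> x) j = (a \<odot>\<^bsub>?F m\<^esub> ft x) j"
        using ft[OF x] ft[OF Fr.smult_closed[OF a x]] mhomD(3)[OF dh[of j] a x]
          a x Fr.smult_closed[OF a x] by (simp del: free_module_simps(1))
    qed
  qed
  \<comment> \<open>That \<open>ft\<close> is the transpose of \<open>f\<close>; as both sides are linear in \<open>h\<close>, it suffices to take basis vectors.\<close>
  have adjoint: "dot R r x (f h) = dot R m (ft x) h"
    if x: "x \<in> carrier (?F r)" and h: "h \<in> carrier (?F m)" for x h
  proof -
    have ftx: "ft x \<in> carrier (?F m)" by (rule mhomD(1)[OF fth x])
    have "compose (carrier (?F m)) (\<lambda>y\<in>carrier (?F r). dot R r y x) f =
      (\<lambda>h\<in>carrier (?F m). dot R m h (ft x))"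
    proof (rule mhom_free_eqI[OF module_regular_module
          mhom_compose[OF module_free_module fr dot_mhom[OF x]] dot_mhom[OF ftx]])
      fix j assume j: "j < m"
      show "compose (carrier (?F m)) (\<lambda>y\<in>carrier (?F r). dot R r y x) f (?e j) =
        (\<lambda>h\<in>carrier (?F m). dot R m h (ft x)) (?e j)"
        using unit_vector_closed[OF j] fe[OF j] dot_unit_vector[OF ftx j] ft[OF x] j
          dot_commute[OF x fe[OF j]]
        by (simp add: compose_eq del: free_module_simps)
    qed
    then have "compose (carrier (?F m)) (\<lambda>y\<in>carrier (?F r). dot R r y x) f h =
      (\<lambda>h\<in>carrier (?F m). dot R m h (ft x)) h" by (rule fun_cong)
    then have "dot R r (f h) x = dot R m h (ft x)"
      using h mhomD(1)[OF fr h] by (simp add: compose_eq del: free_module_simps)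
    then show ?thesis using dot_commute mhomD(1)[OF fr h] ftx x h by metis
  qed
  have ft0: "ft x = (\<lambda>i. \<zero>) \<longleftrightarrow> (\<forall>k\<in>?K. dot R r x k = \<zero>)" if x: "x \<in> carrier (?F r)" for x
  proof
    assume ft0: "ft x = (\<lambda>i. \<zero>)"
    show "\<forall>k\<in>?K. dot R r x k = \<zero>"
    proof
      fix k assume "k \<in> ?K"
      then obtain h where h: "h \<in> carrier (?F m)" "k = f h" using fim by blast
      have "dot R m (\<lambda>i. \<zero>) h = \<zero>"
        unfolding dot_def using h(1) by (intro add.finprod_one_eqI) auto
      then show "dot R r x k = \<zero>" using adjoint[OF x h(1)] ft0 h(2) by simp
    qed
  next
    assume *: "\<forall>k\<in>?K. dot R r x k = \<zero>"
    have "f (?e j) \<in> ?K" if "j < m" for j using fim unit_vector_closed[OF that] by blast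
    then show "ft x = (\<lambda>i. \<zero>)" using ft[OF x] * by auto
  qed
  define c where "c = (\<lambda>a\<in>carrier (?F 1). \<lambda>i. a 0 \<otimes> u i)"
  have uc: "u i \<in> carrier R" for i using u by auto
  have ch: "c \<in> mhom R (?F 1) (?F r)"
    unfolding c_def using u
    by (intro mhom_restrictI[OF module_free_module]) (auto simp: l_distr m_assoc)
  have c: "c a = (\<lambda>i. a 0 \<otimes> u i)" if "a \<in> carrier (?F 1)" for a
    using that unfolding c_def by simp
  define in1 where "in1 a = (\<lambda>i::nat. if i = 0 then a else \<zero>)" for a
  have in1: "in1 a \<in> carrier (?F 1)" "in1 a 0 = a" if "a \<in> carrier R" for a
    using that by (auto simp: in1_def)
  have dot_scaled: "dot R r x (\<lambda>i. a \<otimes> u i) = a \<otimes> dot R r x u"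
    if "a \<in> carrier R" "x \<in> carrier (?F r)" for a x
  proof -
    have v: "(\<lambda>i. a \<otimes> u i) \<in> carrier (?F r)" using that u by auto
    have "dot R r (a \<odot>\<^bsub>?F r\<^esub> u) x = a \<otimes> dot R r u x"
      using mhomD(3)[OF dot_mhom[OF that(2)] that(1) u] u v by (simp del: free_module_simps(1))
    then show ?thesis using dot_commute[OF that(2) u] dot_commute[OF that(2) v] by simp
  qed
  \<comment> \<open>The kernel of \<open>ft\<close> consists of the vectors satisfying all relations, that is, of \<open>Hom(I, R)\<close>.\<close>
  have ex1: "c ` carrier (?F 1) = mkernel (?F r) (?F m) ft"
  proof (intro equalityI subsetI)
    fix x assume "x \<in> c ` carrier (?F 1)"
    then obtain a where a: "a \<in> carrier (?F 1)" "x = c a" by blast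
    have x: "x \<in> carrier (?F r)" using a mhomD(1)[OF ch] by blast
    have a0: "a 0 \<in> carrier R" using a by auto
    have "dot R r x k = \<zero>" if "k \<in> ?K" for k
    proof -
      have k: "k \<in> carrier (?F r)" "dot R r k u = \<zero>" using that unfolding ker1 by auto
      have "dot R r x k = dot R r k x" by (rule dot_commute[OF x k(1)])
      then show ?thesis using a(2) c[OF a(1)] dot_scaled[OF a0 k(1)] k(2) a0 by simp
    qed
    then have "ft x = (\<lambda>i. \<zero>)" using ft0[OF x] by blast
    then show "x \<in> mkernel (?F r) (?F m) ft" using x by (simp add: mkernel_def)
  next
    fix x assume "x \<in> mkernel (?F r) (?F m) ft"
    then have x: "x \<in> carrier (?F r)" and "ft x = (\<lambda>i. \<zero>)" by (auto simp: mkernel_def)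
    then have *: "\<forall>k\<in>?K. dot R r x k = \<zero>" using ft0 by blast
    have "\<exists>a\<in>carrier R. x = (\<lambda>i. a \<otimes> u i)"
    proof (rule homs[OF x])
      fix k assume k: "k \<in> carrier (?F r)" "dot R r k u = \<zero>"
      then have "k \<in> ?K" unfolding ker1 by auto
      then show "dot R r k x = \<zero>" using * dot_commute[OF x k(1)] by simp
    qed
    then obtain a where "a \<in> carrier R" "x = (\<lambda>i. a \<otimes> u i)" by blast
    then have "x = c (in1 a)" "in1 a \<in> carrier (?F 1)" using c in1 by auto
    then show "x \<in> c ` carrier (?F 1)" by blast
  qed
  have dot_u_u: "dot R r x u \<otimes> u i = \<zero>" if x: "x \<in> carrier (?F r)" for x i
  proof -
    have "dot R r x u \<otimes> u i = (\<Oplus>j\<in>{..<r}. x j \<otimes> u j \<otimes> u i)"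
      unfolding dot_def using x uc by (intro finsum_ldistr) auto
    also have "\<dots> = \<zero>"
      using x uc zero by (intro add.finprod_one_eqI) (auto simp: m_assoc)
    finally show ?thesis .
  qed
  \<comment> \<open>The kernel of \<open>c\<close> is the annihilator of \<open>I\<close>.\<close>
  have ex2: "p ` carrier (?F r) = mkernel (?F 1) (?F r) c"
  proof (intro equalityI subsetI)
    fix z assume "z \<in> p ` carrier (?F r)"
    then obtain x where x: "x \<in> carrier (?F r)" "z = p x" by blast
    have z: "z \<in> carrier (?F 1)" using x mhomD(1)[OF ph] by blast
    have "c z = (\<lambda>i. \<zero>)" unfolding c[OF z] using x p[OF x(1)] dot_u_u[OF x(1)] by simp
    then show "z \<in> mkernel (?F 1) (?F r) c" using z by (simp add: mkernel_def)
  next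
    fix z assume "z \<in> mkernel (?F 1) (?F r) c"
    then have z: "z \<in> carrier (?F 1)" and c0: "c z = (\<lambda>i. \<zero>)" by (auto simp: mkernel_def)
    have "z 0 \<otimes> u i = \<zero>" for i using c0 unfolding c[OF z] by (rule fun_cong)
    then obtain x where x: "x \<in> carrier (?F r)" "z 0 = dot R r x u"
      using ann[of "z 0"] z by auto
    have "z = p x" unfolding p[OF x(1)] using x z by (auto simp: fun_eq_iff)
    then show "z \<in> p ` carrier (?F r)" using x by blast
  qed
  have ex3: "f ` carrier (?F m) = mkernel (?F r) (?F 1) p"
    using fim ker1 ker2 by simp
  obtain n0 d0 where nd: "n0 0 = r" "n0 (Suc 0) = m" "d0 0 = f"
    "\<And>i. d0 i \<in> mhom R (?F (n0 (Suc i))) (?F (n0 i))"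
    "\<And>i. d0 (Suc i) ` carrier (?F (n0 (Suc (Suc i)))) = mkernel (?F (n0 (Suc i))) (?F (n0 i)) (d0 i)"
    using free_resolution_continues[OF noeth fr] by blast
  \<comment> \<open>The terms of the resolution in degrees 0, 1 and 2 are put in front; the chosen tail begins with \<open>f\<close> in degree 3.\<close>
  define n where "n = case_nat m (case_nat r (case_nat 1 n0))"
  define d where "d = case_nat ft (case_nat c (case_nat p d0))"
  have n: "n 0 = m" "n 1 = r" "n 2 = 1" "n 3 = r" "n 4 = m" "\<And>i. n (Suc (Suc (Suc i))) = n0 i"
    using nd by (simp_all add: n_def numeral_eq_Suc)
  have dd: "d 0 = ft" "d 1 = c" "d 2 = p" "d 3 = f" "\<And>i. d (Suc (Suc (Suc i))) = d0 i"
    using nd by (simp_all add: d_def numeral_eq_Suc)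
  have ndS: "n (Suc 0) = r" "n (Suc (Suc 0)) = 1" "n (Suc (Suc (Suc 0))) = r"
    "n (Suc (Suc (Suc (Suc 0)))) = m" "d (Suc 0) = c" "d (Suc (Suc 0)) = p"
    "d (Suc (Suc (Suc 0))) = f"
    using nd by (simp_all add: n_def d_def)
  define P where "P i = ?F (n i)" for i
  have dh: "d i \<in> mhom R (P (Suc i)) (P i)" for i
  proof -
    have "i = 0 \<or> i = Suc 0 \<or> i = Suc (Suc 0) \<or> (\<exists>k. i = Suc (Suc (Suc k)))"
      by (metis not0_implies_Suc)
    then show ?thesis
      using fth ch ph nd(4) by (elim disjE exE) (simp_all only: P_def n dd ndS nd(1-3))
  qed
  have exact: "d (Suc i) ` carrier (P (Suc (Suc i))) = mkernel (P (Suc i)) (P i) (d i)" for i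
  proof -
    have "i = 0 \<or> i = Suc 0 \<or> i = Suc (Suc 0) \<or> (\<exists>k. i = Suc (Suc (Suc k)))"
      by (metis not0_implies_Suc)
    then show ?thesis
      using ex1 ex2 ex3 nd(5) by (elim disjE exE) (simp_all only: P_def n dd ndS nd(1-3))
  qed
  have imS: "submodule (ft ` carrier (?F r)) R (?F m)"
    by (rule submodule_image[OF module_free_module module_free_module fth Fr.carrier_is_submodule])
  obtain N :: "('a, nat \<Rightarrow> 'a) module" and q where N: "module R N" and q: "q \<in> mhom R (?F m) N"
    and qim: "q ` carrier (?F m) = carrier N"
    and qker: "mkernel (?F m) N q = ft ` carrier (?F r)"
    using quotient_on_representatives[OF module_free_module imS] by blast
  have res: "projective_resolution R N P d q"
    unfolding projective_resolution_def
    using dh exact q qim qker projective_free_module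
    by (simp add: P_def n dd ndS del: free_module_simps)
  \<comment> \<open>\<open>vec k\<close> identifies the dual of \<open>R\<^sup>k\<close> with \<open>R\<^sup>k\<close>, and composition with \<open>f\<close> becomes \<open>ft\<close>.\<close>
  define vec where "vec k g = (\<lambda>i. if i < k then g (?e i) else \<zero>)" for k and g :: "(nat \<Rightarrow> 'a) \<Rightarrow> 'a"
  have vec: "vec k g \<in> carrier (?F k)" "\<And>x. x \<in> carrier (?F k) \<Longrightarrow> g x = dot R k x (vec k g)"
    if "g \<in> mhom R (?F k) (regular_module R)" for k g
    using mhom_free_eq_dot[OF that] unfolding vec_def by auto
  have trans: "is_transpose R ?M N"
  proof -
    let ?q = "\<lambda>g\<in>mhom R (?F m) (regular_module R). q (vec m g)"
    interpret Fm: module R "?F m" by (rule module_free_module)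
    have vdot: "vec m (\<lambda>x\<in>carrier (?F m). dot R m x y) = y" if y: "y \<in> carrier (?F m)" for y
    proof
      fix i
      show "vec m (\<lambda>x\<in>carrier (?F m). dot R m x y) i = y i"
      proof (cases "i < m")
        case True
        then show ?thesis
          using dot_unit_vector[OF y True] unit_vector_closed[OF True]
          by (simp add: vec_def del: free_module_simps)
      next
        case False
        then show ?thesis using y by (simp add: vec_def)
      qed
    qed
    have "?q \<in> mhom (opposite_ring R) (dual_module R (?F m)) N"
      unfolding mhom_opposite_ring[OF cring_axioms]
    proof (rule mhomI)
      show "?q \<in> extensional (carrier (dual_module R (?F m)))" by (simp add: dual_module_def)
    next
      fix g assume "g \<in> carrier (dual_module R (?F m))"
      then show "?q g \<in> carrier N"
        using mhomD(1)[OF q] vec(1) by (simp add: dual_module_def del: free_module_simps)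
    next
      fix g h assume "g \<in> carrier (dual_module R (?F m))" "h \<in> carrier (dual_module R (?F m))"
      then have gh: "g \<in> mhom R (?F m) (regular_module R)" "h \<in> mhom R (?F m) (regular_module R)"
        by (simp_all add: dual_module_def)
      have sum: "(\<lambda>x\<in>carrier (?F m). g x \<oplus> h x) \<in> mhom R (?F m) (regular_module R)"
        using mhomD(1-3)[OF gh(1)] mhomD(1-3)[OF gh(2)]
        by (intro mhom_restrictI[OF module_free_module])
          (simp_all add: a_ac r_distr del: free_module_simps)
      have "vec m (\<lambda>x\<in>carrier (?F m). g x \<oplus> h x) = vec m g \<oplus>\<^bsub>?F m\<^esub> vec m h"
        by (auto simp: vec_def fun_eq_iff simp del: free_module_simps(1))
      then show "?q (g \<oplus>\<^bsub>dual_module R (?F m)\<^esub> h) = ?q g \<oplus>\<^bsub>N\<^esub> ?q h"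
        using gh sum mhomD(2)[OF q vec(1)[OF gh(1)] vec(1)[OF gh(2)]]
        by (simp add: dual_module_def del: free_module_simps)
    next
      fix a g assume a: "a \<in> carrier R" and "g \<in> carrier (dual_module R (?F m))"
      then have g: "g \<in> mhom R (?F m) (regular_module R)" by (simp_all add: dual_module_def)
      have prod: "(\<lambda>x\<in>carrier (?F m). g x \<otimes> a) \<in> mhom R (?F m) (regular_module R)"
        using mhomD(1-3)[OF g] a
        by (intro mhom_restrictI[OF module_free_module])
          (simp_all add: m_assoc l_distr del: free_module_simps)
      have "vec m (\<lambda>x\<in>carrier (?F m). g x \<otimes> a) = a \<odot>\<^bsub>?F m\<^esub> vec m g"
        using a mhomD(1)[OF g unit_vector_closed] 
        by (auto simp: vec_def fun_eq_iff m_comm simp del: free_module_simps(1))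
      then show "?q (a \<odot>\<^bsub>dual_module R (?F m)\<^esub> g) = a \<odot>\<^bsub>N\<^esub> ?q g"
        using g a prod mhomD(3)[OF q a vec(1)[OF g]]
        by (simp add: dual_module_def del: free_module_simps)
    qed
    moreover have "?q ` carrier (dual_module R (?F m)) = carrier N"
    proof (intro equalityI subsetI)
      fix z assume "z \<in> ?q ` carrier (dual_module R (?F m))"
      then show "z \<in> carrier N"
        using mhomD(1)[OF q] vec(1) by (auto simp: dual_module_def simp del: free_module_simps)
    next
      fix z assume "z \<in> carrier N"
      then obtain y where y: "y \<in> carrier (?F m)" "z = q y" using qim by blast
      then have "z = ?q (\<lambda>x\<in>carrier (?F m). dot R m x y)"
        using vdot[OF y(1)] dot_mhom[OF y(1)] by (simp del: free_module_simps)
      then show "z \<in> ?q ` carrier (dual_module R (?F m))"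
        using dot_mhom[OF y(1)] by (simp add: dual_module_def del: free_module_simps)
    qed
    moreover have "mkernel (dual_module R (?F m)) N ?q =
        (\<lambda>g. compose (carrier (?F m)) g f) ` carrier (dual_module R (?F r))"
    proof -
      have comp: "vec m (compose (carrier (?F m)) g f) = ft (vec r g)"
        if g: "g \<in> mhom R (?F r) (regular_module R)" for g
      proof
        fix j show "vec m (compose (carrier (?F m)) g f) j = ft (vec r g) j"
        proof (cases "j < m")
          case True
          then have "vec m (compose (carrier (?F m)) g f) j = compose (carrier (?F m)) g f (?e j)"
            by (simp add: vec_def)
          also have "\<dots> = g (f (?e j))" by (rule compose_eq[OF unit_vector_closed[OF True]])
          also have "\<dots> = dot R r (vec r g) (f (?e j))"
            using vec(2)[OF g fe[OF True]] dot_commute[OF vec(1)[OF g] fe[OF True]] by simp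
          also have "\<dots> = ft (vec r g) j" using ft[OF vec(1)[OF g]] True by simp
          finally show ?thesis .
        next
          case False
          then show ?thesis using ft[OF vec(1)[OF g]] by (simp add: vec_def)
        qed
      qed
      have inj: "g = h" if g: "g \<in> mhom R (?F m) (regular_module R)"
        and h: "h \<in> mhom R (?F m) (regular_module R)" and "vec m g = vec m h" for g h
      proof (rule mhom_free_eqI[OF module_regular_module g h])
        fix i assume "i < m"
        then show "g (?e i) = h (?e i)" using fun_cong[OF that(3), of i] by (simp add: vec_def)
      qed
      have ker: "g \<in> mkernel (dual_module R (?F m)) N ?q \<longleftrightarrow>
        g \<in> mhom R (?F m) (regular_module R) \<and> vec m g \<in> ft ` carrier (?F r)" for g
        unfolding qker[symmetric] using vec(1)
        by (auto simp: mkernel_def dual_module_def simp del: free_module_simps)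
      show ?thesis
      proof (intro equalityI subsetI)
        fix g assume "g \<in> mkernel (dual_module R (?F m)) N ?q"
        then have g: "g \<in> mhom R (?F m) (regular_module R)" and "vec m g \<in> ft ` carrier (?F r)"
          unfolding ker by auto
        then obtain y where y: "y \<in> carrier (?F r)" "vec m g = ft y" by blast
        let ?h = "\<lambda>x\<in>carrier (?F r). dot R r x y"
        have h: "?h \<in> mhom R (?F r) (regular_module R)" by (rule dot_mhom[OF y(1)])
        have "vec r ?h = y"
        proof
          fix i show "vec r ?h i = y i"
          proof (cases "i < r")
            case True
            then show ?thesis
              using dot_unit_vector[OF y(1) True] unit_vector_closed[OF True]
              by (simp add: vec_def del: free_module_simps)
          next
            case False
            then show ?thesis using y by (simp add: vec_def)
          qed
        qed
        then have "g = compose (carrier (?F m)) ?h f"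
          using comp[OF h] y(2) by (intro inj[OF g] mhom_compose[OF module_free_module fr h]) simp
        then show "g \<in> (\<lambda>g. compose (carrier (?F m)) g f) ` carrier (dual_module R (?F r))"
          using h by (simp add: dual_module_def del: free_module_simps)
      next
        fix g assume "g \<in> (\<lambda>g. compose (carrier (?F m)) g f) ` carrier (dual_module R (?F r))"
        then obtain h where h: "h \<in> mhom R (?F r) (regular_module R)" "g = compose (carrier (?F m)) h f"
          by (auto simp: dual_module_def simp del: free_module_simps)
        then show "g \<in> mkernel (dual_module R (?F m)) N ?q"
          unfolding ker using comp[OF h(1)] vec(1)[OF h(1)] mhom_compose[OF module_free_module fr h(1)]
          by auto
      qed
    qed
    moreover have "lmodule (opposite_ring R) N"
      using N module_opposite_ring[OF cring_axioms] lmodule_iff_module[OF cring_opposite_ring[OF cring_axioms]]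
      by blast
    ultimately show ?thesis
      unfolding is_transpose_def using cover0 cover1 by blast
  qed
  have coc_le: "coboundaries R P d (regular_module R) (Suc i) \<subseteq> cocycles R P d (regular_module R) (Suc i)" for i
  proof
    fix g assume "g \<in> coboundaries R P d (regular_module R) (Suc i)"
    then obtain h where h: "h \<in> mhom R (P i) (regular_module R)"
      and g: "g = compose (carrier (P (Suc i))) h (d i)" by auto
    have Pm: "module R (P i)" for i unfolding P_def by (rule module_free_module)
    have "g (d (Suc i) x) = \<zero>" if x: "x \<in> carrier (P (Suc (Suc i)))" for x
    proof -
      have "d (Suc i) x \<in> mkernel (P (Suc i)) (P i) (d i)" using exact[of i] x by blast
      then show ?thesis unfolding g using mhom_zero[OF Pm module_regular_module h]
        by (simp add: mkernel_def compose_eq)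
    qed
    then show "g \<in> cocycles R P d (regular_module R) (Suc i)"
      unfolding cocycles_def using mhom_compose[OF Pm dh h] g by simp
  qed
  \<comment> \<open>A form \<open>g\<close> with \<open>g \<circ> c = 0\<close> is a relation \<open>f h\<close>, and then \<open>g\<close> is the form \<open>h\<close> composed with \<open>ft\<close>.\<close>
  have coc1: "cocycles R P d (regular_module R) (Suc 0) \<subseteq> coboundaries R P d (regular_module R) (Suc 0)"
  proof
    fix g assume "g \<in> cocycles R P d (regular_module R) (Suc 0)"
    then have g: "g \<in> mhom R (?F r) (regular_module R)"
      and 0: "\<And>a. a \<in> carrier (?F 1) \<Longrightarrow> g (c a) = \<zero>"
      by (simp_all add: cocycles_def P_def ndS del: free_module_simps)
    have "c (in1 \<one>) = u" using c[OF in1(1)[OF one_closed]] in1(2)[OF one_closed] uc by simp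
    then have "g u = \<zero>" using 0[OF in1(1)[OF one_closed]] by simp
    then have "vec r g \<in> ?K"
      unfolding ker1 using vec[OF g] u dot_commute[OF u vec(1)[OF g]] by auto
    then obtain h where h: "h \<in> carrier (?F m)" "vec r g = f h" using fim by blast
    let ?h = "\<lambda>x\<in>carrier (?F m). dot R m x h"
    have "g = compose (carrier (?F r)) ?h ft"
    proof (rule extensionalityI[OF mhomD(4)[OF g]])
      fix x assume x: "x \<in> carrier (?F r)"
      show "g x = compose (carrier (?F r)) ?h ft x"
        using vec(2)[OF g x] adjoint[OF x h(1)] h(2) x mhomD(1)[OF fth x]
        by (simp add: compose_eq del: free_module_simps)
    qed simp
    then show "g \<in> coboundaries R P d (regular_module R) (Suc 0)"
      using dot_mhom[OF h(1)] by (auto simp: P_def ndS n(1) dd(1) simp del: free_module_simps)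
  qed
  \<comment> \<open>A form \<open>g\<close> with \<open>g \<circ> p = 0\<close> is the multiplication by some \<open>b\<close> annihilating \<open>I\<close>, hence \<open>b = y \<bullet> u\<close>.\<close>
  have coc2: "cocycles R P d (regular_module R) (Suc (Suc 0)) \<subseteq>
      coboundaries R P d (regular_module R) (Suc (Suc 0))"
  proof
    fix g assume "g \<in> cocycles R P d (regular_module R) (Suc (Suc 0))"
    then have g: "g \<in> mhom R (?F 1) (regular_module R)"
      and 0: "\<And>x. x \<in> carrier (?F r) \<Longrightarrow> g (p x) = \<zero>"
      by (simp_all add: cocycles_def P_def ndS del: free_module_simps)
    define b where "b = vec 1 g 0"
    have bR: "b \<in> carrier R" using vec(1)[OF g] by (auto simp: b_def)
    have gx: "g x = x 0 \<otimes> b" if "x \<in> carrier (?F 1)" for x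
    proof -
      have "g x = dot R 1 x (vec 1 g)" using vec(2)[OF g that] .
      also have "\<dots> = x 0 \<otimes> b"
        unfolding dot_def b_def using that vec(1)[OF g] finsum_lessThan_Suc[of 0 "\<lambda>i. x i \<otimes> vec 1 g i"]
        by auto
      finally show ?thesis .
    qed
    have "b \<otimes> u i = \<zero>" for i
    proof (cases "i < r")
      case True
      have e: "?e i \<in> carrier (?F r)" by (rule unit_vector_closed[OF True])
      have "p (?e i) 0 = u i" using p[OF e] dot_unit_vector[OF u True] by simp
      then have "u i \<otimes> b = \<zero>" using 0[OF e] gx[OF mhomD(1)[OF ph e]] by simp
      then show ?thesis using m_comm[OF bR uc] by simp
    next
      case False
      then show ?thesis using u bR by simp
    qed
    then obtain y where y: "y \<in> carrier (?F r)" "b = dot R r y u" using ann[OF bR] by blast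
    let ?h = "\<lambda>x\<in>carrier (?F r). dot R r x y"
    have "g = compose (carrier (?F 1)) ?h c"
    proof (rule extensionalityI[OF mhomD(4)[OF g]])
      fix x assume x: "x \<in> carrier (?F 1)"
      have x0: "x 0 \<in> carrier R" using x by auto
      have cx: "c x \<in> carrier (?F r)" using mhomD(1)[OF ch x] .
      have "dot R r (c x) y = dot R r y (c x)" by (rule dot_commute[OF cx y(1)])
      also have "\<dots> = x 0 \<otimes> b" unfolding c[OF x] y(2) by (rule dot_scaled[OF x0 y(1)])
      finally show "g x = compose (carrier (?F 1)) ?h c x"
        using gx[OF x] x cx by (simp add: compose_eq del: free_module_simps)
    qed simp
    then show "g \<in> coboundaries R P d (regular_module R) (Suc (Suc 0))"
      using dot_mhom[OF y(1)] by (auto simp: P_def ndS simp del: free_module_simps)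
  qed
  \<comment> \<open>A form \<open>g\<close> with \<open>g \<circ> f = 0\<close> is a homomorphism \<open>I \<rightarrow> R\<close>, hence a multiple \<open>a u\<close>.\<close>
  have coc3: "cocycles R P d (regular_module R) (Suc (Suc (Suc 0))) \<subseteq>
      coboundaries R P d (regular_module R) (Suc (Suc (Suc 0)))"
  proof
    fix g assume "g \<in> cocycles R P d (regular_module R) (Suc (Suc (Suc 0)))"
    then have g: "g \<in> mhom R (?F r) (regular_module R)"
      and 0: "\<And>x. x \<in> carrier (?F m) \<Longrightarrow> g (f x) = \<zero>"
      by (simp_all add: cocycles_def P_def ndS del: free_module_simps)
    have "\<exists>a\<in>carrier R. vec r g = (\<lambda>i. a \<otimes> u i)"
    proof (rule homs[OF vec(1)[OF g]])
      fix x assume x: "x \<in> carrier (?F r)" "dot R r x u = \<zero>"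
      then have "x \<in> ?K" unfolding ker1 by auto
      then obtain y where "y \<in> carrier (?F m)" "x = f y" using fim by blast
      then show "dot R r x (vec r g) = \<zero>" using 0 vec(2)[OF g x(1)] by simp
    qed
    then obtain a where a: "a \<in> carrier R" "vec r g = (\<lambda>i. a \<otimes> u i)" by blast
    let ?h = "\<lambda>x\<in>carrier (?F 1). dot R 1 x (in1 a)"
    have "g = compose (carrier (?F r)) ?h p"
    proof (rule extensionalityI[OF mhomD(4)[OF g]])
      fix x assume x: "x \<in> carrier (?F r)"
      note px = mhomD(1)[OF ph x]
      have DR: "dot R r x u \<in> carrier R" by (rule dot_closed[OF x u])
      have "dot R 1 (p x) (in1 a) = p x 0 \<otimes> a"
        unfolding dot_def using a(1) px in1[OF a(1)] finsum_lessThan_Suc[of 0 "\<lambda>i. p x i \<otimes> in1 a i"]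
        by auto
      also have "\<dots> = a \<otimes> dot R r x u" using p[OF x] DR m_comm[OF DR a(1)] by simp
      also have "\<dots> = g x" using vec(2)[OF g x] a(2) dot_scaled[OF a(1) x] by simp
      finally show "g x = compose (carrier (?F r)) ?h p x"
        using x px by (simp add: compose_eq del: free_module_simps)
    qed simp
    then show "g \<in> coboundaries R P d (regular_module R) (Suc (Suc (Suc 0)))"
      using dot_mhom[OF in1(1)[OF a(1)]] by (auto simp: P_def ndS simp del: free_module_simps)
  qed
  have Ext: "Ext_vanishes R N (regular_module R) i" if "i \<in> {1..3}" for i
  proof -
    have "i = Suc 0 \<or> i = Suc (Suc 0) \<or> i = Suc (Suc (Suc 0))" using that by auto
    then have "cocycles R P d (regular_module R) i = coboundaries R P d (regular_module R) i"
      using coc_le coc1 coc2 coc3 by blast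
    then have "trivial_group (cohomology R P d (regular_module R) i)"
      using dh by (intro trivial_cohomologyI module_regular_module)
        (simp_all add: P_def module_free_module)
    then show ?thesis unfolding Ext_vanishes_def using res by blast
  qed
  show ?thesis
    unfolding torsionfree_def using trans Ext Ext_vanishes_opposite_ring[OF cring_axioms] by blast
qed

end

section \<open>Lengths computed by coordinates\<close>

text \<open>
  Let \<open>X\<close> be identified with \<open>K\<^sup>n\<close> by the coordinates \<open>\<xi>\<close> in such a way that \<open>A\<close> acts by triangular matrices
  and contains the scalars of \<open>K\<close>. The vectors whose coordinates from the \<open>i\<close>-th one on vanish form a
  submodule, and the factor of two successive submodules is one-dimensional over \<open>K\<close>, hence simple.
\<close>

lemma has_length_by_coordinates:
  fixes K :: "('k, 'e) ring_scheme" and A :: "('r, 'f) ring_scheme" and X :: "('r, 'm) module"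
    and \<xi> :: "'m \<Rightarrow> nat \<Rightarrow> 'k"
  assumes K: "field K" and X: "abelian_group X"
    and closed: "\<And>a x. a \<in> carrier A \<Longrightarrow> x \<in> carrier X \<Longrightarrow> a \<odot>\<^bsub>X\<^esub> x \<in> carrier X"
    and co: "\<And>x i. x \<in> carrier X \<Longrightarrow> i < n \<Longrightarrow> \<xi> x i \<in> carrier K"
    and add: "\<And>x y i. x \<in> carrier X \<Longrightarrow> y \<in> carrier X \<Longrightarrow> i < n \<Longrightarrow>
      \<xi> (x \<oplus>\<^bsub>X\<^esub> y) i = \<xi> x i \<oplus>\<^bsub>K\<^esub> \<xi> y i"
    and inj: "\<And>x. x \<in> carrier X \<Longrightarrow> (\<And>i. i < n \<Longrightarrow> \<xi> x i = \<zero>\<^bsub>K\<^esub>) \<Longrightarrow> x = \<zero>\<^bsub>X\<^esub>"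
    and triangular: "\<And>a x i j. a \<in> carrier A \<Longrightarrow> x \<in> carrier X \<Longrightarrow>
      (\<And>j. i \<le> j \<Longrightarrow> j < n \<Longrightarrow> \<xi> x j = \<zero>\<^bsub>K\<^esub>) \<Longrightarrow> i \<le> j \<Longrightarrow> j < n \<Longrightarrow> \<xi> (a \<odot>\<^bsub>X\<^esub> x) j = \<zero>\<^bsub>K\<^esub>"
    and scalar: "\<And>c. c \<in> carrier K \<Longrightarrow>
      \<exists>a\<in>carrier A. \<forall>x\<in>carrier X. \<forall>i<n. \<xi> (a \<odot>\<^bsub>X\<^esub> x) i = c \<otimes>\<^bsub>K\<^esub> \<xi> x i"
    and nonzero: "\<And>i. i < n \<Longrightarrow>
      \<exists>x\<in>carrier X. \<xi> x i \<noteq> \<zero>\<^bsub>K\<^esub> \<and> (\<forall>j. i < j \<and> j < n \<longrightarrow> \<xi> x j = \<zero>\<^bsub>K\<^esub>)"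
  shows "has_length A X n"
proof -
  interpret K: field K by fact
  interpret X: abelian_group X by fact
  have zero: "\<xi> \<zero>\<^bsub>X\<^esub> i = \<zero>\<^bsub>K\<^esub>" if "i < n" for i
  proof -
    have "\<xi> \<zero>\<^bsub>X\<^esub> i \<oplus>\<^bsub>K\<^esub> \<xi> \<zero>\<^bsub>X\<^esub> i = \<xi> \<zero>\<^bsub>X\<^esub> i" using add[of "\<zero>\<^bsub>X\<^esub>" "\<zero>\<^bsub>X\<^esub>" i] that by simp
    then show ?thesis using co[OF X.zero_closed that] K.add.l_cancel_one by blast
  qed
  have minus: "\<xi> (\<ominus>\<^bsub>X\<^esub> x) i = \<ominus>\<^bsub>K\<^esub> \<xi> x i" if "x \<in> carrier X" "i < n" for x i
  proof -
    have "\<xi> (\<ominus>\<^bsub>X\<^esub> x) i \<oplus>\<^bsub>K\<^esub> \<xi> x i = \<zero>\<^bsub>K\<^esub>"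
      using add[of "\<ominus>\<^bsub>X\<^esub> x" x i] that by (simp add: X.l_neg zero)
    then show ?thesis using co that K.minus_equality by simp
  qed
  define U where "U i = {x \<in> carrier X. \<forall>j. i \<le> j \<and> j < n \<longrightarrow> \<xi> x j = \<zero>\<^bsub>K\<^esub>}" for i
  have sub: "submodule (U i) A X" for i
  proof (rule submodule.intro)
    show "subgroup (U i) (add_monoid X)"
    proof (rule X.add.subgroupI)
      show "U i \<noteq> {}" using zero by (auto simp: U_def intro!: exI[of _ "\<zero>\<^bsub>X\<^esub>"])
    qed (auto simp: U_def minus add co)
    show "submodule_axioms (U i) A X"
      unfolding submodule_axioms_def U_def using triangular closed by blast
  qed
  show ?thesis
    unfolding has_length_def
  proof (intro exI[of _ U] conjI allI impI)
    show "U 0 = {\<zero>\<^bsub>X\<^esub>}" using inj zero by (auto simp: U_def)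
    show "U n = carrier X" by (auto simp: U_def)
    show "submodule (U i) A X" for i by (rule sub)
    fix i assume i: "i < n"
    obtain e where "e \<in> carrier X" "\<xi> e i \<noteq> \<zero>\<^bsub>K\<^esub>" "\<forall>j. i < j \<and> j < n \<longrightarrow> \<xi> e j = \<zero>\<^bsub>K\<^esub>"
      using nonzero[OF i] by blast
    then have "e \<in> U (Suc i)" "e \<notin> U i" using i by (auto simp: U_def)
    moreover have "U i \<subseteq> U (Suc i)" by (auto simp: U_def)
    ultimately show "U i \<subset> U (Suc i)" by blast
    show "\<nexists>V. submodule V A X \<and> U i \<subset> V \<and> V \<subset> U (Suc i)"
    proof
      assume "\<exists>V. submodule V A X \<and> U i \<subset> V \<and> V \<subset> U (Suc i)"
      then obtain V where V: "submodule V A X" "U i \<subset> V" "V \<subset> U (Suc i)" by blast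
      then obtain v where v: "v \<in> V" "v \<notin> U i" by blast
      have vX: "v \<in> carrier X" and v0: "\<And>j. i < j \<Longrightarrow> j < n \<Longrightarrow> \<xi> v j = \<zero>\<^bsub>K\<^esub>"
        using v V(3) by (auto simp: U_def)
      have vi: "\<xi> v i \<noteq> \<zero>\<^bsub>K\<^esub>"
        using v(2) vX v0 by (auto simp: U_def) (metis nat_less_le)
      have "U (Suc i) \<subseteq> V"
      proof
        fix x assume x: "x \<in> U (Suc i)"
        have xX: "x \<in> carrier X" and x0: "\<And>j. i < j \<Longrightarrow> j < n \<Longrightarrow> \<xi> x j = \<zero>\<^bsub>K\<^esub>"
          using x by (auto simp: U_def)
        have cK: "\<xi> v i \<in> carrier K" "\<xi> x i \<in> carrier K" using co vX xX i by auto
        have vu: "\<xi> v i \<in> Units K" using vi cK K.field_Units by simp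
        obtain a where a: "a \<in> carrier A"
          and av: "\<And>j. j < n \<Longrightarrow> \<xi> (a \<odot>\<^bsub>X\<^esub> v) j = (\<xi> x i \<otimes>\<^bsub>K\<^esub> inv\<^bsub>K\<^esub> \<xi> v i) \<otimes>\<^bsub>K\<^esub> \<xi> v j"
          using scalar[of "\<xi> x i \<otimes>\<^bsub>K\<^esub> inv\<^bsub>K\<^esub> \<xi> v i"] cK vu vX by auto
        have avX: "a \<odot>\<^bsub>X\<^esub> v \<in> carrier X" using closed a vX by simp
        define y where "y = x \<oplus>\<^bsub>X\<^esub> \<ominus>\<^bsub>X\<^esub> (a \<odot>\<^bsub>X\<^esub> v)"
        have yX: "y \<in> carrier X" using xX avX by (simp add: y_def)
        have "\<xi> y j = \<zero>\<^bsub>K\<^esub>" if j: "i \<le> j" "j < n" for j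
        proof (cases "j = i")
          case True
          have "\<xi> (a \<odot>\<^bsub>X\<^esub> v) i = \<xi> x i" using av[OF i] cK vu by (simp add: K.m_assoc)
          then show ?thesis using True i xX avX cK by (simp add: y_def add minus K.r_neg)
        next
          case False
          then show ?thesis
            using j xX avX x0[of j] v0[of j] av[OF j(2)] cK vu by (simp add: y_def add minus)
        qed
        then have "y \<in> V" using V(2) yX by (auto simp: U_def)
        moreover have "a \<odot>\<^bsub>X\<^esub> v \<in> V" using submodule.smult_closed[OF V(1) a v(1)] .
        moreover have "x = y \<oplus>\<^bsub>X\<^esub> a \<odot>\<^bsub>X\<^esub> v"
          using xX avX by (simp add: y_def X.a_assoc X.l_neg)
        ultimately show "x \<in> V"
          using subgroup.m_closed[OF submodule.axioms(1)[OF V(1)]] by simp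
      qed
      then show False using V(3) by blast
    qed
  qed
qed

text \<open>
  Coordinates on \<open>X\<close> with the common kernel \<open>U\<close> are coordinates on the quotient, evaluated at representatives.
\<close>

lemma has_length_quotient_by_coordinates:
  fixes K :: "('k, 'e) ring_scheme" and A :: "('r, 'f) ring_scheme" and X :: "('r, 'm) module"
    and \<xi> :: "'m \<Rightarrow> nat \<Rightarrow> 'k"
  assumes K: "field K" and X: "module A X" and U: "submodule U A X"
    and ker: "\<And>x. x \<in> carrier X \<Longrightarrow> x \<in> U \<longleftrightarrow> (\<forall>i<n. \<xi> x i = \<zero>\<^bsub>K\<^esub>)"
    and co: "\<And>x i. x \<in> carrier X \<Longrightarrow> i < n \<Longrightarrow> \<xi> x i \<in> carrier K"
    and add: "\<And>x y i. x \<in> carrier X \<Longrightarrow> y \<in> carrier X \<Longrightarrow> i < n \<Longrightarrow>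
      \<xi> (x \<oplus>\<^bsub>X\<^esub> y) i = \<xi> x i \<oplus>\<^bsub>K\<^esub> \<xi> y i"
    and triangular: "\<And>a x i j. a \<in> carrier A \<Longrightarrow> x \<in> carrier X \<Longrightarrow>
      (\<And>j. i \<le> j \<Longrightarrow> j < n \<Longrightarrow> \<xi> x j = \<zero>\<^bsub>K\<^esub>) \<Longrightarrow> i \<le> j \<Longrightarrow> j < n \<Longrightarrow> \<xi> (a \<odot>\<^bsub>X\<^esub> x) j = \<zero>\<^bsub>K\<^esub>"
    and scalar: "\<And>c. c \<in> carrier K \<Longrightarrow>
      \<exists>a\<in>carrier A. \<forall>x\<in>carrier X. \<forall>i<n. \<xi> (a \<odot>\<^bsub>X\<^esub> x) i = c \<otimes>\<^bsub>K\<^esub> \<xi> x i"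
    and nonzero: "\<And>i. i < n \<Longrightarrow>
      \<exists>x\<in>carrier X. \<xi> x i \<noteq> \<zero>\<^bsub>K\<^esub> \<and> (\<forall>j. i < j \<and> j < n \<longrightarrow> \<xi> x j = \<zero>\<^bsub>K\<^esub>)"
  shows "has_length A (quot_module X U) n"
proof -
  interpret K: field K by fact
  interpret X: module A X by fact
  note UE = X.submoduleE[OF U]
  interpret S: abelian_subgroup U X
    using X.a_comm_group submodule.axioms(1)[OF U] by (intro abelian_subgroupI2) auto
  let ?Q = "quot_module X U"
  let ?q = "\<lambda>x. U +>\<^bsub>X\<^esub> x"
  have car: "carrier ?Q = ?q ` carrier X"
    by (auto simp: quot_module_def A_RCOSETS_def')
  have addq: "?q (x \<oplus>\<^bsub>X\<^esub> y) = ?q x \<oplus>\<^bsub>?Q\<^esub> ?q y" if "x \<in> carrier X" "y \<in> carrier X" for x y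
    using S.a_rcos_sum[OF that] by (simp add: quot_module_def)
  have smq: "?q (a \<odot>\<^bsub>X\<^esub> x) = a \<odot>\<^bsub>?Q\<^esub> ?q x" if a: "a \<in> carrier A" and x: "x \<in> carrier X" for a x
  proof -
    have "?q (a \<odot>\<^bsub>X\<^esub> y) = ?q (a \<odot>\<^bsub>X\<^esub> x)" if y: "y \<in> ?q x" for y
    proof -
      obtain h where h: "h \<in> U" "y = h \<oplus>\<^bsub>X\<^esub> x" using y by (auto simp: a_r_coset_def')
      have hX: "h \<in> carrier X" using h UE(1) by blast
      have "a \<odot>\<^bsub>X\<^esub> y = a \<odot>\<^bsub>X\<^esub> h \<oplus>\<^bsub>X\<^esub> a \<odot>\<^bsub>X\<^esub> x" using h(2) a x hX by (simp add: X.smult_r_distr)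
      then have "a \<odot>\<^bsub>X\<^esub> y \<in> ?q (a \<odot>\<^bsub>X\<^esub> x)"
        using UE(4)[OF a h(1)] a x by (auto simp: a_r_coset_def')
      then show ?thesis using S.a_repr_independence' a x by (metis X.smult_closed)
    qed
    then have "(\<Union>y\<in>?q x. ?q (a \<odot>\<^bsub>X\<^esub> y)) = (\<Union>y\<in>?q x. ?q (a \<odot>\<^bsub>X\<^esub> x))" by simp
    moreover have "x \<in> ?q x" using X.a_rcosI[of "\<zero>\<^bsub>X\<^esub>" U x] UE(1) x by simp
    ultimately show ?thesis unfolding quot_module_def by auto
  qed
  have zq: "?q \<zero>\<^bsub>X\<^esub> = \<zero>\<^bsub>?Q\<^esub>" using UE(1) by (simp add: quot_module_def)
  have Q: "module A ?Q"
    by (rule module_surjective_image[OF X, of ?q]) (use car addq smq zq in auto)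
  interpret Q: module A ?Q by (rule Q)
  define rep where "rep Y = (SOME x. x \<in> Y)" for Y :: "'m set"
  have rep: "\<xi> (rep (?q x)) i = \<xi> x i" if x: "x \<in> carrier X" and i: "i < n" for x i
  proof -
    have "x \<in> ?q x" using X.a_rcosI[of "\<zero>\<^bsub>X\<^esub>" U x] UE(1) x by simp
    then have "rep (?q x) \<in> ?q x" unfolding rep_def by (rule someI)
    then obtain h where h: "h \<in> U" "rep (?q x) = h \<oplus>\<^bsub>X\<^esub> x" by (auto simp: a_r_coset_def')
    have hX: "h \<in> carrier X" using h UE(1) by blast
    then show ?thesis using h x i ker[OF hX] add[OF hX x i] co[OF x i] by simp
  qed
  show ?thesis
  proof (rule has_length_by_coordinates[OF K Q.abelian_group_axioms, where \<xi> = "\<lambda>Y. \<xi> (rep Y)"])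
    show "a \<odot>\<^bsub>?Q\<^esub> Y \<in> carrier ?Q" if "a \<in> carrier A" "Y \<in> carrier ?Q" for a Y
      using that by (rule Q.smult_closed)
    show "\<xi> (rep Y) i \<in> carrier K" if "Y \<in> carrier ?Q" "i < n" for Y i
      using that rep co by (auto simp: car)
    show "\<xi> (rep (Y \<oplus>\<^bsub>?Q\<^esub> Z)) i = \<xi> (rep Y) i \<oplus>\<^bsub>K\<^esub> \<xi> (rep Z) i"
      if "Y \<in> carrier ?Q" "Z \<in> carrier ?Q" "i < n" for Y Z i
      using that rep add by (auto simp: car addq[symmetric])
    show "Y = \<zero>\<^bsub>?Q\<^esub>" if Y: "Y \<in> carrier ?Q" and 0: "\<And>i. i < n \<Longrightarrow> \<xi> (rep Y) i = \<zero>\<^bsub>K\<^esub>" for Y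
    proof -
      obtain x where x: "x \<in> carrier X" "Y = ?q x" using Y by (auto simp: car)
      then have "x \<in> U" using 0 rep ker by auto
      then show ?thesis using x S.a_rcos_const by (simp add: quot_module_def)
    qed
    show "\<xi> (rep (a \<odot>\<^bsub>?Q\<^esub> Y)) j = \<zero>\<^bsub>K\<^esub>"
      if a: "a \<in> carrier A" and Y: "Y \<in> carrier ?Q"
        and 0: "\<And>j. i \<le> j \<Longrightarrow> j < n \<Longrightarrow> \<xi> (rep Y) j = \<zero>\<^bsub>K\<^esub>" and j: "i \<le> j" "j < n" for a Y i j
    proof -
      obtain x where x: "x \<in> carrier X" "Y = ?q x" using Y by (auto simp: car)
      then have "\<xi> x j = \<zero>\<^bsub>K\<^esub>" if "i \<le> j" "j < n" for j using 0[OF that] rep that by simp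
      then have "\<xi> (a \<odot>\<^bsub>X\<^esub> x) j = \<zero>\<^bsub>K\<^esub>" by (rule triangular[OF a x(1) _ j])
      then show ?thesis using x a j rep by (simp add: smq[symmetric])
    qed
    show "\<exists>a\<in>carrier A. \<forall>Y\<in>carrier ?Q. \<forall>i<n. \<xi> (rep (a \<odot>\<^bsub>?Q\<^esub> Y)) i = c \<otimes>\<^bsub>K\<^esub> \<xi> (rep Y) i"
      if c: "c \<in> carrier K" for c
    proof -
      obtain a where a: "a \<in> carrier A"
        "\<forall>x\<in>carrier X. \<forall>i<n. \<xi> (a \<odot>\<^bsub>X\<^esub> x) i = c \<otimes>\<^bsub>K\<^esub> \<xi> x i"
        using scalar[OF c] by blast
      then show ?thesis
        by (intro bexI[of _ a]) (auto simp: car smq[symmetric] rep)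
    qed
    show "\<exists>Y\<in>carrier ?Q. \<xi> (rep Y) i \<noteq> \<zero>\<^bsub>K\<^esub> \<and> (\<forall>j. i < j \<and> j < n \<longrightarrow> \<xi> (rep Y) j = \<zero>\<^bsub>K\<^esub>)"
      if i: "i < n" for i
      using nonzero[OF i] i by (auto simp: car rep)
  qed
qed

section \<open>The radical\<close>

text \<open>
  Every left ideal that is not contained in \<open>J\<close> contains a unit.
\<close>

lemma (in short_local_ring) maximal_left_ideal_iff:
  assumes one: "\<one> \<notin> J"
  shows "maximal_left_ideal R I \<longleftrightarrow> I = J"
proof -
  interpret J: ideal J R by (rule J_ideal)
  interpret G: module R "regular_module R" by (rule module_regular_module)
  have JS: "submodule J R (regular_module R)"
  proof (rule G.submoduleI)
    fix a assume a: "a \<in> J"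
    have "\<ominus>\<^bsub>regular_module R\<^esub> a = \<ominus> a"
      using J.Icarr[OF a] by (intro G.minus_equality) (simp_all add: l_neg)
    then show "\<ominus>\<^bsub>regular_module R\<^esub> a \<in> J" using a by simp
  qed (auto simp: J.I_l_closed J.Icarr)
  have full: "L = carrier R" if L: "submodule L R (regular_module R)" and nJ: "\<not> L \<subseteq> J" for L
  proof -
    note LE = G.submoduleE[OF L]
    obtain a where a: "a \<in> L" "a \<notin> J" using nJ by blast
    then have "a \<in> Units R" using LE(1) unit_outside_J by auto
    then have aU: "inv a \<otimes> a = \<one>" "inv a \<in> carrier R" by auto
    have "\<one> \<in> L" using LE(4)[OF aU(2) a(1)] aU(1) by simp
    then have "x \<in> L" if "x \<in> carrier R" for x using LE(4)[of x \<one>] that by simp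
    then show ?thesis using LE(1) by auto
  qed
  have proper: "J \<noteq> carrier R" using one by blast
  show ?thesis
  proof
    assume I: "maximal_left_ideal R I"
    then have "I \<subseteq> J" using full unfolding maximal_left_ideal_def by blast
    then show "I = J" using I JS proper unfolding maximal_left_ideal_def by blast
  next
    assume "I = J"
    then show "maximal_left_ideal R I"
      using JS proper full unfolding maximal_left_ideal_def by blast
  qed
qed

lemma (in short_local_ring) radical_eq: "\<one> \<notin> J \<Longrightarrow> radical R = J"
proof -
  assume one: "\<one> \<notin> J"
  have "J \<subseteq> carrier R" using ideal.Icarr[OF J_ideal] by blast
  moreover have "{I. maximal_left_ideal R I} = {J}" using maximal_left_ideal_iff[OF one] by auto
  ultimately show "radical R = J" unfolding radical_def by auto
qed

section \<open>The algebra\<close>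

definition single :: "('k, 'e) ring_scheme \<Rightarrow> nat \<Rightarrow> 'k \<Rightarrow> nat \<Rightarrow> 'k" where
  "single K i c = (\<lambda>j. if j = i then c else \<zero>\<^bsub>K\<^esub>)"

text \<open>
  The coordinates 0, 1, 2 belong to \<open>1\<close>, \<open>u\<^sub>1\<close>, \<open>u\<^sub>2\<close>, the coordinates 3 to 6 to \<open>y\<^sub>1, \<dots>, y\<^sub>4\<close>, and 7, 8
  to \<open>w\<^sub>1\<close>, \<open>w\<^sub>2\<close>.
\<close>

definition example_mult :: "('k, 'e) ring_scheme \<Rightarrow> (nat \<Rightarrow> 'k) \<Rightarrow> (nat \<Rightarrow> 'k) \<Rightarrow> nat \<Rightarrow> 'k" where
  "example_mult K a b = (\<lambda>i.
    if i = 0 then a 0 \<otimes>\<^bsub>K\<^esub> b 0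
    else if i \<le> 6 then a 0 \<otimes>\<^bsub>K\<^esub> b i \<oplus>\<^bsub>K\<^esub> a i \<otimes>\<^bsub>K\<^esub> b 0
    else if i = 7 then (a 0 \<otimes>\<^bsub>K\<^esub> b 7 \<oplus>\<^bsub>K\<^esub> a 7 \<otimes>\<^bsub>K\<^esub> b 0) \<oplus>\<^bsub>K\<^esub>
      ((a 1 \<otimes>\<^bsub>K\<^esub> b 3 \<oplus>\<^bsub>K\<^esub> a 3 \<otimes>\<^bsub>K\<^esub> b 1) \<oplus>\<^bsub>K\<^esub> (a 2 \<otimes>\<^bsub>K\<^esub> b 5 \<oplus>\<^bsub>K\<^esub> a 5 \<otimes>\<^bsub>K\<^esub> b 2))
    else if i = 8 then (a 0 \<otimes>\<^bsub>K\<^esub> b 8 \<oplus>\<^bsub>K\<^esub> a 8 \<otimes>\<^bsub>K\<^esub> b 0) \<oplus>\<^bsub>K\<^esub>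
      ((a 1 \<otimes>\<^bsub>K\<^esub> b 4 \<oplus>\<^bsub>K\<^esub> a 4 \<otimes>\<^bsub>K\<^esub> b 1) \<oplus>\<^bsub>K\<^esub> (a 2 \<otimes>\<^bsub>K\<^esub> b 6 \<oplus>\<^bsub>K\<^esub> a 6 \<otimes>\<^bsub>K\<^esub> b 2))
    else \<zero>\<^bsub>K\<^esub>)"

definition example_algebra :: "('k, 'e) ring_scheme \<Rightarrow> ('k, nat \<Rightarrow> 'k) module" where
  "example_algebra K =
    (free_module K 9)\<lparr>mult := example_mult K, one := single K 0 \<one>\<^bsub>K\<^esub>\<rparr>"

lemma example_algebra_simps [simp]:
  "carrier (example_algebra K) = {x. (\<forall>i. x i \<in> carrier K) \<and> (\<forall>i\<ge>9. x i = \<zero>\<^bsub>K\<^esub>)}"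
  "zero (example_algebra K) = (\<lambda>i. \<zero>\<^bsub>K\<^esub>)"
  "add (example_algebra K) = (\<lambda>x y i. x i \<oplus>\<^bsub>K\<^esub> y i)"
  "smult (example_algebra K) = (\<lambda>a x i. a \<otimes>\<^bsub>K\<^esub> x i)"
  "mult (example_algebra K) = example_mult K"
  "one (example_algebra K) = single K 0 \<one>\<^bsub>K\<^esub>"
  by (simp_all add: example_algebra_def)

lemma single_same [simp]: "single K i c i = c"
  by (simp add: single_def)

lemma nat_cases_9:
  fixes i :: nat
  obtains "i = 0" | "i = 1" | "i = 2" | "i = 3" | "i = 4" | "i = 5" | "i = 6" | "i = 7" | "i = 8"
    | "9 \<le> i"
  by linarith

locale example = field K for K :: "('k, 'e) ring_scheme" (structure)
begin

abbreviation A :: "('k, nat \<Rightarrow> 'k) module" where "A \<equiv> example_algebra K"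

text \<open>
  The radical and its square.
\<close>

definition J :: "(nat \<Rightarrow> 'k) set" where "J = {a \<in> carrier A. a 0 = \<zero>}"

definition W :: "(nat \<Rightarrow> 'k) set" where "W = {a \<in> carrier A. \<forall>i<7. a i = \<zero>}"

lemma example_mult_eqs:
  "example_mult K a b 0 = a 0 \<otimes> b 0"
  "example_mult K a b 1 = a 0 \<otimes> b 1 \<oplus> a 1 \<otimes> b 0"
  "example_mult K a b (Suc 0) = a 0 \<otimes> b 1 \<oplus> a 1 \<otimes> b 0"
  "example_mult K a b 2 = a 0 \<otimes> b 2 \<oplus> a 2 \<otimes> b 0"
  "example_mult K a b 3 = a 0 \<otimes> b 3 \<oplus> a 3 \<otimes> b 0"
  "example_mult K a b 4 = a 0 \<otimes> b 4 \<oplus> a 4 \<otimes> b 0"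
  "example_mult K a b 5 = a 0 \<otimes> b 5 \<oplus> a 5 \<otimes> b 0"
  "example_mult K a b 6 = a 0 \<otimes> b 6 \<oplus> a 6 \<otimes> b 0"
  "example_mult K a b 7 = (a 0 \<otimes> b 7 \<oplus> a 7 \<otimes> b 0) \<oplus>
      ((a 1 \<otimes> b 3 \<oplus> a 3 \<otimes> b 1) \<oplus> (a 2 \<otimes> b 5 \<oplus> a 5 \<otimes> b 2))"
  "example_mult K a b 8 = (a 0 \<otimes> b 8 \<oplus> a 8 \<otimes> b 0) \<oplus>
      ((a 1 \<otimes> b 4 \<oplus> a 4 \<otimes> b 1) \<oplus> (a 2 \<otimes> b 6 \<oplus> a 6 \<otimes> b 2))"
  "9 \<le> i \<Longrightarrow> example_mult K a b i = \<zero>"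
  by (simp_all add: example_mult_def)

lemma example_eqI:
  assumes "x \<in> carrier A" "y \<in> carrier A" "x 0 = y 0" "x 1 = y 1" "x 2 = y 2" "x 3 = y 3"
    "x 4 = y 4" "x 5 = y 5" "x 6 = y 6" "x 7 = y 7" "x 8 = y 8"
  shows "x = y"
proof
  fix i show "x i = y i" by (rule nat_cases_9[of i]) (use assms in simp_all)
qed

lemma example_mult_closed [simp]:
  assumes "a \<in> carrier A" "b \<in> carrier A" shows "example_mult K a b \<in> carrier A"
proof -
  have "a i \<in> carrier K" "b i \<in> carrier K" for i using assms by auto
  then show ?thesis by (auto simp: example_mult_def)
qed

lemma single_closed [simp]: "c \<in> carrier K \<Longrightarrow> i < 9 \<Longrightarrow> single K i c \<in> carrier A"
  by (auto simp: single_def)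

lemma module_example: "module K A"
  by (rule module_surjective_image[OF module_free_module, of "\<lambda>x. x" 9]) auto

lemma cring_example: "cring A"
proof (rule cringI)
  interpret A: module K A by (rule module_example)
  show "abelian_group A" by (rule A.abelian_group_axioms)
  have co: "a i \<in> carrier K" if "a \<in> carrier A" for a i using that by simp
  show "comm_monoid A"
  proof (rule comm_monoidI)
    fix x y z assume x: "x \<in> carrier A" and y: "y \<in> carrier A" and z: "z \<in> carrier A"
    note c = co[OF x] co[OF y] co[OF z]
    show "x \<otimes>\<^bsub>A\<^esub> y \<otimes>\<^bsub>A\<^esub> z = x \<otimes>\<^bsub>A\<^esub> (y \<otimes>\<^bsub>A\<^esub> z)"
      unfolding example_algebra_simps(5)
      by (intro example_eqI example_mult_closed x y z; simp only: example_mult_eqs)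
        (simp_all add: c l_distr r_distr a_ac m_ac)
  next
    fix x y assume x: "x \<in> carrier A" and y: "y \<in> carrier A"
    note c = co[OF x] co[OF y]
    show "x \<otimes>\<^bsub>A\<^esub> y = y \<otimes>\<^bsub>A\<^esub> x"
      unfolding example_algebra_simps(5)
      by (intro example_eqI example_mult_closed x y; simp only: example_mult_eqs)
        (simp_all add: c a_ac m_ac)
    show "x \<otimes>\<^bsub>A\<^esub> y \<in> carrier A"
      unfolding example_algebra_simps(5) by (rule example_mult_closed[OF x y])
  next
    fix x assume x: "x \<in> carrier A"
    have o: "single K 0 \<one> \<in> carrier A" by (rule single_closed) simp_all
    show "\<one>\<^bsub>A\<^esub> \<otimes>\<^bsub>A\<^esub> x = x"
      unfolding example_algebra_simps(5,6)
      by (intro example_eqI example_mult_closed o x; simp only: example_mult_eqs)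
        (simp_all add: co[OF x] single_def)
  qed (simp add: single_def)
  fix x y z assume x: "x \<in> carrier A" and y: "y \<in> carrier A" and z: "z \<in> carrier A"
  note c = co[OF x] co[OF y] co[OF z]
  have xy: "(\<lambda>i. x i \<oplus> y i) \<in> carrier A" using x y by auto
  have s: "(\<lambda>i. example_mult K x z i \<oplus> example_mult K y z i) \<in> carrier A"
    using A.a_closed[OF example_mult_closed[OF x z] example_mult_closed[OF y z]] by simp
  show "(x \<oplus>\<^bsub>A\<^esub> y) \<otimes>\<^bsub>A\<^esub> z = x \<otimes>\<^bsub>A\<^esub> z \<oplus>\<^bsub>A\<^esub> y \<otimes>\<^bsub>A\<^esub> z"
    unfolding example_algebra_simps(3,5)
    by (intro example_eqI example_mult_closed xy s z; simp only: example_mult_eqs)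
      (simp_all add: c l_distr r_distr a_ac m_ac)
qed

sublocale A: cring A by (rule cring_example)

lemma ideal_J: "ideal J A"
proof (rule idealI[OF A.ring_axioms])
  have mi: "\<ominus>\<^bsub>A\<^esub> a = (\<lambda>i. \<ominus> a i)" if "a \<in> carrier A" for a
    using that by (intro A.minus_equality) (auto simp: l_neg)
  show "subgroup J (add_monoid A)"
    by (rule A.add.subgroupI) (auto simp: J_def mi intro!: exI[of _ "\<lambda>_. \<zero>"])
qed (auto simp: J_def example_mult_eqs simp del: example_algebra_simps(1),
    auto)

lemma JJ_W: "x \<in> J \<Longrightarrow> y \<in> J \<Longrightarrow> x \<otimes>\<^bsub>A\<^esub> y \<in> W"
proof -
  assume x: "x \<in> J" and y: "y \<in> J"
  have "example_mult K x y i = \<zero>" if "i < 7" for i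
    by (rule nat_cases_9[of i]) (use that x y in \<open>auto simp: example_mult_eqs J_def\<close>)
  then show ?thesis
    using x y example_mult_closed[of x y] by (simp add: W_def J_def del: example_algebra_simps(1))
qed

lemma WJ_0: "x \<in> W \<Longrightarrow> y \<in> J \<Longrightarrow> x \<otimes>\<^bsub>A\<^esub> y = \<zero>\<^bsub>A\<^esub>"
proof -
  assume x: "x \<in> W" and y: "y \<in> J"
  have "example_mult K x y i = \<zero>" for i
    by (rule nat_cases_9[of i]) (use x y in \<open>auto simp: example_mult_eqs J_def W_def\<close>)
  then show ?thesis by auto
qed

lemma W_subset_J: "W \<subseteq> J"
  by (auto simp: W_def J_def)


lemma single_mult:
  assumes c: "c \<in> carrier K" and a: "a \<in> carrier A"
  shows "example_mult K (single K 0 c) a = (\<lambda>i. c \<otimes> a i)"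
proof -
  have "a i \<in> carrier K" for i using a by auto
  moreover have "(\<lambda>i. c \<otimes> a i) \<in> carrier A" using c a by auto
  moreover have "single K 0 c \<in> carrier A" using c by (intro single_closed) auto
  ultimately show ?thesis
    using c a by (intro example_eqI example_mult_closed; (simp only: example_mult_eqs)?)
      (simp_all add: single_def)
qed

lemma J_cube: "x \<in> J \<Longrightarrow> y \<in> J \<Longrightarrow> z \<in> J \<Longrightarrow> x \<otimes>\<^bsub>A\<^esub> y \<otimes>\<^bsub>A\<^esub> z = \<zero>\<^bsub>A\<^esub>"
  using JJ_W WJ_0 by blast

text \<open>
  After division by the constant coordinate, an element outside \<open>J\<close> is \<open>1 + n\<close> with \<open>n\<^sup>3 = 0\<close>, and its inverse
  is \<open>1 - n + n\<^sup>2\<close>.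
\<close>

lemma unit_outside: "x \<in> carrier A \<Longrightarrow> x \<notin> J \<Longrightarrow> x \<in> Units A"
proof -
  assume x: "x \<in> carrier A" and "x \<notin> J"
  then have x0: "x 0 \<in> Units K" using field_Units by (auto simp: J_def)
  let ?c = "single K 0 (inv (x 0))"
  have cA: "?c \<in> carrier A" using x0 by (intro single_closed) auto
  define u where "u = ?c \<otimes>\<^bsub>A\<^esub> x"
  have uA: "u \<in> carrier A" unfolding u_def by (rule A.m_closed[OF cA x])
  have u0: "u 0 = \<one>" using x0 by (simp add: u_def example_mult_eqs)
  define n where "n = u \<ominus>\<^bsub>A\<^esub> \<one>\<^bsub>A\<^esub>"
  have nA: "n \<in> carrier A" unfolding n_def by (rule A.minus_closed[OF uA A.one_closed])
  have un: "u = \<one>\<^bsub>A\<^esub> \<oplus>\<^bsub>A\<^esub> n"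
    unfolding n_def using uA A.one_closed by algebra
  have "\<one> = \<one> \<oplus> n 0" using fun_cong[OF un, of 0] u0 by simp
  moreover have "n 0 \<in> carrier K" using nA by simp
  ultimately have "n 0 = \<zero>" using add.l_cancel_one' by (metis one_closed)
  then have nJ: "n \<in> J" using nA by (simp add: J_def)
  let ?v = "\<one>\<^bsub>A\<^esub> \<ominus>\<^bsub>A\<^esub> n \<oplus>\<^bsub>A\<^esub> n \<otimes>\<^bsub>A\<^esub> n"
  have vA: "?v \<in> carrier A" using nA A.one_closed by (intro A.a_closed A.minus_closed A.m_closed)
  have "u \<otimes>\<^bsub>A\<^esub> ?v = \<one>\<^bsub>A\<^esub> \<oplus>\<^bsub>A\<^esub> n \<otimes>\<^bsub>A\<^esub> n \<otimes>\<^bsub>A\<^esub> n"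
    unfolding un using nA A.one_closed by algebra
  also have "\<dots> = \<one>\<^bsub>A\<^esub>" unfolding J_cube[OF nJ nJ nJ] by (rule A.r_zero[OF A.one_closed])
  finally have "?c \<otimes>\<^bsub>A\<^esub> x \<otimes>\<^bsub>A\<^esub> ?v = \<one>\<^bsub>A\<^esub>" unfolding u_def .
  then have "x \<otimes>\<^bsub>A\<^esub> (?c \<otimes>\<^bsub>A\<^esub> ?v) = \<one>\<^bsub>A\<^esub>"
    using A.m_assoc[OF x cA vA] A.m_comm[OF x cA] by metis
  moreover have cv: "?c \<otimes>\<^bsub>A\<^esub> ?v \<in> carrier A" by (rule A.m_closed[OF cA vA])
  ultimately have "?c \<otimes>\<^bsub>A\<^esub> ?v \<otimes>\<^bsub>A\<^esub> x = \<one>\<^bsub>A\<^esub>" using A.m_comm[OF x cv] by simp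
  then show "x \<in> Units A"
    unfolding Units_def using A.m_comm[OF x cv] by (intro CollectI conjI x bexI[OF _ cv]) simp_all
qed

sublocale A: short_local_ring A J
  by (intro short_local_ring.intro cring_example short_local_ring_axioms.intro ideal_J J_cube unit_outside)

lemma radical_example: "radical A = J"
  by (rule A.radical_eq) (simp add: J_def)

lemma finitely_generated_example: "finitely_generated K A"
  unfolding finitely_generated_def
proof (intro exI[of _ "unit_vector K ` {..<9}"] conjI allI impI)
  show "unit_vector K ` {..<9} \<subseteq> carrier A" by (auto simp: unit_vector_def)
  fix U assume U: "submodule U K A \<and> unit_vector K ` {..<9} \<subseteq> U"
  interpret F: module K "free_module K 9" by (rule module_free_module)
  have "add_monoid A = add_monoid (free_module K 9)" by (simp add: example_algebra_def)
  then have V: "submodule U K (free_module K 9)"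
    using U by (simp add: submodule_def submodule_axioms_def)
  have id: "(\<lambda>x\<in>carrier (free_module K 9). x) \<in> mhom K (free_module K 9) (free_module K 9)"
    by (rule mhom_restrictI[OF F.module_axioms]) auto
  have "x \<in> U" if "x \<in> carrier (free_module K 9)" for x
  proof -
    have "(\<lambda>x\<in>carrier (free_module K 9). x) x \<in> U"
    proof (rule mhom_free_in_submodule[OF F.module_axioms id that V])
      fix i :: nat assume i: "i < 9"
      have "unit_vector K i \<in> U" "x i \<in> carrier K" using U i that by auto
      then have "x i \<odot>\<^bsub>free_module K 9\<^esub> unit_vector K i \<in> U"
        by (intro F.submoduleE(4)[OF V])
      then show "x i \<odot>\<^bsub>free_module K 9\<^esub>
          (\<lambda>x\<in>carrier (free_module K 9). x) (unit_vector K i) \<in> U"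
        using unit_vector_closed[OF i] by (simp del: free_module_simps)
    qed
    then show ?thesis using that by (simp del: free_module_simps)
  qed
  then show "U = carrier A" using F.submoduleE(1)[OF V] by (auto simp: example_algebra_def)
qed simp

lemma local_algebra_example: "local_algebra K A"
proof (intro local_algebra.intro local_algebra_axioms.intro)
  show "field K" by (rule field_axioms)
  show "module K A" by (rule module_example)
  show "ring A" by (rule A.ring_axioms)
  show "finitely_generated K A" by (rule finitely_generated_example)
  have one: "\<one>\<^bsub>A\<^esub> \<notin> J" by (simp add: J_def)
  show "\<exists>!I. maximal_left_ideal A I" using A.maximal_left_ideal_iff[OF one] by blast
  fix c a b assume c: "c \<in> carrier K" and a: "a \<in> carrier A" and b: "b \<in> carrier A"
  have sA: "single K 0 c \<in> carrier A" using c by (intro single_closed) auto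
  have sm: "c \<odot>\<^bsub>A\<^esub> x = single K 0 c \<otimes>\<^bsub>A\<^esub> x" if "x \<in> carrier A" for x
    using single_mult[OF c that] by simp
  note ab = A.m_closed[OF a b]
  show "c \<odot>\<^bsub>A\<^esub> a \<otimes>\<^bsub>A\<^esub> b = c \<odot>\<^bsub>A\<^esub> (a \<otimes>\<^bsub>A\<^esub> b)"
    unfolding sm[OF a] sm[OF ab] by (rule A.m_assoc[OF sA a b])
  show "a \<otimes>\<^bsub>A\<^esub> (c \<odot>\<^bsub>A\<^esub> b) = c \<odot>\<^bsub>A\<^esub> (a \<otimes>\<^bsub>A\<^esub> b)"
    unfolding sm[OF b] sm[OF ab] by (rule A.m_lcomm[OF a sA b])
next
  interpret J: ideal J A by (rule ideal_J)
  have si: "c \<odot>\<^bsub>A\<^esub> \<one>\<^bsub>A\<^esub> = single K 0 c" if "c \<in> carrier K" for c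
    using that by (auto simp: single_def)
  have sA: "single K 0 c \<in> carrier A" if "c \<in> carrier K" for c
    using that by (intro single_closed) auto
  let ?\<iota> = "\<lambda>c. c \<odot>\<^bsub>A\<^esub> \<one>\<^bsub>A\<^esub>"
  have hom1: "?\<iota> \<in> ring_hom K A"
  proof (rule ring_hom_memI)
    fix c d assume c: "c \<in> carrier K" and d: "d \<in> carrier K"
    show "?\<iota> c \<in> carrier A" unfolding si[OF c] by (rule sA[OF c])
    show "?\<iota> (c \<otimes> d) = ?\<iota> c \<otimes>\<^bsub>A\<^esub> ?\<iota> d"
      unfolding si[OF c] si[OF d] si[OF m_closed[OF c d]] example_algebra_simps(5)
        single_mult[OF c sA[OF d]] using c by (auto simp: single_def)
    show "?\<iota> (c \<oplus> d) = ?\<iota> c \<oplus>\<^bsub>A\<^esub> ?\<iota> d"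
      using c d by (auto simp: single_def)
  qed (auto simp: single_def)
  have hom: "(\<lambda>c. J +>\<^bsub>A\<^esub> ?\<iota> c) \<in> ring_hom K (A Quot J)"
    using ring_hom_trans[OF hom1 J.rcos_ring_hom] by (simp add: comp_def)
  have coset_eq: "J +>\<^bsub>A\<^esub> x = J +>\<^bsub>A\<^esub> y \<longleftrightarrow> x 0 = y 0" if x: "x \<in> carrier A" and y: "y \<in> carrier A" for x y
  proof -
    have "J +>\<^bsub>A\<^esub> x = J +>\<^bsub>A\<^esub> y \<longleftrightarrow> x \<ominus>\<^bsub>A\<^esub> y \<in> J"
      using A.quotient_eq_iff_same_a_r_cos[OF ideal_J x y] by simp
    also have "\<dots> \<longleftrightarrow> x 0 = y 0"
    proof -
      have "\<ominus>\<^bsub>A\<^esub> y = (\<lambda>i. \<ominus> y i)" using y by (intro A.minus_equality) (auto simp: l_neg)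
      then have "(x \<ominus>\<^bsub>A\<^esub> y) 0 = x 0 \<ominus> y 0" by (simp add: a_minus_def)
      moreover have "x 0 \<in> carrier K" "y 0 \<in> carrier K" using x y by auto
      moreover have "x \<ominus>\<^bsub>A\<^esub> y \<in> J \<longleftrightarrow> (x \<ominus>\<^bsub>A\<^esub> y) 0 = \<zero>"
        unfolding J_def using A.minus_closed[OF x y] by blast
      moreover have "x 0 \<ominus> y 0 = \<zero> \<longleftrightarrow> x 0 = y 0"
      proof
        assume "x 0 \<ominus> y 0 = \<zero>"
        moreover have "x 0 = (x 0 \<ominus> y 0) \<oplus> y 0"
          using \<open>x 0 \<in> carrier K\<close> \<open>y 0 \<in> carrier K\<close> by algebra
        ultimately show "x 0 = y 0" using \<open>y 0 \<in> carrier K\<close> by simp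
      next
        assume "x 0 = y 0"
        then show "x 0 \<ominus> y 0 = \<zero>" using \<open>y 0 \<in> carrier K\<close> by (simp add: a_minus_def r_neg)
      qed
      ultimately show ?thesis by simp
    qed
    finally show ?thesis .
  qed
  have "bij_betw (\<lambda>c. J +>\<^bsub>A\<^esub> ?\<iota> c) (carrier K) (carrier (A Quot J))"
  proof (rule bij_betwI')
    fix c d assume c: "c \<in> carrier K" and d: "d \<in> carrier K"
    show "J +>\<^bsub>A\<^esub> ?\<iota> c = J +>\<^bsub>A\<^esub> ?\<iota> d \<longleftrightarrow> c = d"
      unfolding si[OF c] si[OF d] coset_eq[OF sA[OF c] sA[OF d]] by simp
    show "J +>\<^bsub>A\<^esub> ?\<iota> c \<in> carrier (A Quot J)" using hom c by (auto simp: ring_hom_def)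
  next
    fix Y assume "Y \<in> carrier (A Quot J)"
    then obtain x where x: "x \<in> carrier A" "Y = J +>\<^bsub>A\<^esub> x"
      by (auto simp: FactRing_def A_RCOSETS_def' simp del: example_algebra_simps)
    have x0: "x 0 \<in> carrier K" using x by simp
    have "Y = J +>\<^bsub>A\<^esub> ?\<iota> (x 0)"
      unfolding x(2) si[OF x0] coset_eq[OF x(1) sA[OF x0]] by simp
    then show "\<exists>c\<in>carrier K. Y = J +>\<^bsub>A\<^esub> ?\<iota> c" using x0 by blast
  qed
  then show "(\<lambda>c. radical A +>\<^bsub>A\<^esub> ?\<iota> c) \<in> ring_iso K (A Quot radical A)"
    unfolding radical_example ring_iso_def using hom by simp
qed

text \<open>
  The inclusion of \<open>W\<close> in the square of \<open>J\<close> comes from \<open>w\<^sub>1 = u\<^sub>1 y\<^sub>1\<close> and \<open>w\<^sub>2 = u\<^sub>1 y\<^sub>2\<close>.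
\<close>

lemma ideal_prod_J_J: "ideal_prod A J J = W"
proof (intro equalityI subsetI)
  fix x assume "x \<in> ideal_prod A J J"
  then show "x \<in> W"
  proof induction
    case (prod i j)
    then show ?case by (rule JJ_W)
  next
    case (sum x y)
    then show ?case by (auto simp: W_def)
  qed
next
  fix w assume w: "w \<in> W"
  then have wA: "w \<in> carrier A" and w0: "\<And>i. i < 7 \<Longrightarrow> w i = \<zero>" and wi: "\<And>i. w i \<in> carrier K"
    by (auto simp: W_def)
  let ?u = "single K 1" and ?y = "single K 3 \<one>" and ?z = "single K 4 \<one>"
  have m: "?u (w 7) \<in> J" "?u (w 8) \<in> J" "?y \<in> J" "?z \<in> J"
    using single_closed wi by (auto simp: J_def single_def)
  note mA = m[THEN ideal.Icarr[OF ideal_J]]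
  have "w = ?u (w 7) \<otimes>\<^bsub>A\<^esub> ?y \<oplus>\<^bsub>A\<^esub> ?u (w 8) \<otimes>\<^bsub>A\<^esub> ?z"
  proof (rule example_eqI[OF wA A.a_closed[OF A.m_closed[OF mA(1,3)] A.m_closed[OF mA(2,4)]]])
  qed (simp_all add: example_mult_eqs w0 wi single_def)
  then show "w \<in> ideal_prod A J J"
    using ideal_prod.sum[OF ideal_prod.prod[OF m(1,3)] ideal_prod.prod[OF m(2,4)], of A] by simp
qed

lemma ideal_prod_W_J: "ideal_prod A W J = {\<zero>\<^bsub>A\<^esub>}"
proof (intro equalityI subsetI)
  fix x assume "x \<in> ideal_prod A W J"
  then show "x \<in> {\<zero>\<^bsub>A\<^esub>}"
  proof induction
    case (prod i j)
    then show ?case using WJ_0 by blast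
  next
    case (sum x y)
    then show ?case by auto
  qed
next
  fix x assume "x \<in> {\<zero>\<^bsub>A\<^esub>}"
  moreover have z: "\<zero>\<^bsub>A\<^esub> \<in> W" "\<zero>\<^bsub>A\<^esub> \<in> J" by (auto simp: W_def J_def)
  have "\<zero>\<^bsub>A\<^esub> \<otimes>\<^bsub>A\<^esub> \<zero>\<^bsub>A\<^esub> \<in> ideal_prod A W J" by (rule ideal_prod.prod[OF z])
  ultimately show "x \<in> ideal_prod A W J" using WJ_0[OF z] by simp
qed

lemma short_example: "short A"
  unfolding short_def radical_example ideal_prod_J_J ideal_prod_W_J by simp

end

context example
begin

section \<open>Lengths over the algebra\<close>

lemma scalar_action:
  assumes "c \<in> carrier K" "x \<in> carrier A"
  shows "(single K 0 c \<otimes>\<^bsub>A\<^esub> x) i = c \<otimes> x i"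
  using single_mult[OF assms] by simp

text \<open>
  A coordinate of \<open>a y\<close> only depends on the coordinates of \<open>y\<close> up to the same position, because the
  basis is ordered by degree. So \<open>A\<close> acts by triangular matrices.
\<close>

lemma example_mult_vanishes:
  assumes a: "a \<in> carrier A" and y: "y \<in> carrier A" and c: "c < 9" and 0: "\<And>i. i \<le> c \<Longrightarrow> y i = \<zero>"
  shows "(a \<otimes>\<^bsub>A\<^esub> y) c = \<zero>"
proof -
  have "a i \<in> carrier K" for i using a by auto
  then show ?thesis
    unfolding example_algebra_simps(5)
    by (rule_tac nat_cases_9[of c]) (use c 0 in \<open>auto simp: example_mult_eqs\<close>)
qed

text \<open>
  Position \<open>9 q + (8 - c)\<close> carries the coordinate \<open>c\<close> of the \<open>q\<close>-th entry of a vector over \<open>A\<close>.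
\<close>

lemma digits:
  assumes "c < 9"
  shows "(9 * q + (8 - c)) div 9 = q" and "8 - (9 * q + (8 - c)) mod 9 = (c :: nat)"
proof -
  define d where "d = 8 - c"
  have "d < 9" "8 - d = c" using assms by (auto simp: d_def)
  then show "(9 * q + (8 - c)) div 9 = q" "8 - (9 * q + (8 - c)) mod 9 = c"
    unfolding d_def[symmetric] by simp_all
qed

text \<open>
  The coordinates of each entry are taken in reverse order, since the vectors whose low coordinates vanish
  form a submodule.
\<close>

lemma has_length_free_module: "has_length A (free_module A n) (9 * n)"
proof -
  interpret F: module A "free_module A n" by (rule A.module_free_module)
  have xA: "x q \<in> carrier A" if "x \<in> carrier (free_module A n)" for x q
    using that unfolding free_module_simps by blast
  show ?thesis
  proof (rule has_length_by_coordinates[OF field_axioms F.abelian_group_axioms,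
        where \<xi> = "\<lambda>x k. x (k div 9) (8 - k mod 9)"])
    show "a \<odot>\<^bsub>free_module A n\<^esub> x \<in> carrier (free_module A n)"
      if "a \<in> carrier A" "x \<in> carrier (free_module A n)" for a x
      using that by (rule F.smult_closed)
    show "x (k div 9) (8 - k mod 9) \<in> carrier K" if "x \<in> carrier (free_module A n)" for x k
      using xA[OF that, of "k div 9"] by simp
    show "(x \<oplus>\<^bsub>free_module A n\<^esub> y) (k div 9) (8 - k mod 9) =
        x (k div 9) (8 - k mod 9) \<oplus> y (k div 9) (8 - k mod 9)" for x y k
      by simp
    show "x = \<zero>\<^bsub>free_module A n\<^esub>" if x: "x \<in> carrier (free_module A n)"
      and 0: "\<And>k. k < 9 * n \<Longrightarrow> x (k div 9) (8 - k mod 9) = \<zero>" for x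
    proof -
      have "x q c = \<zero>" for q c
      proof (cases "q < n \<and> c < 9")
        case True
        then have "9 * q + (8 - c) < 9 * n" by linarith
        then show ?thesis using 0[of "9 * q + (8 - c)"] digits[of c q] True by simp
      next
        case False
        then show ?thesis using x by auto
      qed
      then show ?thesis by auto
    qed
    show "(a \<odot>\<^bsub>free_module A n\<^esub> x) (k div 9) (8 - k mod 9) = \<zero>"
      if a: "a \<in> carrier A" and x: "x \<in> carrier (free_module A n)"
        and 0: "\<And>k. i \<le> k \<Longrightarrow> k < 9 * n \<Longrightarrow> x (k div 9) (8 - k mod 9) = \<zero>"
        and k: "i \<le> k" "k < 9 * n" for a x i k
    proof -
      have "x (k div 9) c = \<zero>" if c: "c \<le> 8 - k mod 9" for c
      proof -
        let ?k = "9 * (k div 9) + (8 - c)"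
        have "k mod 9 \<le> 8 - c" using c mod_less_divisor[of 9 k] by linarith
        then have "k \<le> ?k" using mult_div_mod_eq[of 9 k] by linarith
        moreover have "k div 9 < n" using k(2) by (simp add: less_mult_imp_div_less)
        then have "?k < 9 * n" by linarith
        moreover have "c < 9" using c by simp
        ultimately show ?thesis using 0[of ?k] k(1) digits[of c "k div 9"] by simp
      qed
      then have "(a \<otimes>\<^bsub>A\<^esub> x (k div 9)) (8 - k mod 9) = \<zero>"
        by (intro example_mult_vanishes[OF a xA[OF x]]) auto
      then show ?thesis by simp
    qed
    show "\<exists>a\<in>carrier A. \<forall>x\<in>carrier (free_module A n). \<forall>k<9 * n.
        (a \<odot>\<^bsub>free_module A n\<^esub> x) (k div 9) (8 - k mod 9) = c \<otimes> x (k div 9) (8 - k mod 9)"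
      if c: "c \<in> carrier K" for c
    proof (intro bexI[of _ "single K 0 c"] ballI allI impI)
      show "single K 0 c \<in> carrier A" using c by (intro single_closed) auto
      fix x k assume x: "x \<in> carrier (free_module A n)"
      show "(single K 0 c \<odot>\<^bsub>free_module A n\<^esub> x) (k div 9) (8 - k mod 9) = c \<otimes> x (k div 9) (8 - k mod 9)"
        using scalar_action[OF c xA[OF x, of "k div 9"]] by simp
    qed
    show "\<exists>x\<in>carrier (free_module A n). x (k div 9) (8 - k mod 9) \<noteq> \<zero> \<and>
        (\<forall>l. k < l \<and> l < 9 * n \<longrightarrow> x (l div 9) (8 - l mod 9) = \<zero>)" if k: "k < 9 * n" for k
    proof (intro bexI[of _ "single A (k div 9) (single K (8 - k mod 9) \<one>)"] conjI allI impI)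
      have "single K (8 - k mod 9) \<one> \<in> carrier A" by (intro single_closed) auto
      then show "single A (k div 9) (single K (8 - k mod 9) \<one>) \<in> carrier (free_module A n)"
        using k by (auto simp: single_def)
      show "single A (k div 9) (single K (8 - k mod 9) \<one>) (k div 9) (8 - k mod 9) \<noteq> \<zero>" by simp
      fix l assume l: "k < l \<and> l < 9 * n"
      have "\<not> (k div 9 = l div 9 \<and> 8 - k mod 9 = 8 - l mod 9)"
      proof
        assume "k div 9 = l div 9 \<and> 8 - k mod 9 = 8 - l mod 9"
        moreover from this have "k mod 9 = l mod 9"
          using mod_less_divisor[of 9 k] mod_less_divisor[of 9 l] by linarith
        ultimately have "k = l" using mult_div_mod_eq[of 9 k] mult_div_mod_eq[of 9 l] by metis
        then show False using l by simp
      qed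
      then show "single A (k div 9) (single K (8 - k mod 9) \<one>) (l div 9) (8 - l mod 9) = \<zero>"
        by (auto simp: single_def)
    qed
  qed
qed

lemma submodule_free_module_generated:
  assumes "submodule U A (free_module A n)"
  shows "\<exists>m f. f \<in> mhom A (free_module A m) (free_module A n) \<and> f ` carrier (free_module A m) = U"
  by (rule A.finite_length_submodule_generated[OF A.module_free_module has_length_free_module assms])

lemma module_regular_J: "module A ((regular_module A)\<lparr>carrier := J\<rparr>)"
  and submodule_W_J: "submodule W A ((regular_module A)\<lparr>carrier := J\<rparr>)"
  and module_regular_W: "module A ((regular_module A)\<lparr>carrier := W\<rparr>)"
proof -
  interpret G: module A "regular_module A" by (rule A.module_regular_module)
  have inv: "\<ominus>\<^bsub>regular_module A\<^esub> a = (\<lambda>i. \<ominus> a i)" if "a \<in> carrier A" for a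
    using that by (intro G.minus_equality) (auto simp: l_neg)
  have J: "submodule J A (regular_module A)"
    by (rule G.submoduleI)
      (auto simp: J_def inv example_mult_eqs example_mult_closed simp del: example_algebra_simps(1), auto)
  show JM: "module A ((regular_module A)\<lparr>carrier := J\<rparr>)"
    by (rule submodule.submodule_is_module[OF J G.module_axioms])
  interpret GJ: module A "(regular_module A)\<lparr>carrier := J\<rparr>" by (rule JM)
  have invJ: "\<ominus>\<^bsub>(regular_module A)\<lparr>carrier := J\<rparr>\<^esub> a = (\<lambda>i. \<ominus> a i)" if "a \<in> J" for a
    using that by (intro GJ.minus_equality) (auto simp: l_neg J_def)
  have aW: "a \<otimes>\<^bsub>A\<^esub> w \<in> W" if a: "a \<in> carrier A" and w: "w \<in> W" for a w
  proof -
    have wA: "w \<in> carrier A" and "\<And>i. i < 7 \<Longrightarrow> w i = \<zero>" using w by (auto simp: W_def)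
    then have "(a \<otimes>\<^bsub>A\<^esub> w) i = \<zero>" if "i < 7" for i
      using that by (intro example_mult_vanishes[OF a wA]) auto
    then show ?thesis unfolding W_def using A.m_closed[OF a wA] by blast
  qed
  show WJ: "submodule W A ((regular_module A)\<lparr>carrier := J\<rparr>)"
  proof (rule GJ.submoduleI)
    show "a \<odot>\<^bsub>(regular_module A)\<lparr>carrier := J\<rparr>\<^esub> x \<in> W" if "a \<in> carrier A" "x \<in> W" for a x
      using aW[OF that] by simp
    show "\<ominus>\<^bsub>(regular_module A)\<lparr>carrier := J\<rparr>\<^esub> a \<in> W" if "a \<in> W" for a
      using that invJ W_subset_J by (auto simp: W_def)
  qed (use W_subset_J in \<open>auto simp: W_def\<close>)
  show "module A ((regular_module A)\<lparr>carrier := W\<rparr>)"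
    using submodule.submodule_is_module[OF WJ JM] by simp
qed

lemma hilbert_type_example: "has_hilbert_type A 6 2"
proof -
  let ?J = "(regular_module A)\<lparr>carrier := J\<rparr>"
  let ?W = "(regular_module A)\<lparr>carrier := W\<rparr>"
  have JA: "x \<in> carrier A" if "x \<in> J" for x using that by (simp add: J_def)
  have WA: "x \<in> carrier A" if "x \<in> W" for x using that by (simp add: W_def)
  have "has_length A (quot_module ?J W) 6"
  proof (rule has_length_quotient_by_coordinates[OF field_axioms module_regular_J submodule_W_J,
        where \<xi> = "\<lambda>x i. x (Suc i)"])
    show "x \<in> W \<longleftrightarrow> (\<forall>i<6. x (Suc i) = \<zero>)" if "x \<in> carrier ?J" for x
    proof -
      have x: "x \<in> carrier A" "x 0 = \<zero>" using that by (auto simp: J_def)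
      have "(\<forall>i<7. x i = \<zero>) \<longleftrightarrow> (\<forall>i<6. x (Suc i) = \<zero>)"
        using x(2) by (metis (no_types, lifting) Suc_less_eq eval_nat_numeral(3) not0_implies_Suc
            semiring_norm(26) semiring_norm(27))
      then show ?thesis using x(1) unfolding W_def by blast
    qed
    show "(a \<odot>\<^bsub>?J\<^esub> x) (Suc j) = \<zero>"
      if a: "a \<in> carrier A" and x: "x \<in> carrier ?J"
        and 0: "\<And>j. i \<le> j \<Longrightarrow> j < 6 \<Longrightarrow> x (Suc j) = \<zero>" and j: "i \<le> j" "j < 6" for a x i j
      using 0[OF j] j x a by (simp add: example_mult_def J_def)
    show "\<exists>a\<in>carrier A. \<forall>x\<in>carrier ?J. \<forall>i<6. (a \<odot>\<^bsub>?J\<^esub> x) (Suc i) = c \<otimes> x (Suc i)"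
      if c: "c \<in> carrier K" for c
      using scalar_action[OF c JA] single_closed[OF c, of 0] by (intro bexI[of _ "single K 0 c"]) simp_all
    show "\<exists>x\<in>carrier ?J. x (Suc i) \<noteq> \<zero> \<and> (\<forall>j. i < j \<and> j < 6 \<longrightarrow> x (Suc j) = \<zero>)"
      if i: "i < 6" for i
      using i by (intro bexI[of _ "single K (Suc i) \<one>"]) (auto simp: J_def single_def)
  qed (auto simp: J_def)
  moreover have "has_length A ?W 2"
  proof (rule has_length_by_coordinates[OF field_axioms module.axioms(2)[OF module_regular_W],
        where \<xi> = "\<lambda>x i. x (i + 7)"])
    interpret W: module A ?W by (rule module_regular_W)
    show "a \<odot>\<^bsub>?W\<^esub> x \<in> carrier ?W" if "a \<in> carrier A" "x \<in> carrier ?W" for a x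
      using that by (rule W.smult_closed)
    show "x = \<zero>\<^bsub>?W\<^esub>" if x: "x \<in> carrier ?W" and 0: "\<And>i. i < 2 \<Longrightarrow> x (i + 7) = \<zero>" for x
    proof -
      have "x i = \<zero>" for i
        by (rule nat_cases_9[of i]) (use x 0[of 0] 0[of 1] in \<open>auto simp: W_def\<close>)
      then show ?thesis by auto
    qed
    show "(a \<odot>\<^bsub>?W\<^esub> x) (j + 7) = \<zero>"
      if a: "a \<in> carrier A" and x: "x \<in> carrier ?W"
        and 0: "\<And>j. i \<le> j \<Longrightarrow> j < 2 \<Longrightarrow> x (j + 7) = \<zero>" and j: "i \<le> j" "j < 2" for a x i j
    proof -
      have "j = 0 \<or> j = 1" using j by auto
      then show ?thesis using 0[OF j] x a by (auto simp: example_mult_eqs W_def)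
    qed
    show "\<exists>a\<in>carrier A. \<forall>x\<in>carrier ?W. \<forall>i<2. (a \<odot>\<^bsub>?W\<^esub> x) (i + 7) = c \<otimes> x (i + 7)"
      if c: "c \<in> carrier K" for c
      using scalar_action[OF c WA] single_closed[OF c, of 0] by (intro bexI[of _ "single K 0 c"]) simp_all
    show "\<exists>x\<in>carrier ?W. x (i + 7) \<noteq> \<zero> \<and> (\<forall>j. i < j \<and> j < 2 \<longrightarrow> x (j + 7) = \<zero>)"
      if i: "i < 2" for i
      using i by (intro bexI[of _ "single K (i + 7) \<one>"]) (auto simp: W_def single_def)
  qed (auto simp: W_def)
  ultimately show ?thesis
    unfolding has_hilbert_type_def Let_def radical_example ideal_prod_J_J by blast
qed

section \<open>The module\<close>

text \<open>
  The vector \<open>(u\<^sub>1, u\<^sub>2)\<close> and the ideal with the basis \<open>u\<^sub>1, u\<^sub>2, w\<^sub>1, w\<^sub>2\<close>.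
\<close>

definition gens :: "nat \<Rightarrow> nat \<Rightarrow> 'k" where
  "gens = (\<lambda>i. if i < 2 then single K (Suc i) \<one> else (\<lambda>_. \<zero>))"

definition I :: "(nat \<Rightarrow> 'k) set" where
  "I = {a \<in> carrier A. a 0 = \<zero> \<and> a 3 = \<zero> \<and> a 4 = \<zero> \<and> a 5 = \<zero> \<and> a 6 = \<zero>}"

lemma gens_closed: "gens \<in> carrier (free_module A 2)"
  by (auto simp: gens_def single_def)

lemma gens_eqs: "gens 0 = single K 1 \<one>" "gens 1 = single K 2 \<one>" "gens (Suc 0) = single K 2 \<one>"
  by (simp_all add: gens_def numeral_2_eq_2)

lemma dot_2:
  assumes "x \<in> carrier (free_module A 2)" "y \<in> carrier (free_module A 2)"
  shows "dot A 2 x y = (\<lambda>i. example_mult K (x 0) (y 0) i \<oplus> example_mult K (x 1) (y 1) i)"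
proof -
  have c: "x i \<in> carrier A" "y i \<in> carrier A" for i
    using assms unfolding free_module_simps by blast+
  have m: "x i \<otimes>\<^bsub>A\<^esub> y i \<in> carrier A" for i by (rule A.m_closed[OF c])
  have "dot A 2 x y = x 1 \<otimes>\<^bsub>A\<^esub> y 1 \<oplus>\<^bsub>A\<^esub> (\<Oplus>\<^bsub>A\<^esub>i\<in>{..<Suc 0}. x i \<otimes>\<^bsub>A\<^esub> y i)"
    unfolding dot_def numeral_2_eq_2 One_nat_def by (rule A.finsum_lessThan_Suc[OF m])
  also have "(\<Oplus>\<^bsub>A\<^esub>i\<in>{..<Suc 0}. x i \<otimes>\<^bsub>A\<^esub> y i) = x 0 \<otimes>\<^bsub>A\<^esub> y 0 \<oplus>\<^bsub>A\<^esub> (\<Oplus>\<^bsub>A\<^esub>i\<in>{..<0::nat}. x i \<otimes>\<^bsub>A\<^esub> y i)"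
    by (rule A.finsum_lessThan_Suc[OF m])
  also have "\<dots> = x 0 \<otimes>\<^bsub>A\<^esub> y 0"
    unfolding lessThan_0 A.finsum_empty by (rule A.r_zero[OF m])
  also have "x 1 \<otimes>\<^bsub>A\<^esub> y 1 \<oplus>\<^bsub>A\<^esub> x 0 \<otimes>\<^bsub>A\<^esub> y 0 = x 0 \<otimes>\<^bsub>A\<^esub> y 0 \<oplus>\<^bsub>A\<^esub> x 1 \<otimes>\<^bsub>A\<^esub> y 1"
    by (rule A.a_comm[OF m m])
  finally show ?thesis by simp
qed

lemma dot_gens:
  assumes x: "x \<in> carrier (free_module A 2)"
  shows "dot A 2 x gens 0 = \<zero>" "dot A 2 x gens 1 = x 0 0" "dot A 2 x gens 2 = x 1 0"
    "dot A 2 x gens 3 = \<zero>" "dot A 2 x gens 4 = \<zero>" "dot A 2 x gens 5 = \<zero>" "dot A 2 x gens 6 = \<zero>"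
    "dot A 2 x gens 7 = x 0 3 \<oplus> x 1 5" "dot A 2 x gens 8 = x 0 4 \<oplus> x 1 6"
proof -
  have c: "x i j \<in> carrier K" for i j using x by auto
  show "dot A 2 x gens 0 = \<zero>" "dot A 2 x gens 1 = x 0 0" "dot A 2 x gens 2 = x 1 0"
    "dot A 2 x gens 3 = \<zero>" "dot A 2 x gens 4 = \<zero>" "dot A 2 x gens 5 = \<zero>" "dot A 2 x gens 6 = \<zero>"
    "dot A 2 x gens 7 = x 0 3 \<oplus> x 1 5" "dot A 2 x gens 8 = x 0 4 \<oplus> x 1 6"
    unfolding dot_2[OF x gens_closed] gens_eqs example_mult_eqs
    by (simp_all add: c single_def)
qed

text \<open>
  The generator \<open>u\<^sub>1\<close> alone already yields \<open>w\<^sub>1 = y\<^sub>1 u\<^sub>1\<close> and \<open>w\<^sub>2 = y\<^sub>2 u\<^sub>1\<close>.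
\<close>

lemma ideal_of_gens: "{dot A 2 x gens | x. x \<in> carrier (free_module A 2)} = I"
proof (intro equalityI subsetI)
  fix a assume "a \<in> {dot A 2 x gens | x. x \<in> carrier (free_module A 2)}"
  then obtain x where x: "x \<in> carrier (free_module A 2)" "a = dot A 2 x gens" by blast
  then show "a \<in> I"
    using A.dot_closed[OF x(1) gens_closed] dot_gens(1,4-7)[OF x(1)] unfolding I_def x(2) by blast
next
  fix a assume a: "a \<in> I"
  have c: "a i \<in> carrier K" for i using a by (auto simp: I_def)
  define x where "x i = (if i = 0 then (\<lambda>j. if j = 0 then a 1 else if j = 3 then a 7
    else if j = 4 then a 8 else \<zero>) else if i = 1 then single K 0 (a 2) else (\<lambda>_. \<zero>))" for i :: nat
  have x: "x \<in> carrier (free_module A 2)" using c by (auto simp: x_def single_def)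
  have "a = dot A 2 x gens"
  proof (rule example_eqI)
    show "a \<in> carrier A" using a by (simp add: I_def)
    show "dot A 2 x gens \<in> carrier A" by (rule A.dot_closed[OF x gens_closed])
  qed (use a c in \<open>simp_all only: dot_gens[OF x]\<close>, simp_all add: I_def x_def single_def)
  then show "a \<in> {dot A 2 x gens | x. x \<in> carrier (free_module A 2)}" using x by blast
qed

abbreviation M :: "(nat \<Rightarrow> 'k, nat \<Rightarrow> nat \<Rightarrow> 'k) module" where "M \<equiv> embed_ideal A I"

text \<open>
  The conditions of the criterion hold because \<open>y \<mapsto> (u\<^sub>1 y, u\<^sub>2 y)\<close> is an isomorphism from the span of the
  \<open>y\<^sub>i\<close> to \<open>W\<^sup>2\<close>: by injectivity no combination of the \<open>y\<^sub>i\<close> annihilates both generators, and by surjectivity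
  every pair in \<open>W\<^sup>2\<close> is a multiple of \<open>(u\<^sub>1, u\<^sub>2)\<close>.
\<close>

lemma torsionfree_example: "torsionfree 3 A M"
  unfolding ideal_of_gens[symmetric]
proof (rule A.torsionfree_3_embed_idealI)
  show "\<exists>m f. f \<in> mhom A (free_module A m) (free_module A n) \<and> f ` carrier (free_module A m) = U"
    if "submodule U A (free_module A n)" for U n
    using that by (rule submodule_free_module_generated)
  show "gens \<in> carrier (free_module A 2)" by (rule gens_closed)
  have gA: "gens i \<in> carrier A" for i using gens_closed unfolding free_module_simps by blast
  show "gens i \<otimes>\<^bsub>A\<^esub> gens j = \<zero>\<^bsub>A\<^esub>" for i j
  proof (rule example_eqI[OF A.m_closed[OF gA gA] A.zero_closed])
  qed (simp_all add: example_mult_eqs gens_def single_def)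
  show "x i \<in> J" if x: "x \<in> carrier (free_module A 2)" and 0: "dot A 2 x gens = \<zero>\<^bsub>A\<^esub>" for x i
  proof -
    have "x 0 0 = \<zero>" "x 1 0 = \<zero>" using dot_gens(2,3)[OF x] 0 by simp_all
    moreover have "x i = (\<lambda>_. \<zero>)" if "2 \<le> i" using x that by simp
    ultimately have "x i 0 = \<zero>" by (cases "i = 0"; cases "i = 1") auto
    then show ?thesis using x by (simp add: J_def)
  qed
  show "\<exists>x\<in>carrier (free_module A 2). a = dot A 2 x gens"
    if a: "a \<in> carrier A" and 0: "\<And>i. a \<otimes>\<^bsub>A\<^esub> gens i = \<zero>\<^bsub>A\<^esub>" for a
  proof -
    have c: "a i \<in> carrier K" for i using a by auto
    have "example_mult K a (gens 0) j = \<zero>" "example_mult K a (gens 1) j = \<zero>" for j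
      using fun_cong[OF 0, of 0 j] fun_cong[OF 0, of 1 j] by simp_all
    from this(1)[of 1] this(1)[of 7] this(1)[of 8] this(2)[of 7] this(2)[of 8]
    have "a \<in> I"
      using a c unfolding gens_eqs example_mult_eqs by (simp add: single_def I_def)
    then show ?thesis unfolding ideal_of_gens[symmetric] by blast
  qed
  show "\<exists>c\<in>carrier A. a = (\<lambda>i. c \<otimes>\<^bsub>A\<^esub> gens i)"
    if a: "a \<in> carrier (free_module A 2)"
      and 0: "\<And>x. x \<in> carrier (free_module A 2) \<Longrightarrow> dot A 2 x gens = \<zero>\<^bsub>A\<^esub> \<Longrightarrow> dot A 2 x a = \<zero>\<^bsub>A\<^esub>"
    for a
  proof -
    have c: "a i j \<in> carrier K" for i j using a by auto
    have rel: "example_mult K p (a 0) j \<oplus> example_mult K q (a 1) j = \<zero>"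
      if p: "p \<in> carrier A" and q: "q \<in> carrier A" and p0: "p 0 = \<zero>" "q 0 = \<zero>"
        and w: "p 3 \<oplus> q 5 = \<zero>" "p 4 \<oplus> q 6 = \<zero>" for p q j
    proof -
      define x where "x i = (if i = 0 then p else if i = 1 then q else (\<lambda>_. \<zero>))" for i :: nat
      have x: "x \<in> carrier (free_module A 2)" using p q by (auto simp: x_def)
      have x01: "x 0 = p" "x 1 = q" by (simp_all add: x_def)
      have "dot A 2 x gens = \<zero>\<^bsub>A\<^esub>"
        by (rule example_eqI[OF A.dot_closed[OF x gens_closed] A.zero_closed])
          (simp_all only: dot_gens[OF x] x01 p0 w example_algebra_simps)
      from fun_cong[OF 0[OF x this], of j] show ?thesis
        unfolding dot_2[OF x a] x01 by simp
    qed
    have sA: "single K i \<one> \<in> carrier A" "single K i (\<ominus> \<one>) \<in> carrier A"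
      if "i < 9" for i using that by (auto simp: single_def)
    have zA: "(\<lambda>_. \<zero>) \<in> carrier A" by simp
    \<comment> \<open>the relations \<open>u\<^sub>1 u\<^sub>1 = u\<^sub>2 u\<^sub>1 = y\<^sub>3 u\<^sub>1 = y\<^sub>4 u\<^sub>1 = 0\<close>\<close>
    have r0: "example_mult K (single K i \<one>) (a 0) j = \<zero>" if "i \<in> {1, 2, 5, 6}" for i j
    proof -
      have "example_mult K (single K i \<one>) (a 0) j \<oplus> example_mult K (\<lambda>_. \<zero>) (a 1) j = \<zero>"
        using that by (intro rel sA zA) (auto simp: single_def)
      moreover have "example_mult K (\<lambda>_. \<zero>) (a 1) j = \<zero>" using c by (auto simp: example_mult_def)
      moreover have "example_mult K (single K i \<one>) (a 0) j \<in> carrier K"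
        using c by (auto simp: example_mult_def single_def)
      ultimately show ?thesis by simp
    qed
    \<comment> \<open>the relations \<open>u\<^sub>1 u\<^sub>2 = u\<^sub>2 u\<^sub>2 = y\<^sub>1 u\<^sub>2 = y\<^sub>2 u\<^sub>2 = 0\<close>\<close>
    have r1: "example_mult K (single K i \<one>) (a 1) j = \<zero>" if "i \<in> {1, 2, 3, 4}" for i j
    proof -
      have "example_mult K (\<lambda>_. \<zero>) (a 0) j \<oplus> example_mult K (single K i \<one>) (a 1) j = \<zero>"
        using that by (intro rel sA zA) (auto simp: single_def)
      moreover have "example_mult K (\<lambda>_. \<zero>) (a 0) j = \<zero>" using c by (auto simp: example_mult_def)
      moreover have "example_mult K (single K i \<one>) (a 1) j \<in> carrier K"
        using c by (auto simp: example_mult_def single_def)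
      ultimately show ?thesis by simp
    qed
    have a0: "a 0 0 = \<zero>" "a 0 3 = \<zero>" "a 0 4 = \<zero>" "a 0 5 = \<zero>" "a 0 6 = \<zero>" "a 0 2 = \<zero>"
      using r0[of 1 1] r0[of 1 7] r0[of 1 8] r0[of 2 7] r0[of 2 8] r0[of 5 7] c
      unfolding example_mult_eqs by (simp_all add: single_def)
    have a1: "a 1 0 = \<zero>" "a 1 3 = \<zero>" "a 1 4 = \<zero>" "a 1 5 = \<zero>" "a 1 6 = \<zero>" "a 1 1 = \<zero>"
      using r1[of 1 1] r1[of 1 7] r1[of 1 8] r1[of 2 7] r1[of 2 8] r1[of 3 7] c
      unfolding example_mult_eqs by (simp_all add: single_def)
    \<comment> \<open>The relation \<open>y\<^sub>1 u\<^sub>1 - y\<^sub>3 u\<^sub>2 = 0\<close> equates the two remaining linear coefficients.\<close>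
    have "example_mult K (single K 3 \<one>) (a 0) 7 \<oplus> example_mult K (single K 5 (\<ominus> \<one>)) (a 1) 7 = \<zero>"
      by (intro rel sA) (auto simp: single_def r_neg)
    then have "a 0 1 \<oplus> \<ominus> a 1 2 = \<zero>"
      using c unfolding example_mult_eqs by (simp add: single_def l_minus)
    then have eq: "a 0 1 = a 1 2"
      using c by (metis a_inv_closed minus_equality minus_minus)
    \<comment> \<open>The constant term of \<open>s\<close> produces the linear part of \<open>a\<close>, and its \<open>y\<^sub>i\<close>-coordinates produce the part in \<open>W\<^sup>2\<close>.\<close>
    define s where "s = (\<lambda>i::nat. if i = 0 then a 0 1 else if i = 3 then a 0 7 else if i = 4 then a 0 8
      else if i = 5 then a 1 7 else if i = 6 then a 1 8 else \<zero> :: 'k)"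
    have sA': "s \<in> carrier A" using c by (auto simp: s_def)
    have aA: "a i \<in> carrier A" for i using a unfolding free_module_simps by blast
    have "a i = s \<otimes>\<^bsub>A\<^esub> gens i" for i
    proof -
      consider "i = 0" | "i = 1" | "2 \<le> i" by linarith
      then show ?thesis
      proof cases
        case 1
        show ?thesis unfolding 1
        proof (rule example_eqI[OF aA A.m_closed[OF sA' gA]])
        qed (use a0 c in \<open>simp_all add: example_mult_eqs gens_eqs single_def s_def\<close>)
      next
        case 2
        show ?thesis unfolding 2
        proof (rule example_eqI[OF aA A.m_closed[OF sA' gA]])
        qed (use a1 c eq in \<open>simp_all add: example_mult_eqs gens_eqs single_def s_def\<close>)
      next
        case 3
        then have "a i = (\<lambda>_. \<zero>)" "gens i = (\<lambda>_. \<zero>)" using a by (auto simp: gens_def)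
        then show ?thesis using sA' by (auto simp: example_mult_def)
      qed
    qed
    then show ?thesis using sA' by blast
  qed
qed

lemmas presentation = A.embed_ideal_presentation[OF gens_closed, unfolded ideal_of_gens]

lemma module_M: "module A M"
  by (rule presentation(6))

text \<open>
  If \<open>M\<close> were projective, \<open>A\<^sup>2 \<rightarrow> M\<close> would have a section. It would send \<open>u\<^sub>1\<close> to a vector whose first
  entry has the constant coordinate \<open>1\<close>, and such a vector is not annihilated by \<open>u\<^sub>1\<close>.
\<close>

lemma not_projective_M: "\<not> projective A M"
proof
  assume P: "projective A M"
  interpret M: module A M by (rule module_M)
  let ?F = "free_module A 2"
  define p where "p = (\<lambda>x\<in>carrier ?F. \<lambda>i::nat. if i = 0 then dot A 2 x gens else \<zero>\<^bsub>A\<^esub>)"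
  note pres = presentation[folded p_def]
  let ?id = "\<lambda>x\<in>carrier M. x"
  have id: "?id \<in> mhom A M M" by (rule mhom_restrictI[OF module_M]) auto
  have l: "lmodule A ?F" "lmodule A M"
    using lmodule_iff_module[OF cring_example] A.module_free_module module_M by blast+
  obtain h where h: "h \<in> mhom A M ?F" and ph: "\<And>x. x \<in> carrier M \<Longrightarrow> p (h x) = ?id x"
    using conjunct2[OF P[unfolded projective_def], rule_format, of ?F M p ?id] l pres(2,3) id by blast
  define e where "e = single A 0 (single K 1 \<one>)"
  have sA: "single K 1 \<one> \<in> carrier A" by (intro single_closed) auto
  have eM: "e \<in> carrier M" using sA by (auto simp: embed_ideal_def e_def I_def single_def)
  have y: "h e \<in> carrier ?F" by (rule mhomD(1)[OF h eM])
  have "p (h e) = e" using ph[OF eM] eM by simp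
  then have "dot A 2 (h e) gens = single K 1 \<one>"
    using fun_cong[of "p (h e)" e 0] y unfolding p_def restrict_apply'[OF y] by (simp add: e_def)
  then have 1: "h e 0 0 = \<one>" using dot_gens(2)[OF y] by simp
  have "single K 1 \<one> \<odot>\<^bsub>M\<^esub> e = \<zero>\<^bsub>M\<^esub>"
  proof -
    have "example_mult K (single K 1 \<one>) (single K 1 \<one>) j = \<zero>" for j
      by (rule nat_cases_9[of j]) (auto simp: example_mult_eqs single_def)
    moreover have "example_mult K (single K 1 \<one>) (\<lambda>_. \<zero>) j = \<zero>" for j
      by (auto simp: example_mult_def single_def)
    ultimately show ?thesis by (auto simp: embed_ideal_def e_def single_def fun_eq_iff)
  qed
  then have "h \<zero>\<^bsub>M\<^esub> = single K 1 \<one> \<odot>\<^bsub>?F\<^esub> h e" using mhomD(3)[OF h sA eM] by simp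
  then have "\<zero>\<^bsub>?F\<^esub> = single K 1 \<one> \<odot>\<^bsub>?F\<^esub> h e"
    using mhom_zero[OF module_M A.module_free_module h] by simp
  from fun_cong[OF fun_cong[OF this, of 0], of 1]
  have "example_mult K (single K 1 \<one>) (h e 0) 1 = \<zero>" by simp
  then show False
    unfolding example_mult_eqs 1 using y by (simp add: single_def)
qed

lemma ops_M: "add M = (\<lambda>x y i. x i \<oplus>\<^bsub>A\<^esub> y i)" "zero M = (\<lambda>i. \<zero>\<^bsub>A\<^esub>)"
    "smult M = (\<lambda>a x i. a \<otimes>\<^bsub>A\<^esub> x i)"
  by (simp_all add: embed_ideal_def)

definition JM :: "(nat \<Rightarrow> nat \<Rightarrow> 'k) set" where "JM = {x \<in> carrier M. x 0 \<in> W}"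

lemma M_D:
  assumes "x \<in> carrier M"
  shows "x 0 \<in> carrier A" "x 0 \<in> I" "x 0 0 = \<zero>" "x 0 3 = \<zero>" "x 0 4 = \<zero>" "x 0 5 = \<zero>" "x 0 6 = \<zero>"
    "\<And>i. 0 < i \<Longrightarrow> x i = (\<lambda>_. \<zero>)" "\<And>i j. x i j \<in> carrier K"
  using assms by (auto simp: embed_ideal_def I_def)

lemma single_in_M: "a \<in> I \<Longrightarrow> single A 0 a \<in> carrier M"
  by (auto simp: embed_ideal_def I_def single_def)

lemma M_eqI: "x \<in> carrier M \<Longrightarrow> y \<in> carrier M \<Longrightarrow> x 0 = y 0 \<Longrightarrow> x = y"
  using M_D(8) by (metis ext neq0_conv)

text \<open>
  An element of \<open>W\<close> is a multiple of \<open>u\<^sub>1\<close> by a combination of \<open>y\<^sub>1\<close> and \<open>y\<^sub>2\<close>.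
\<close>

lemma ideal_smult_J_M: "ideal_smult J M (carrier M) = JM"
proof (intro equalityI subsetI)
  interpret M: module A M by (rule module_M)
  fix x assume "x \<in> ideal_smult J M (carrier M)"
  then show "x \<in> JM"
  proof induction
    case (smult a x)
    have "x 0 \<in> J" using M_D(1,3)[OF smult(2)] by (simp add: J_def)
    then have "a \<otimes>\<^bsub>A\<^esub> x 0 \<in> W" by (rule JJ_W[OF smult(1)])
    moreover have "a \<odot>\<^bsub>M\<^esub> x \<in> carrier M" using smult by (intro M.smult_closed) (auto simp: J_def)
    ultimately show ?case unfolding JM_def ops_M by blast
  next
    case (add x y)
    then have "x \<oplus>\<^bsub>M\<^esub> y \<in> carrier M" by (intro M.a_closed) (auto simp: JM_def)
    then show ?case using add by (auto simp: JM_def ops_M W_def)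
  qed
next
  interpret M: module A M by (rule module_M)
  fix x assume x: "x \<in> JM"
  then have xM: "x \<in> carrier M" and xW: "x 0 \<in> W" by (auto simp: JM_def)
  let ?u = "single A 0 (single K 1 \<one>)"
  have u: "?u \<in> carrier M" by (rule single_in_M) (auto simp: I_def single_def)
  let ?a = "(\<lambda>i. if i = 3 then x 0 7 else if i = 4 then x 0 8 else \<zero>)"
  have aJ: "?a \<in> J" using M_D(9)[OF xM] by (auto simp: J_def)
  then have au: "?a \<odot>\<^bsub>M\<^esub> ?u \<in> carrier M" by (intro M.smult_closed u) (auto simp: J_def)
  have "x = ?a \<odot>\<^bsub>M\<^esub> ?u"
  proof (rule M_eqI[OF xM au])
    have "x 0 = ?a \<otimes>\<^bsub>A\<^esub> single K 1 \<one>"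
    proof (rule example_eqI)
      show "x 0 \<in> carrier A" by (rule M_D(1)[OF xM])
      show "?a \<otimes>\<^bsub>A\<^esub> single K 1 \<one> \<in> carrier A"
        using aJ by (intro A.m_closed single_closed) (auto simp: J_def)
    qed (use xW M_D(9)[OF xM] in \<open>simp_all add: example_mult_eqs single_def W_def\<close>)
    then show "x 0 = (?a \<odot>\<^bsub>M\<^esub> ?u) 0" by (simp add: ops_M)
  qed
  then show "x \<in> ideal_smult J M (carrier M)"
    using ideal_smult.smult[OF aJ u, of M] by simp
qed

lemma ideal_smult_J_JM: "ideal_smult J M JM = {\<zero>\<^bsub>M\<^esub>}"
proof -
  interpret M: module A M by (rule module_M)
  have z: "a \<odot>\<^bsub>M\<^esub> x = \<zero>\<^bsub>M\<^esub>" if a: "a \<in> J" and x: "x \<in> JM" for a x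
  proof (rule M_eqI)
    have xM: "x \<in> carrier M" "x 0 \<in> W" using x by (auto simp: JM_def)
    have aA: "a \<in> carrier A" using a by (simp add: J_def)
    show "a \<odot>\<^bsub>M\<^esub> x \<in> carrier M" by (rule M.smult_closed[OF aA xM(1)])
    have "a \<otimes>\<^bsub>A\<^esub> x 0 = x 0 \<otimes>\<^bsub>A\<^esub> a" by (rule A.m_comm[OF aA M_D(1)[OF xM(1)]])
    then show "(a \<odot>\<^bsub>M\<^esub> x) 0 = \<zero>\<^bsub>M\<^esub> 0" using WJ_0[OF xM(2) a] by (simp add: ops_M)
  qed (rule M.zero_closed)
  show ?thesis
  proof (intro equalityI subsetI)
    fix x assume "x \<in> ideal_smult J M JM"
    then show "x \<in> {\<zero>\<^bsub>M\<^esub>}"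
    proof induction
      case (smult a x)
      then show ?case using z by blast
    next
      case (add x y)
      then show ?case by simp
    qed
  next
    fix x assume "x \<in> {\<zero>\<^bsub>M\<^esub>}"
    moreover have zz: "\<zero>\<^bsub>A\<^esub> \<in> J" "\<zero>\<^bsub>M\<^esub> \<in> JM"
      using M.zero_closed by (auto simp: J_def JM_def W_def ops_M)
    ultimately show "x \<in> ideal_smult J M JM"
      using ideal_smult.smult[OF zz, of M] z[OF zz] by simp
  qed
qed

lemma submodule_JM: "submodule JM A M"
proof -
  interpret M: module A M by (rule module_M)
  have smult: "a \<odot>\<^bsub>M\<^esub> x \<in> JM" if a: "a \<in> carrier A" and x: "x \<in> JM" for a x
  proof -
    have xM: "x \<in> carrier M" and x0: "x 0 \<in> carrier A" and xW: "\<And>i. i < 7 \<Longrightarrow> x 0 i = \<zero>"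
      using x by (auto simp: JM_def W_def)
    have "(a \<otimes>\<^bsub>A\<^esub> x 0) i = \<zero>" if "i < 7" for i
      using that xW by (intro example_mult_vanishes[OF a x0]) auto
    then have "a \<otimes>\<^bsub>A\<^esub> x 0 \<in> W" unfolding W_def using A.m_closed[OF a x0] by blast
    then show ?thesis using M.smult_closed[OF a xM] unfolding JM_def ops_M by blast
  qed
  show ?thesis
  proof (rule M.submoduleI)
    show "\<zero>\<^bsub>M\<^esub> \<in> JM" using M.zero_closed by (auto simp: JM_def W_def ops_M)
  next
    fix x assume x: "x \<in> JM"
    then have xM: "x \<in> carrier M" by (simp add: JM_def)
    have "\<ominus>\<^bsub>M\<^esub> x = (\<ominus>\<^bsub>A\<^esub> \<one>\<^bsub>A\<^esub>) \<odot>\<^bsub>M\<^esub> x"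
      using M.smult_l_minus[OF A.one_closed xM] M.smult_one[OF xM] by simp
    then show "\<ominus>\<^bsub>M\<^esub> x \<in> JM" using smult[OF A.a_inv_closed[OF A.one_closed] x] by simp
  next
    fix x y assume "x \<in> JM" "y \<in> JM"
    then show "x \<oplus>\<^bsub>M\<^esub> y \<in> JM" unfolding ideal_smult_J_M[symmetric] by (rule ideal_smult.add)
  next
    show "a \<odot>\<^bsub>M\<^esub> x \<in> JM" if "a \<in> carrier A" "x \<in> JM" for a x using that by (rule smult)
  qed (auto simp: JM_def)
qed

text \<open>
  The coordinates on \<open>M\<close> are those of \<open>w\<^sub>2, w\<^sub>1, u\<^sub>2, u\<^sub>1\<close> in this order.
\<close>

lemma has_length_M: "has_length A M 4"
proof -
  interpret M: module A M by (rule module_M)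
  let ?c = "\<lambda>i::nat. if i = 0 then 8 else if i = 1 then 7 else if i = 2 then 2 else 1 :: nat"
  show ?thesis
  proof (rule has_length_by_coordinates[OF field_axioms M.abelian_group_axioms,
        where \<xi> = "\<lambda>x i. x 0 (?c i)"])
    show "a \<odot>\<^bsub>M\<^esub> x \<in> carrier M" if "a \<in> carrier A" "x \<in> carrier M" for a x
      using that by (rule M.smult_closed)
    show "x 0 (?c i) \<in> carrier K" if "x \<in> carrier M" for x i
      using that by (rule M_D(9))
    show "(x \<oplus>\<^bsub>M\<^esub> y) 0 (?c i) = x 0 (?c i) \<oplus> y 0 (?c i)" for x y i
      by (simp add: ops_M)
    show "x = \<zero>\<^bsub>M\<^esub>" if x: "x \<in> carrier M" and 0: "\<And>i. i < 4 \<Longrightarrow> x 0 (?c i) = \<zero>" for x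
    proof (rule M_eqI[OF x M.zero_closed])
      have "x 0 = \<zero>\<^bsub>A\<^esub>"
      proof (rule example_eqI[OF M_D(1)[OF x] A.zero_closed])
      qed (use 0[of 0] 0[of 1] 0[of 2] 0[of 3] M_D[OF x] in simp_all)
      then show "x 0 = \<zero>\<^bsub>M\<^esub> 0" by (simp add: ops_M)
    qed
    show "(a \<odot>\<^bsub>M\<^esub> x) 0 (?c j) = \<zero>"
      if a: "a \<in> carrier A" and x: "x \<in> carrier M"
        and 0: "\<And>j. i \<le> j \<Longrightarrow> j < 4 \<Longrightarrow> x 0 (?c j) = \<zero>" and j: "i \<le> j" "j < 4" for a x i j
    proof -
      have "j = 0 \<or> j = 1 \<or> j = 2 \<or> j = 3" using j(2) by linarith
      then show ?thesis
        using 0[of j] 0[of 2] 0[of 3] j M_D[OF x] a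
        by (auto simp: ops_M example_mult_eqs simp del: One_nat_def)
    qed
    show "\<exists>a\<in>carrier A. \<forall>x\<in>carrier M. \<forall>i<4. (a \<odot>\<^bsub>M\<^esub> x) 0 (?c i) = c \<otimes> x 0 (?c i)"
      if c: "c \<in> carrier K" for c
      using scalar_action[OF c M_D(1)] single_closed[OF c, of 0]
      by (intro bexI[of _ "single K 0 c"]) (simp_all add: ops_M)
    show "\<exists>x\<in>carrier M. x 0 (?c i) \<noteq> \<zero> \<and> (\<forall>j. i < j \<and> j < 4 \<longrightarrow> x 0 (?c j) = \<zero>)"
      if i: "i < 4" for i
    proof (intro bexI[of _ "single A 0 (single K (?c i) \<one>)"] conjI allI impI)
      show "single A 0 (single K (?c i) \<one>) \<in> carrier M"
        by (rule single_in_M) (auto simp: I_def single_def)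
    qed (auto simp: single_def)
  qed
qed

lemma dimension_vector_M: "has_dimension_vector A M 2 2"
proof -
  interpret M: module A M by (rule module_M)
  have "has_length A (quot_module M JM) 2"
  proof (rule has_length_quotient_by_coordinates[OF field_axioms module_M submodule_JM,
        where \<xi> = "\<lambda>x i. x 0 (Suc i)"])
    show "x \<in> JM \<longleftrightarrow> (\<forall>i<2. x 0 (Suc i) = \<zero>)" if x: "x \<in> carrier M" for x
    proof
      assume "x \<in> JM"
      then show "\<forall>i<2. x 0 (Suc i) = \<zero>" by (auto simp: JM_def W_def)
    next
      assume *: "\<forall>i<2. x 0 (Suc i) = \<zero>"
      have "x 0 1 = \<zero>" "x 0 2 = \<zero>"
        using spec[OF *, of 0] spec[OF *, of 1] by (simp_all add: numeral_2_eq_2)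
      then have "x 0 i = \<zero>" if "i < 7" for i
        by (rule_tac nat_cases_9[of i]) (use that M_D[OF x] in simp_all)
      then show "x \<in> JM" using x M_D(1)[OF x] by (auto simp: JM_def W_def)
    qed
    show "x 0 (Suc i) \<in> carrier K" if "x \<in> carrier M" for x i
      using that by (rule M_D(9))
    show "(x \<oplus>\<^bsub>M\<^esub> y) 0 (Suc i) = x 0 (Suc i) \<oplus> y 0 (Suc i)" for x y i
      by (simp add: ops_M)
    show "(a \<odot>\<^bsub>M\<^esub> x) 0 (Suc j) = \<zero>"
      if a: "a \<in> carrier A" and x: "x \<in> carrier M"
        and 0: "\<And>j. i \<le> j \<Longrightarrow> j < 2 \<Longrightarrow> x 0 (Suc j) = \<zero>" and j: "i \<le> j" "j < 2" for a x i j
      using 0[OF j] M_D(3)[OF x] a j by (simp add: ops_M example_mult_def)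
    show "\<exists>a\<in>carrier A. \<forall>x\<in>carrier M. \<forall>i<2. (a \<odot>\<^bsub>M\<^esub> x) 0 (Suc i) = c \<otimes> x 0 (Suc i)"
      if c: "c \<in> carrier K" for c
      using scalar_action[OF c M_D(1)] single_closed[OF c, of 0]
      by (intro bexI[of _ "single K 0 c"]) (simp_all add: ops_M)
    show "\<exists>x\<in>carrier M. x 0 (Suc i) \<noteq> \<zero> \<and> (\<forall>j. i < j \<and> j < 2 \<longrightarrow> x 0 (Suc j) = \<zero>)"
      if i: "i < 2" for i
    proof (intro bexI[of _ "single A 0 (single K (Suc i) \<one>)"] conjI allI impI)
      show "single A 0 (single K (Suc i) \<one>) \<in> carrier M"
        using i by (intro single_in_M) (auto simp: I_def single_def)
    qed (auto simp: single_def)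
  qed
  moreover have "has_length A (M\<lparr>carrier := JM\<rparr>) 2"
  proof -
    let ?N = "M\<lparr>carrier := JM\<rparr>"
    interpret N: module A ?N by (rule submodule.submodule_is_module[OF submodule_JM module_M])
    have NM: "x \<in> carrier M" if "x \<in> JM" for x using that by (simp add: JM_def)
    show ?thesis
    proof (rule has_length_by_coordinates[OF field_axioms N.abelian_group_axioms,
          where \<xi> = "\<lambda>x i. x 0 (i + 7)"])
      show "a \<odot>\<^bsub>?N\<^esub> x \<in> carrier ?N" if "a \<in> carrier A" "x \<in> carrier ?N" for a x
        using that by (rule N.smult_closed)
      show "x 0 (i + 7) \<in> carrier K" if "x \<in> carrier ?N" for x i
        using M_D(9)[OF NM] that by simp
      show "(x \<oplus>\<^bsub>?N\<^esub> y) 0 (i + 7) = x 0 (i + 7) \<oplus> y 0 (i + 7)" for x y i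
        by (simp add: ops_M)
      show "x = \<zero>\<^bsub>?N\<^esub>" if x: "x \<in> carrier ?N" and 0: "\<And>i. i < 2 \<Longrightarrow> x 0 (i + 7) = \<zero>" for x
      proof -
        have xM: "x \<in> carrier M" and xW: "x 0 \<in> W" using x by (auto simp: JM_def)
        have "x 0 = \<zero>\<^bsub>A\<^esub>"
        proof (rule example_eqI[OF M_D(1)[OF xM] A.zero_closed])
        qed (use 0[of 0] 0[of 1] xW in \<open>simp_all add: W_def\<close>)
        then have "x = \<zero>\<^bsub>M\<^esub>" by (intro M_eqI[OF xM M.zero_closed]) (simp add: ops_M)
        then show ?thesis by simp
      qed
      show "(a \<odot>\<^bsub>?N\<^esub> x) 0 (j + 7) = \<zero>"
        if a: "a \<in> carrier A" and x: "x \<in> carrier ?N"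
          and 0: "\<And>j. i \<le> j \<Longrightarrow> j < 2 \<Longrightarrow> x 0 (j + 7) = \<zero>" and j: "i \<le> j" "j < 2" for a x i j
      proof -
        have xW: "x 0 \<in> W" using x by (simp add: JM_def)
        have "j = 0 \<or> j = 1" using j by auto
        then show ?thesis using 0[OF j] xW a by (auto simp: example_mult_eqs W_def ops_M)
      qed
      show "\<exists>a\<in>carrier A. \<forall>x\<in>carrier ?N. \<forall>i<2. (a \<odot>\<^bsub>?N\<^esub> x) 0 (i + 7) = c \<otimes> x 0 (i + 7)"
        if c: "c \<in> carrier K" for c
        using scalar_action[OF c M_D(1)[OF NM]] single_closed[OF c, of 0]
        by (intro bexI[of _ "single K 0 c"]) (simp_all add: ops_M)
      show "\<exists>x\<in>carrier ?N. x 0 (i + 7) \<noteq> \<zero> \<and> (\<forall>j. i < j \<and> j < 2 \<longrightarrow> x 0 (j + 7) = \<zero>)"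
        if i: "i < 2" for i
      proof (intro bexI[of _ "single A 0 (single K (i + 7) \<one>)"] conjI allI impI)
        have "single A 0 (single K (i + 7) \<one>) \<in> carrier M"
          using i by (intro single_in_M) (auto simp: I_def single_def)
        then show "single A 0 (single K (i + 7) \<one>) \<in> carrier ?N"
          using i by (auto simp: JM_def W_def single_def)
      qed (auto simp: single_def)
    qed
  qed
  ultimately show ?thesis
    unfolding has_dimension_vector_def Let_def radical_example ideal_smult_J_M ideal_smult_J_JM by blast
qed

end

theorem proposition15p2:
  fixes K :: "'k ring"
  assumes "field K"
  shows "\<exists>(A :: ('k, nat \<Rightarrow> 'k) module) (M :: (nat \<Rightarrow> 'k, nat \<Rightarrow> nat \<Rightarrow> 'k) module).
    local_algebra K A \<and> cring A \<and> short A \<and> has_hilbert_type A 6 2 \<and>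
    lmodule A M \<and> (\<exists>n. has_length A M n) \<and> has_dimension_vector A M 2 2 \<and>
    \<not> projective A M \<and> torsionfree 3 A M"
proof -
  interpret example K by (rule example.intro[OF assms])
  have "lmodule A M" using lmodule_iff_module[OF cring_example] module_M by blast
  then show ?thesis
    using local_algebra_example cring_example short_example hilbert_type_example has_length_M
      dimension_vector_M not_projective_M torsionfree_example by blast
qed

end
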